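(* Let $F(s)$ be an $m\times m$-valued rational function with no pole at infinity, of McMillan degree $n$, with minimal realization $F(s)=C(sI_n-A)^{-1}B+D$, and assume $-1\notin\mathrm{spect}(D)$ whenever the matrices below are written. Let $\eta\in(1,\infty]$. Then $F(s)$ belongs to the class $\mathcal{HP}_\eta$ if and only if there exists an $n\times n$ Hermitian positive definite matrix $H$ such that, with $$M=\begin{pmatrix} A-B(I_m+D)^{-1}C & -\sqrt2\,B(I_m+D)^{-1}\\ \sqrt2\,(I_m+D)^{-1}C & (I_m+D)^{-1}(I_m-D)\\ I_n & 0\\ 0& I_m\end{pmatrix},\qquad W=\begin{pmatrix}0&0&-H&0\\ 0&\frac{1+\eta}{1-\eta}I_m&0&0\\ -H&0&0&0\\ 0&0&0&I_m\end{pmatrix},$$ the $(n+m)\times(n+m)$ matrix $M^*WM$ is positive semi-definite.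
   Context: $\mathbb{C}_R$ denotes the open right half of the complex plane. The realization has $A\in\mathbb{C}^{n\times n}$, $B\in\mathbb{C}^{n\times m}$, $C\in\mathbb{C}^{m\times n}$, $D\in\mathbb{C}^{m\times m}$, and it is minimal when $n$ equals the McMillan degree of $F$. For $\eta=\infty$, the quantities $\frac{1+\eta}{1-\eta}$ and $\frac{\eta+1}{\eta-1}$ are understood as their limits $-1$ and $1$. For a square matrix $M$ with $-1\notin\mathrm{spect}(M)$, the Cayley transform is $\mathcal{C}(M)=(I-M)(I+M)^{-1}=-I+2(I+M)^{-1}$; it is involutive whenever defined, and is applied to matrix-valued rational functions pointwise. $\mathcal{HB}_\eta$ is the set of $m\times m$-valued rational functions $G(s)$, analytic in $\mathbb{C}_R$, such that $I_m-\frac{\eta+1}{\eta-1}\,G(s)^*G(s)$ is positive semi-definite for all $s\in\mathbb{C}_R$. The class $\mathcal{HP}_\eta$ is $\mathcal{C}(\mathcal{HB}_\eta)$, the set of Cayley transforms of functions in $\mathcal{HB}_\eta$; equivalently, $F\in\mathcal{HP}_\eta$ if and only if $F$ is an $m\times m$-valued rational function, analytic in $\mathbb{C}_R$, with $F(s)+F(s)^*-\frac1\eta\left(F(s)^*F(s)+I_m\right)$ positive semi-definite for all $s\in\mathbb{C}_R$ (with $\frac1\eta=0$ for $\eta=\infty$). *)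

theory Defs
  imports
    "HOL-Analysis.Complex_Analysis_Basics"
    "HOL-Library.Extended_Real"
    "Jordan_Normal_Form.Schur_Decomposition"
    "Jordan_Normal_Form.Spectral_Radius"
    "Jordan_Normal_Form.Gauss_Jordan_Elimination"
    "Jordan_Normal_Form.DL_Submatrix"
begin

(* Matrices carry their dimensions as natural numbers, so that the state dimension n
   is an ordinary number that can be compared with the McMillan degree and may be 0
   (constant F). *)

abbreviation right_half_plane :: "complex set" where
  "right_half_plane \<equiv> {s. Re s > 0}"

definition pos_semidef :: "nat \<Rightarrow> complex mat \<Rightarrow> bool" where
  "pos_semidef k P \<longleftrightarrow> P \<in> carrier_mat k k \<and> mat_adjoint P = P \<and>
     (\<forall>v \<in> carrier_vec k. 0 \<le> Re ((P *\<^sub>v v) \<bullet>c v))"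

definition pos_def :: "nat \<Rightarrow> complex mat \<Rightarrow> bool" where
  "pos_def k P \<longleftrightarrow> P \<in> carrier_mat k k \<and> mat_adjoint P = P \<and>
     (\<forall>v \<in> carrier_vec k. v \<noteq> 0\<^sub>v k \<longrightarrow> 0 < Re ((P *\<^sub>v v) \<bullet>c v))"

(* Unspecified if P is not invertible; every use below is guarded by a condition on a
   spectrum. *)
definition inv_mat :: "complex mat \<Rightarrow> complex mat" where
  "inv_mat P = the (mat_inverse P)"

definition cayley :: "nat \<Rightarrow> complex mat \<Rightarrow> complex mat" where
  "cayley m P = (1\<^sub>m m - P) * inv_mat (1\<^sub>m m + P)"

(* Since p and q are coprime, the zeros of q are exactly the poles. The value at a pole
   is arbitrary; at every other point it is the value of the rational function, so there
   are no spurious values at removable singularities. *)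
definition rational_function :: "(complex \<Rightarrow> complex) \<Rightarrow> bool" where
  "rational_function f \<longleftrightarrow>
     (\<exists>p q. q \<noteq> 0 \<and> coprime p q \<and> (\<forall>s. poly q s \<noteq> 0 \<longrightarrow> f s = poly p s / poly q s))"

definition rational_matrix :: "nat \<Rightarrow> (complex \<Rightarrow> complex mat) \<Rightarrow> bool" where
  "rational_matrix m F \<longleftrightarrow> (\<forall>s. F s \<in> carrier_mat m m) \<and>
     (\<forall>i<m. \<forall>j<m. rational_function (\<lambda>s. F s $$ (i, j)))"

definition mat_analytic_on :: "nat \<Rightarrow> (complex \<Rightarrow> complex mat) \<Rightarrow> complex set \<Rightarrow> bool" where
  "mat_analytic_on m F S \<longleftrightarrow> (\<forall>i<m. \<forall>j<m. (\<lambda>s. F s $$ (i, j)) analytic_on S)"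

definition no_pole_at_infinity :: "nat \<Rightarrow> (complex \<Rightarrow> complex mat) \<Rightarrow> bool" where
  "no_pole_at_infinity m F \<longleftrightarrow>
     (\<forall>i<m. \<forall>j<m. \<exists>l. ((\<lambda>s. F s $$ (i, j)) \<longlongrightarrow> l) at_infinity)"

(* d is a common denominator of all minors, of every order, of F. *)
definition minors_denominator :: "nat \<Rightarrow> (complex \<Rightarrow> complex mat) \<Rightarrow> complex poly \<Rightarrow> bool" where
  "minors_denominator m F d \<longleftrightarrow> d \<noteq> 0 \<and>
     (\<forall>I J. I \<subseteq> {..<m} \<and> J \<subseteq> {..<m} \<and> card I = card J \<longrightarrow>
        (\<exists>p. \<forall>\<^sub>F s in cofinite. poly d s * det (submatrix (F s) I J) = poly p s))"

(* McMillan's definition: the degree of the least common denominator of all minors.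
   In this form it counts finite poles only, so it is the McMillan degree for F without
   a pole at infinity. *)
definition mcmillan_degree :: "nat \<Rightarrow> (complex \<Rightarrow> complex mat) \<Rightarrow> nat" where
  "mcmillan_degree m F = (LEAST k. \<exists>d. minors_denominator m F d \<and> degree d = k)"

definition realization ::
  "nat \<Rightarrow> nat \<Rightarrow> (complex \<Rightarrow> complex mat) \<Rightarrow>
   complex mat \<Rightarrow> complex mat \<Rightarrow> complex mat \<Rightarrow> complex mat \<Rightarrow> bool" where
  "realization m n F A B C D \<longleftrightarrow>
     A \<in> carrier_mat n n \<and> B \<in> carrier_mat n m \<and> C \<in> carrier_mat m n \<and> D \<in> carrier_mat m m \<and>
     (\<forall>s. s \<notin> spectrum A \<longrightarrow> F s = C * inv_mat (s \<cdot>\<^sub>m 1\<^sub>m n - A) * B + D)"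

definition minimal_realization ::
  "nat \<Rightarrow> nat \<Rightarrow> (complex \<Rightarrow> complex mat) \<Rightarrow>
   complex mat \<Rightarrow> complex mat \<Rightarrow> complex mat \<Rightarrow> complex mat \<Rightarrow> bool" where
  "minimal_realization m n F A B C D \<longleftrightarrow> realization m n F A B C D \<and> n = mcmillan_degree m F"

(* (eta + 1) / (eta - 1) and (1 + eta) / (1 - eta) for 1 < eta, with their limits 1 and
   -1 at infinity. *)
definition eta_ratio :: "ereal \<Rightarrow> real" where
  "eta_ratio \<eta> = (if \<eta> = \<infinity> then 1 else (real_of_ereal \<eta> + 1) / (real_of_ereal \<eta> - 1))"

definition eta_ratio_neg :: "ereal \<Rightarrow> real" where
  "eta_ratio_neg \<eta> = (if \<eta> = \<infinity> then - 1 else (1 + real_of_ereal \<eta>) / (1 - real_of_ereal \<eta>))"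

definition HB :: "nat \<Rightarrow> ereal \<Rightarrow> (complex \<Rightarrow> complex mat) set" where
  "HB m \<eta> = {G. rational_matrix m G \<and> mat_analytic_on m G right_half_plane \<and>
     (\<forall>s \<in> right_half_plane.
        pos_semidef m (1\<^sub>m m - complex_of_real (eta_ratio \<eta>) \<cdot>\<^sub>m (mat_adjoint (G s) * G s)))}"

(* The rational function F is the Cayley transform of the rational function G if they are
   related pointwise at all but finitely many s; in particular det (I + G) is not
   identically zero, so that the Cayley transform of G exists. *)
definition HP :: "nat \<Rightarrow> ereal \<Rightarrow> (complex \<Rightarrow> complex mat) set" where
  "HP m \<eta> = {F. rational_matrix m F \<and>
     (\<exists>G \<in> HB m \<eta>. \<forall>\<^sub>F s in cofinite. - 1 \<notin> spectrum (G s) \<and> F s = cayley m (G s))}"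

definition M_mat ::
  "nat \<Rightarrow> nat \<Rightarrow> complex mat \<Rightarrow> complex mat \<Rightarrow> complex mat \<Rightarrow> complex mat \<Rightarrow> complex mat" where
  "M_mat m n A B C D =
     (let R = inv_mat (1\<^sub>m m + D); r = complex_of_real (sqrt 2) in
      four_block_mat
        (A - B * R * C)              ((- r) \<cdot>\<^sub>m (B * R))
        (r \<cdot>\<^sub>m (R * C))              (R * (1\<^sub>m m - D))
      @\<^sub>r
      four_block_mat
        (1\<^sub>m n)                      (0\<^sub>m n m)
        (0\<^sub>m m n)                    (1\<^sub>m m))"

definition W_mat :: "nat \<Rightarrow> nat \<Rightarrow> ereal \<Rightarrow> complex mat \<Rightarrow> complex mat" where
  "W_mat m n \<eta> H =
     (let minusH = four_block_mat (- H) (0\<^sub>m n m) (0\<^sub>m m n) (0\<^sub>m m m) in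
      four_block_mat
        (four_block_mat
           (0\<^sub>m n n)  (0\<^sub>m n m)
           (0\<^sub>m m n)  (complex_of_real (eta_ratio_neg \<eta>) \<cdot>\<^sub>m 1\<^sub>m m))
        minusH
        minusH
        (four_block_mat
           (0\<^sub>m n n)  (0\<^sub>m n m)
           (0\<^sub>m m n)  (1\<^sub>m m)))"

end

theory Submission
  imports Defs
begin

text \<open>
Let \<open>G\<close> be the Cayley transform of \<open>F\<close>. The upper half \<open>(Ah, Bh, Ch, Dh)\<close> of \<open>M_mat\<close> is a realization of \<open>G\<close>
(\<open>cayley_transfer\<close>), and evaluated at a state \<open>x\<close> and an input \<open>u\<close>, with output \<open>y = Ch x + Dh u\<close>, the form of
the matrix in the theorem is
  \<open>|u|\<^sup>2 - \<kappa> |y|\<^sup>2 - 2 Re \<langle>H x, Ah x + Bh u\<rangle>\<close>  where  \<open>\<kappa> = eta_ratio \<eta>\<close>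
(\<open>lmi_form\<close>). The theorem is thus the bounded real lemma for \<open>G\<close>: the frequency domain condition
\<open>\<kappa> |G(s) u|\<^sup>2 \<le> |u|\<^sup>2\<close> on the right half plane, which is the content of \<open>HB\<close>, is equivalent to the existence of a positive
definite quadratic storage function.

From the matrix inequality to the class, insert the state \<open>x = (s - Ah)\<inverse> Bh u\<close>, for which \<open>Ah x + Bh u = s x\<close> and
the stored term is \<open>2 Re s \<langle>H x, x\<rangle> \<ge> 0\<close> (\<open>lmi_imp_HP\<close>).

The converse needs three things. First, minimality enters in the eigenvector form of Hautus: no eigenvector of \<open>A\<close>
is annihilated by \<open>C\<close>, and none of the adjoint of \<open>A\<close> by the adjoint of \<open>B\<close>. Every minor of \<open>F\<close> is a bordered
determinant divided by the characteristic polynomial, and such an eigenvector would make all bordered determinants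
vanish at the eigenvalue, so that a common denominator of degree \<open>n - 1\<close> would do
(\<open>minimal_realization_observable\<close>, \<open>minimal_realization_controllable\<close>). Feedback preserves both properties.

Second, a Hermitian storage matrix exists by the Kalman--Yakubovich--Popov lemma (\<open>kyp_lemma\<close>). Its proof projects
the matrix of the supply rate onto the cone of all storage rates plus semidefinite matrices, which is closed by
controllability. The residual is semidefinite; if it were not \<open>0\<close>, its range would contain a vector at which the
system oscillates with an imaginary frequency, or with the state at rest, and at which the supply rate is negative.
The frequency condition on the imaginary axis and at infinity, obtained by passing to the limit from the right half
plane, excludes this.

Third, the storage matrix is positive definite. Since the system is controllable and observable, eigenvalues of \<open>Ah\<close>
are poles of \<open>G\<close> (\<open>hautus_eigenvalue_is_pole\<close>), and \<open>G\<close> is bounded on the right half plane, so \<open>Ah\<close> is stable.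
A stable system loses all its storage, hence the storage is nonnegative (\<open>stable_lyapunov_nonneg\<close>), and a state of
zero storage would produce no output, which observability excludes (\<open>hat_storage_pos_def\<close>).
\<close>

section \<open>Adjoints, inner products and semidefinite matrices\<close>

abbreviation cvec :: "nat \<Rightarrow> complex vec set" where
  "cvec \<equiv> carrier_vec"

abbreviation cmat :: "nat \<Rightarrow> nat \<Rightarrow> complex mat set" where
  "cmat \<equiv> carrier_mat"

abbreviation adj :: "complex mat \<Rightarrow> complex mat" where
  "adj \<equiv> mat_adjoint"

abbreviation qform :: "complex mat \<Rightarrow> complex vec \<Rightarrow> real" where
  "qform P v \<equiv> Re ((P *\<^sub>v v) \<bullet>c v)"

abbreviation resolvent_mat :: "nat \<Rightarrow> complex mat \<Rightarrow> complex \<Rightarrow> complex mat" where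
  "resolvent_mat n A s \<equiv> inv_mat (s \<cdot>\<^sub>m 1\<^sub>m n - A)"

lemma mat_adjoint_dim[simp]: "dim_row (adj A) = dim_col A" "dim_col (adj A) = dim_row A"
  unfolding mat_adjoint_def by auto

lemma mat_adjoint_carrier[simp]: "A \<in> cmat n k \<Longrightarrow> adj A \<in> cmat k n"
  by (intro carrier_matI) auto

lemma mat_adjoint_index[simp]:
  fixes A :: "complex mat"
  shows "i < dim_col A \<Longrightarrow> j < dim_row A \<Longrightarrow> adj A $$ (i, j) = cnj (A $$ (j, i))"
  unfolding mat_adjoint_def by (simp add: mat_of_rows_index conjugate_complex_def)

lemma mat_adjoint_adjoint[simp]: "adj (adj (A :: complex mat)) = A"
  by (intro eq_matI) auto

lemma mult_mat_vec_index_sum: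
  "A \<in> cmat n k \<Longrightarrow> v \<in> cvec k \<Longrightarrow> i < n \<Longrightarrow> (A *\<^sub>v v) $ i = (\<Sum>j<k. A $$ (i, j) * v $ j)"
  by (auto simp: scalar_prod_def lessThan_atLeast0)

lemma mult_mat_index_sum:
  "A \<in> cmat n k \<Longrightarrow> B \<in> cmat k l \<Longrightarrow> i < n \<Longrightarrow> j < l \<Longrightarrow>
   (A * B) $$ (i, j) = (\<Sum>q<k. A $$ (i, q) * B $$ (q, j))"
  by (auto simp: scalar_prod_def lessThan_atLeast0)

lemma cscalar_sum:
  fixes v w :: "complex vec"
  assumes "w \<in> cvec n"
  shows "v \<bullet>c w = (\<Sum>i<n. v $ i * cnj (w $ i))"
  using assms by (auto simp: scalar_prod_def lessThan_atLeast0)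

lemma cscalar_add_left:
  fixes u v w :: "complex vec"
  assumes "u \<in> cvec n" "v \<in> cvec n" "w \<in> cvec n"
  shows "(u + v) \<bullet>c w = u \<bullet>c w + v \<bullet>c w"
  using assms by (simp add: cscalar_sum distrib_right sum.distrib)

lemma cscalar_add_right:
  fixes u v w :: "complex vec"
  assumes "u \<in> cvec n" "v \<in> cvec n" "w \<in> cvec n"
  shows "w \<bullet>c (u + v) = w \<bullet>c u + w \<bullet>c v"
  using assms by (simp add: cscalar_sum[where n=n] distrib_left sum.distrib)

lemma cscalar_minus_left:
  fixes u v w :: "complex vec"
  assumes "u \<in> cvec n" "v \<in> cvec n" "w \<in> cvec n"
  shows "(u - v) \<bullet>c w = u \<bullet>c w - v \<bullet>c w"
  using assms by (simp add: cscalar_sum left_diff_distrib sum_subtractf)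

lemma cscalar_minus_right:
  fixes u v w :: "complex vec"
  assumes "u \<in> cvec n" "v \<in> cvec n" "w \<in> cvec n"
  shows "w \<bullet>c (u - v) = w \<bullet>c u - w \<bullet>c v"
  using assms by (simp add: cscalar_sum[where n=n] right_diff_distrib sum_subtractf)

lemma cscalar_smult_left:
  fixes v w :: "complex vec"
  assumes "v \<in> cvec n" "w \<in> cvec n"
  shows "(a \<cdot>\<^sub>v v) \<bullet>c w = a * (v \<bullet>c w)"
  using assms by (simp add: cscalar_sum sum_distrib_left mult.assoc)

lemma cscalar_smult_right:
  fixes v w :: "complex vec"
  assumes "v \<in> cvec n" "w \<in> cvec n"
  shows "w \<bullet>c (a \<cdot>\<^sub>v v) = cnj a * (w \<bullet>c v)"
  using assms by (simp add: cscalar_sum[where n=n] sum_distrib_left mult_ac)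

lemma cscalar_zero[simp]:
  fixes v :: "complex vec"
  assumes "v \<in> cvec n"
  shows "0\<^sub>v n \<bullet>c v = 0" "v \<bullet>c 0\<^sub>v n = 0"
  using assms by (simp_all add: cscalar_sum[where n=n])

lemma cscalar_cnj:
  fixes v w :: "complex vec"
  assumes "v \<in> cvec n" "w \<in> cvec n"
  shows "cnj (v \<bullet>c w) = w \<bullet>c v"
  using assms by (simp add: cscalar_sum[where n=n] mult.commute)

lemma cscalar_self:
  fixes v :: "complex vec"
  assumes "v \<in> cvec n"
  shows "v \<bullet>c v = of_real (\<Sum>i<n. (cmod (v $ i))\<^sup>2)"
  using assms by (simp add: cscalar_sum complex_norm_square del: of_real_power)

lemma cscalar_self_Re:
  fixes v :: "complex vec"
  assumes "v \<in> cvec n"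
  shows "v \<bullet>c v = of_real (Re (v \<bullet>c v))" "0 \<le> Re (v \<bullet>c v)"
  using cscalar_self[OF assms] by (auto simp: sum_nonneg)

lemma cscalar_self_eq_0:
  fixes v :: "complex vec"
  assumes "v \<in> cvec n"
  shows "Re (v \<bullet>c v) = 0 \<longleftrightarrow> v = 0\<^sub>v n"
proof
  assume "Re (v \<bullet>c v) = 0"
  hence "(\<Sum>i<n. (cmod (v $ i))\<^sup>2) = 0" using cscalar_self[OF assms] by simp
  hence "\<forall>i<n. v $ i = 0" by (simp add: sum_nonneg_eq_0_iff)
  thus "v = 0\<^sub>v n" using assms by (intro eq_vecI) auto
qed (use assms in simp)

lemma cscalar_self_pos:
  fixes v :: "complex vec"
  assumes "v \<in> cvec n" "v \<noteq> 0\<^sub>v n"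
  shows "0 < Re (v \<bullet>c v)"
  using cscalar_self_eq_0[OF assms(1)] cscalar_self_Re(2)[OF assms(1)] assms(2) by linarith

lemma cscalar_adjoint:
  fixes A :: "complex mat"
  assumes "A \<in> cmat n k" "v \<in> cvec k" "w \<in> cvec n"
  shows "(A *\<^sub>v v) \<bullet>c w = v \<bullet>c (adj A *\<^sub>v w)"
proof -
  have A': "adj A \<in> cmat k n" using assms by simp
  have Aw: "adj A *\<^sub>v w \<in> cvec k" using A' assms(3) by auto
  have "(A *\<^sub>v v) \<bullet>c w = (\<Sum>i<n. \<Sum>j<k. A $$ (i, j) * v $ j * cnj (w $ i))"
    using assms by (simp add: cscalar_sum mult_mat_vec_index_sum[OF assms(1,2)] sum_distrib_right
        del: index_mult_mat_vec)
  also have "\<dots> = (\<Sum>j<k. \<Sum>i<n. A $$ (i, j) * v $ j * cnj (w $ i))" by (rule sum.swap)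
  also have "\<dots> = (\<Sum>j<k. v $ j * cnj (\<Sum>i<n. adj A $$ (j, i) * w $ i))"
    using assms by (intro sum.cong refl) (auto simp: sum_distrib_left mult_ac intro!: sum.cong)
  also have "\<dots> = v \<bullet>c (adj A *\<^sub>v w)"
    using assms A' Aw mult_mat_vec_index_sum[OF A' assms(3)]
    by (subst cscalar_sum[where n=k]) (auto intro!: sum.cong simp del: index_mult_mat_vec)
  finally show ?thesis .
qed

lemma cscalar_adjoint2:
  fixes A :: "complex mat"
  assumes "A \<in> cmat n k" "v \<in> cvec n" "w \<in> cvec k"
  shows "(adj A *\<^sub>v v) \<bullet>c w = v \<bullet>c (A *\<^sub>v w)"
  using cscalar_adjoint[of "adj A" k n v w] assms by simp

lemma hermitian_cscalar:
  fixes P :: "complex mat"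
  assumes "P \<in> cmat n n" "adj P = P" "v \<in> cvec n" "w \<in> cvec n"
  shows "(P *\<^sub>v v) \<bullet>c w = v \<bullet>c (P *\<^sub>v w)"
  using cscalar_adjoint[of P n n v w] assms by simp

lemma hermitian_cscalar_cnj:
  fixes P :: "complex mat"
  assumes "P \<in> cmat n n" "adj P = P" "v \<in> cvec n" "w \<in> cvec n"
  shows "(P *\<^sub>v v) \<bullet>c w = cnj ((P *\<^sub>v w) \<bullet>c v)"
  using hermitian_cscalar[OF assms] cscalar_cnj[of "P *\<^sub>v w" n v] assms
  by (metis mult_mat_vec_carrier)

text \<open>Completing the square; the two properties of semidefinite forms proved below each follow by choosing the
scalar \<open>a\<close>.\<close>

lemma hermitian_form_minus:
  fixes P :: "complex mat"
  assumes P: "P \<in> cmat n n" "adj P = P" and v: "v \<in> cvec n" and w: "w \<in> cvec n"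
  shows "qform P (w - a \<cdot>\<^sub>v v) =
    qform P w - 2 * Re (cnj a * ((P *\<^sub>v w) \<bullet>c v)) + (cmod a)\<^sup>2 * qform P v"
proof -
  have c: "P *\<^sub>v v \<in> cvec n" "P *\<^sub>v w \<in> cvec n" "a \<cdot>\<^sub>v v \<in> cvec n"
    "a \<cdot>\<^sub>v (P *\<^sub>v v) \<in> cvec n" "w - a \<cdot>\<^sub>v v \<in> cvec n"
    using P v w by auto
  have e: "P *\<^sub>v (w - a \<cdot>\<^sub>v v) = P *\<^sub>v w - a \<cdot>\<^sub>v (P *\<^sub>v v)"
    using P v w c by (simp add: mult_minus_distrib_mat_vec[of _ n n] mult_mat_vec[of _ n n])
  have h: "(P *\<^sub>v v) \<bullet>c w = cnj ((P *\<^sub>v w) \<bullet>c v)" by (rule hermitian_cscalar_cnj[OF P v w])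
  have aa: "a * (cnj a * z) = of_real ((cmod a)\<^sup>2) * z" "cnj a * (a * z) = of_real ((cmod a)\<^sup>2) * z" for z
    by (metis complex_norm_square mult.assoc mult.commute of_real_power)+
  have "(P *\<^sub>v (w - a \<cdot>\<^sub>v v)) \<bullet>c (w - a \<cdot>\<^sub>v v) =
     (P *\<^sub>v w) \<bullet>c w - cnj a * ((P *\<^sub>v w) \<bullet>c v) - a * cnj ((P *\<^sub>v w) \<bullet>c v)
       + of_real ((cmod a)\<^sup>2) * ((P *\<^sub>v v) \<bullet>c v)"
    unfolding e using c v w h
    by (simp add: cscalar_minus_left[where n=n] cscalar_minus_right[where n=n] cscalar_smult_left[where n=n]
        cscalar_smult_right[where n=n] right_diff_distrib aa del: of_real_power)
  moreover have "Re (a * cnj z) = Re (cnj a * z)" for z by (simp add: mult_ac)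
  ultimately show ?thesis by simp
qed

lemma pos_semidefD:
  assumes "pos_semidef n P"
  shows "P \<in> cmat n n" "adj P = P" "\<And>v. v \<in> cvec n \<Longrightarrow> 0 \<le> qform P v"
  using assms unfolding pos_semidef_def by auto

text \<open>A vector at which the form vanishes is a minimum of the form, so a small step from \<open>v\<close> in the
direction of \<open>P *\<^sub>v v\<close> must not decrease it.\<close>

lemma pos_semidef_zero_form:
  assumes P: "pos_semidef n P" and v: "v \<in> cvec n" and z: "qform P v = 0"
  shows "P *\<^sub>v v = 0\<^sub>v n"
proof (rule ccontr)
  assume ne: "P *\<^sub>v v \<noteq> 0\<^sub>v n"
  note PD = pos_semidefD[OF P]
  let ?w = "P *\<^sub>v v"
  have w: "?w \<in> cvec n" using PD v by auto
  define q where "q = qform P ?w"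
  define N where "N = Re (?w \<bullet>c ?w)"
  have q: "0 \<le> q" unfolding q_def using PD w by auto
  have N: "N > 0" unfolding N_def using cscalar_self_pos[OF w ne] .
  \<comment> \<open>The summand 1 keeps the denominator positive when the second order term vanishes.\<close>
  define t where "t = N / (q + 1)"
  have t: "t > 0" unfolding t_def using N q by auto
  have "0 \<le> qform P (v - of_real t \<cdot>\<^sub>v ?w)"
    using PD v w by auto
  also have "\<dots> = - 2 * t * N + t\<^sup>2 * q"
    using hermitian_form_minus[OF PD(1,2) w v, of "of_real t"] z by (simp add: q_def N_def)
  also have "\<dots> = t * (t * q - 2 * N)" by (simp add: algebra_simps power2_eq_square)
  finally have "t * q - 2 * N \<ge> 0" using t by (simp add: zero_le_mult_iff)
  moreover have "t * q \<le> N" unfolding t_def using N q by (simp add: field_simps)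
  ultimately show False using N by linarith
qed

text \<open>The Cauchy--Schwarz inequality of a semidefinite form. It is stated as a quotient because in this
shape it bounds the rank one matrix that can be subtracted from \<open>P\<close>.\<close>

lemma pos_semidef_cauchy:
  assumes P: "pos_semidef n P" and v: "v \<in> cvec n" and w: "w \<in> cvec n"
    and z: "qform P v > 0"
  shows "(cmod ((P *\<^sub>v w) \<bullet>c v))\<^sup>2 / qform P v \<le> qform P w"
proof -
  note PD = pos_semidefD[OF P]
  define q where "q = qform P v"
  define b where "b = (P *\<^sub>v w) \<bullet>c v"
  define a where "a = b / of_real q"
  have q: "q > 0" using z q_def by simp
  have "0 \<le> qform P (w - a \<cdot>\<^sub>v v)" using PD v w by auto
  also have "\<dots> = qform P w - 2 * Re (cnj a * b) + (cmod a)\<^sup>2 * q"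
    using hermitian_form_minus[OF PD(1,2) v w, of a] by (simp add: q_def b_def)
  also have "cnj a * b = of_real ((cmod b)\<^sup>2 / q)"
    unfolding a_def using complex_norm_square[of b] by (simp add: mult.commute)
  also have "(cmod a)\<^sup>2 * q = (cmod b)\<^sup>2 / q"
    unfolding a_def using q by (simp add: norm_divide power_divide power2_eq_square)
  finally show ?thesis unfolding q_def b_def by simp
qed

section \<open>Subspaces and the Hautus test\<close>

text \<open>Padded by zero rows, the matrix becomes square with determinant \<open>0\<close>.\<close>

lemma wide_matrix_kernel:
  fixes K :: "complex mat"
  assumes K: "K \<in> cmat n r" and nr: "n < r"
  shows "\<exists>c \<in> cvec r. c \<noteq> 0\<^sub>v r \<and> K *\<^sub>v c = 0\<^sub>v n"
proof -
  define M where "M = mat r r (\<lambda>(i, j). if i < n then K $$ (i, j) else 0)"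
  have M: "M \<in> cmat r r" unfolding M_def by simp
  have "transpose_mat M *\<^sub>v unit_vec r n = 0\<^sub>v r"
    using nr by (intro eq_vecI) (auto simp: M_def)
  moreover have "unit_vec r n \<noteq> (0\<^sub>v r :: complex vec)"
    using nr by simp
  ultimately have "det (transpose_mat M) = 0"
    using det_0_iff_vec_prod_zero_field[of "transpose_mat M" r] M by (meson transpose_carrier_mat unit_vec_carrier)
  hence "det M = 0" using det_transpose[OF M] by simp
  then obtain c where c: "c \<in> cvec r" "c \<noteq> 0\<^sub>v r" "M *\<^sub>v c = 0\<^sub>v r"
    using det_0_iff_vec_prod_zero_field[OF M] by auto
  have "K *\<^sub>v c = 0\<^sub>v n"
  proof (intro eq_vecI)
    fix i assume "i < dim_vec (0\<^sub>v n :: complex vec)"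
    hence i: "i < n" by simp
    have "(K *\<^sub>v c) $ i = (M *\<^sub>v c) $ i"
      using i nr mult_mat_vec_index_sum[OF K c(1), of i] mult_mat_vec_index_sum[OF M c(1), of i]
      by (simp add: M_def)
    thus "(K *\<^sub>v c) $ i = 0\<^sub>v n $ i" using c(3) i nr by simp
  qed (use K in auto)
  thus ?thesis using c by auto
qed

lemma inv_mat:
  fixes P :: "complex mat"
  assumes P: "P \<in> cmat n n" and inj: "\<And>v. v \<in> cvec n \<Longrightarrow> P *\<^sub>v v = 0\<^sub>v n \<Longrightarrow> v = 0\<^sub>v n"
  shows "inv_mat P \<in> cmat n n" "P * inv_mat P = 1\<^sub>m n" "inv_mat P * P = 1\<^sub>m n"
proof -
  have "det P \<noteq> 0" using det_0_iff_vec_prod_zero_field[OF P] inj by auto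
  from det_non_zero_imp_unit[OF P this] have "P \<in> Units (ring_mat TYPE(complex) n n)" .
  with mat_inverse(1)[OF P, of n] obtain Q where Q: "mat_inverse P = Some Q" by (cases "mat_inverse P") auto
  from mat_inverse(2)[OF P Q] Q show "inv_mat P \<in> cmat n n" "P * inv_mat P = 1\<^sub>m n" "inv_mat P * P = 1\<^sub>m n"
    unfolding inv_mat_def by auto
qed

lemma square_inj_surj:
  fixes P :: "complex mat"
  assumes P: "P \<in> cmat n n" and inj: "\<And>v. v \<in> cvec n \<Longrightarrow> P *\<^sub>v v = 0\<^sub>v n \<Longrightarrow> v = 0\<^sub>v n"
    and w: "w \<in> cvec n"
  shows "\<exists>v \<in> cvec n. P *\<^sub>v v = w"
proof
  note I = inv_mat[OF P inj]
  show "inv_mat P *\<^sub>v w \<in> cvec n" using I(1) w by auto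
  show "P *\<^sub>v (inv_mat P *\<^sub>v w) = w"
    using assoc_mult_mat_vec[OF P I(1) w] I(2) w by simp
qed

definition vec_subspace :: "nat \<Rightarrow> complex vec set \<Rightarrow> bool" where
  "vec_subspace n U \<longleftrightarrow> U \<subseteq> cvec n \<and> 0\<^sub>v n \<in> U \<and>
     (\<forall>x \<in> U. \<forall>y \<in> U. x + y \<in> U) \<and> (\<forall>a. \<forall>x \<in> U. a \<cdot>\<^sub>v x \<in> U)"

lemma mult_mat_vec_zero: "(K :: complex mat) \<in> cmat n r \<Longrightarrow> K *\<^sub>v 0\<^sub>v r = 0\<^sub>v n"
  by (intro eq_vecI) auto

text \<open>A matrix with the largest possible number of independent columns in \<open>U\<close> has range \<open>U\<close>: a vector
of \<open>U\<close> outside its range could be appended as one more independent column.\<close>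

lemma vec_subspace_basis:
  assumes U: "vec_subspace n U"
  shows "\<exists>r K. r \<le> n \<and> K \<in> cmat n r \<and>
    (\<forall>c \<in> cvec r. K *\<^sub>v c = 0\<^sub>v n \<longrightarrow> c = 0\<^sub>v r) \<and> U = {K *\<^sub>v c | c. c \<in> cvec r}"
proof -
  define P where "P r \<longleftrightarrow> (\<exists>K \<in> cmat n r. (\<forall>c \<in> cvec r. K *\<^sub>v c = 0\<^sub>v n \<longrightarrow> c = 0\<^sub>v r) \<and>
     (\<forall>c \<in> cvec r. K *\<^sub>v c \<in> U))" for r
  have "P 0" unfolding P_def
  proof (intro bexI[of _ "0\<^sub>m n 0"] conjI ballI impI)
    fix c :: "complex vec" assume c: "c \<in> cvec 0"
    show "c = 0\<^sub>v 0" using c by auto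
    have "0\<^sub>m n 0 *\<^sub>v c = 0\<^sub>v n" using c by (intro eq_vecI) (auto simp: scalar_prod_def)
    thus "0\<^sub>m n 0 *\<^sub>v c \<in> U" using U unfolding vec_subspace_def by auto
  qed simp
  moreover have bd: "\<forall>r. P r \<longrightarrow> r \<le> n"
    unfolding P_def using wide_matrix_kernel by (metis not_le)
  ultimately have PG: "P (GREATEST r. P r)" using GreatestI_nat[of P 0 n] by blast
  define r where "r = (GREATEST r. P r)"
  obtain K where K: "K \<in> cmat n r" and inj: "\<And>c. c \<in> cvec r \<Longrightarrow> K *\<^sub>v c = 0\<^sub>v n \<Longrightarrow> c = 0\<^sub>v r"
    and KU: "\<And>c. c \<in> cvec r \<Longrightarrow> K *\<^sub>v c \<in> U" using PG[folded r_def] unfolding P_def by auto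
  have "x \<in> {K *\<^sub>v c | c. c \<in> cvec r}" if x: "x \<in> U" for x
  proof (rule ccontr)
    assume nx: "x \<notin> {K *\<^sub>v c | c. c \<in> cvec r}"
    have xc: "x \<in> cvec n" using U x unfolding vec_subspace_def by auto
    define K' where "K' = mat n (Suc r) (\<lambda>(i, j). if j < r then K $$ (i, j) else x $ i)"
    have K': "K' \<in> cmat n (Suc r)" unfolding K'_def by simp
    have K'v: "K' *\<^sub>v c = K *\<^sub>v vec r (\<lambda>i. c $ i) + c $ r \<cdot>\<^sub>v x" if c: "c \<in> cvec (Suc r)" for c :: "complex vec"
    proof (intro eq_vecI)
      fix i assume "i < dim_vec (K *\<^sub>v vec r (\<lambda>i. c $ i) + c $ r \<cdot>\<^sub>v x)"
      hence i: "i < n" using xc by simp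
      have "(K' *\<^sub>v c) $ i = (\<Sum>j<Suc r. K' $$ (i, j) * c $ j)" by (rule mult_mat_vec_index_sum[OF K' c i])
      also have "\<dots> = (\<Sum>j<r. K $$ (i, j) * vec r (\<lambda>i. c $ i) $ j) + c $ r * x $ i"
        using i unfolding K'_def by simp
      also have "\<dots> = (K *\<^sub>v vec r (\<lambda>i. c $ i) + c $ r \<cdot>\<^sub>v x) $ i"
        using mult_mat_vec_index_sum[OF K, of "vec r (\<lambda>i. c $ i)" i] i xc K by simp
      finally show "(K' *\<^sub>v c) $ i = (K *\<^sub>v vec r (\<lambda>i. c $ i) + c $ r \<cdot>\<^sub>v x) $ i" .
    qed (use K K' xc in auto)
    have "P (Suc r)" unfolding P_def
    proof (intro bexI[of _ K'] conjI ballI impI K')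
      fix c :: "complex vec" assume c: "c \<in> cvec (Suc r)"
      let ?d = "vec r (\<lambda>i. c $ i)"
      show "K' *\<^sub>v c \<in> U" unfolding K'v[OF c] using KU[of ?d] U x unfolding vec_subspace_def by auto
      assume z: "K' *\<^sub>v c = 0\<^sub>v n"
      have z': "K *\<^sub>v ?d + c $ r \<cdot>\<^sub>v x = 0\<^sub>v n" using z K'v[OF c] by simp
      have cr: "c $ r = 0"
      proof (rule ccontr)
        assume nz: "c $ r \<noteq> 0"
        have "x = K *\<^sub>v ((- 1 / c $ r) \<cdot>\<^sub>v ?d)"
        proof (intro eq_vecI)
          fix i assume "i < dim_vec (K *\<^sub>v ((- 1 / c $ r) \<cdot>\<^sub>v ?d))"
          hence i: "i < n" using K by simp
          have "(K *\<^sub>v ?d + c $ r \<cdot>\<^sub>v x) $ i = 0" using z' i by simp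
          hence e: "(K *\<^sub>v ?d) $ i + c $ r * x $ i = 0" using i xc K by simp
          have "(K *\<^sub>v ((- 1 / c $ r) \<cdot>\<^sub>v ?d)) $ i = (- 1 / c $ r) * (K *\<^sub>v ?d) $ i"
            using i K by (subst mult_mat_vec[OF K]) auto
          also have "\<dots> = x $ i" using e nz by (simp add: field_simps add_eq_0_iff)
          finally show "x $ i = (K *\<^sub>v ((- 1 / c $ r) \<cdot>\<^sub>v ?d)) $ i" by simp
        qed (use K xc in auto)
        thus False using nx by auto
      qed
      moreover have "0 \<cdot>\<^sub>v x = 0\<^sub>v n" using xc by (intro eq_vecI) auto
      moreover have "K *\<^sub>v ?d \<in> cvec n" using K by auto
      ultimately have "K *\<^sub>v ?d = 0\<^sub>v n" using z' by simp
      hence "?d = 0\<^sub>v r" using inj by simp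
      hence "\<forall>i<r. c $ i = 0" by (metis index_vec index_zero_vec(1))
      thus "c = 0\<^sub>v (Suc r)" using c cr by (intro eq_vecI) (auto simp: less_Suc_eq)
    qed
    hence "Suc r \<le> r" unfolding r_def using Greatest_le_nat[of P "Suc r" n] bd r_def by auto
    thus False by simp
  qed
  hence "U = {K *\<^sub>v c | c. c \<in> cvec r}" using KU by auto
  moreover have "r \<le> n" using bd PG r_def by auto
  ultimately show ?thesis using K inj by blast
qed

lemma mat_mult_unit_vec:
  assumes "(K :: complex mat) \<in> cmat n r" "j < r"
  shows "K *\<^sub>v unit_vec r j = col K j"
  using assms by (intro eq_vecI) auto

text \<open>A relation between \<open>N\<close> and \<open>J\<close> on a subspace becomes a matrix equation in the coordinates of a
basis \<open>K\<close>; the square matrix \<open>S\<close> then carries the finite-dimensional information.\<close>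

lemma subspace_factor:
  assumes N: "N \<in> cmat q n" and J: "J \<in> cmat q n" and K: "K \<in> cmat n r"
    and U: "U = {K *\<^sub>v c | c. c \<in> cvec r}"
    and NJ: "\<And>z. z \<in> U \<Longrightarrow> \<exists>z' \<in> U. N *\<^sub>v z = J *\<^sub>v z'"
  shows "\<exists>S \<in> cmat r r. N * (K :: complex mat) = J * (K * S)"
proof -
  have "\<forall>j<r. \<exists>s \<in> cvec r. N *\<^sub>v col K j = J *\<^sub>v (K *\<^sub>v s)"
  proof (intro allI impI)
    fix j assume j: "j < r"
    have "col K j \<in> U" unfolding U using mat_mult_unit_vec[OF K j] by (metis (mono_tags, lifting) mem_Collect_eq unit_vec_carrier)
    from NJ[OF this] show "\<exists>s \<in> cvec r. N *\<^sub>v col K j = J *\<^sub>v (K *\<^sub>v s)" unfolding U by auto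
  qed
  then obtain s where s: "\<And>j. j < r \<Longrightarrow> s j \<in> cvec r" "\<And>j. j < r \<Longrightarrow> N *\<^sub>v col K j = J *\<^sub>v (K *\<^sub>v s j)"
    by metis
  define S where "S = mat r r (\<lambda>(i, j). s j $ i)"
  have S: "S \<in> cmat r r" unfolding S_def by simp
  have cS: "col S j = s j" if "j < r" for j using s(1)[OF that] that unfolding S_def by (intro eq_vecI) auto
  have "N * K = J * (K * S)"
  proof (rule mat_col_eqI)
    fix j assume "j < dim_col (J * (K * S))"
    hence j: "j < r" using S by simp
    show "col (N * K) j = col (J * (K * S)) j"
      using col_mult2[OF N K j] col_mult2[of J q n "K * S" r j] col_mult2[OF K S j] s(2)[OF j] cS[OF j] J K S j by simp
  qed (use N J K S in auto)
  thus ?thesis using S by blast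
qed

text \<open>If \<open>c\<close> is an eigenvector of the matrix \<open>S\<close> with \<open>N * K = J * (K * S)\<close>, then \<open>K *\<^sub>v c\<close> is an
eigenvector of the pencil. For \<open>J = 1\<^sub>m n\<close> this is the familiar fact that every nonzero invariant
subspace contains an eigenvector.\<close>

lemma pencil_eigenvector:
  assumes U: "vec_subspace n U" and ne: "U \<noteq> {0\<^sub>v n}"
    and N: "N \<in> cmat q n" and J: "J \<in> cmat q n"
    and NJ: "\<And>z. z \<in> U \<Longrightarrow> \<exists>z' \<in> U. N *\<^sub>v z = J *\<^sub>v z'"
  shows "\<exists>z \<in> U. \<exists>l. z \<noteq> 0\<^sub>v n \<and> N *\<^sub>v z = l \<cdot>\<^sub>v (J *\<^sub>v z)"
proof -
  obtain r K where K: "K \<in> cmat n r" and inj: "\<And>c. c \<in> cvec r \<Longrightarrow> K *\<^sub>v c = 0\<^sub>v n \<Longrightarrow> c = 0\<^sub>v r"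
    and UK: "U = {K *\<^sub>v c | c. c \<in> cvec r}" using vec_subspace_basis[OF U] by auto
  obtain S where S: "S \<in> cmat r r" and NK: "N * K = J * (K * S)"
    using subspace_factor[OF N J K UK NJ] by auto
  have "r \<noteq> 0"
  proof
    assume r: "r = 0"
    have "U = {0\<^sub>v n}" unfolding UK using K r by (auto simp: scalar_prod_def intro!: eq_vecI exI[of _ "0\<^sub>v 0"])
    thus False using ne by simp
  qed
  then obtain l where "l \<in> spectrum S" using spectrum_non_empty[OF S] by auto
  then obtain c where c: "c \<in> cvec r" "c \<noteq> 0\<^sub>v r" "S *\<^sub>v c = l \<cdot>\<^sub>v c"
    using S unfolding spectrum_def eigenvalue_def eigenvector_def by auto
  have "N *\<^sub>v (K *\<^sub>v c) = (N * K) *\<^sub>v c" using N K c by simp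
  also have "\<dots> = J *\<^sub>v (K *\<^sub>v (S *\<^sub>v c))" unfolding NK using J K S c assoc_mult_mat_vec[of J q n "K * S" r c] by simp
  also have "\<dots> = l \<cdot>\<^sub>v (J *\<^sub>v (K *\<^sub>v c))" unfolding c(3) using J K c by (simp add: mult_mat_vec[OF K] mult_mat_vec[OF J])
  finally show ?thesis using inj[OF c(1)] c UK by auto
qed

text \<open>In the coordinates of a basis, \<open>M\<close> acts on \<open>U\<close> as a square matrix, for which injectivity and
surjectivity coincide.\<close>

lemma subspace_inj_surj:
  assumes U: "vec_subspace n U" and M: "M \<in> cmat n n"
    and MU: "\<And>z. z \<in> U \<Longrightarrow> M *\<^sub>v z \<in> U"
    and inj: "\<And>z. z \<in> U \<Longrightarrow> M *\<^sub>v z = 0\<^sub>v n \<Longrightarrow> z = 0\<^sub>v n" and z: "z \<in> U"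
  shows "\<exists>z' \<in> U. M *\<^sub>v z' = z"
proof -
  obtain r K where K: "K \<in> cmat n r" and injK: "\<And>c. c \<in> cvec r \<Longrightarrow> K *\<^sub>v c = 0\<^sub>v n \<Longrightarrow> c = 0\<^sub>v r"
    and UK: "U = {K *\<^sub>v c | c. c \<in> cvec r}" using vec_subspace_basis[OF U] by auto
  have MU': "\<exists>z' \<in> U. M *\<^sub>v z = 1\<^sub>m n *\<^sub>v z'" if "z \<in> U" for z
    using MU[OF that] U unfolding vec_subspace_def by (metis one_mult_mat_vec subsetD)
  obtain S where S: "S \<in> cmat r r" and MK: "M * K = K * S"
    using subspace_factor[OF M one_carrier_mat K UK MU'] K by (metis left_mult_one_mat mult_carrier_mat)
  have MKv: "M *\<^sub>v (K *\<^sub>v c) = K *\<^sub>v (S *\<^sub>v c)" if "c \<in> cvec r" for c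
    using that M K S MK by (metis assoc_mult_mat_vec)
  have injS: "c = 0\<^sub>v r" if c: "c \<in> cvec r" "S *\<^sub>v c = 0\<^sub>v r" for c
    using MKv[OF c(1)] c(2) mult_mat_vec_zero[OF K] inj[of "K *\<^sub>v c"] injK[OF c(1)] UK c(1) by auto
  obtain c where c: "c \<in> cvec r" "z = K *\<^sub>v c" using z UK by auto
  obtain d where d: "d \<in> cvec r" "S *\<^sub>v d = c" using square_inj_surj[OF S injS c(1)] by auto
  show ?thesis using MKv[OF d(1)] d c UK by auto
qed

text \<open>A basis matrix \<open>K\<close> with fewer than \<open>n\<close> columns would have an adjoint with a kernel, that is, a
nonzero vector orthogonal to \<open>U\<close>.\<close>

lemma subspace_full:
  assumes U: "vec_subspace n U"
    and orth: "\<And>a. a \<in> cvec n \<Longrightarrow> (\<And>v. v \<in> U \<Longrightarrow> a \<bullet>c v = 0) \<Longrightarrow> a = 0\<^sub>v n"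
  shows "U = cvec n"
proof -
  obtain r K where rn: "r \<le> n" and K: "K \<in> cmat n r" and injK: "\<And>c. c \<in> cvec r \<Longrightarrow> K *\<^sub>v c = 0\<^sub>v n \<Longrightarrow> c = 0\<^sub>v r"
    and UK: "U = {K *\<^sub>v c | c. c \<in> cvec r}" using vec_subspace_basis[OF U] by auto
  have "r = n"
  proof (rule ccontr)
    assume "r \<noteq> n"
    hence "r < n" using rn by simp
    from wide_matrix_kernel[OF mat_adjoint_carrier[OF K] this]
    obtain a where a: "a \<in> cvec n" "a \<noteq> 0\<^sub>v n" "adj K *\<^sub>v a = 0\<^sub>v r" by auto
    have "a \<bullet>c v = 0" if vU: "v \<in> U" for v
    proof -
      obtain c where c: "c \<in> cvec r" "v = K *\<^sub>v c" using vU UK by auto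
      show ?thesis using cscalar_adjoint2[OF K a(1) c(1)] a(3) c by simp
    qed
    thus False using orth a by auto
  qed
  hence K': "K \<in> cmat n n" and inj': "\<And>c. c \<in> cvec n \<Longrightarrow> K *\<^sub>v c = 0\<^sub>v n \<Longrightarrow> c = 0\<^sub>v n"
    using K injK by auto
  show ?thesis using square_inj_surj[OF K' inj'] UK \<open>r = n\<close> K' by (auto simp: set_eq_iff) 
qed

text \<open>The eigenvector form of controllability, due to Hautus, is used only through this lemma. The
orthogonal complement of \<open>V\<close> is invariant under \<open>adj A\<close> and annihilated by \<open>adj B\<close>, so if it were
nonzero it would contain an eigenvector of the excluded kind.\<close>

lemma hautus_full:
  assumes V: "vec_subspace n V" and A: "A \<in> cmat n n" and B: "B \<in> cmat n m"
    and AV: "\<And>v. v \<in> V \<Longrightarrow> A *\<^sub>v v \<in> V" and BV: "\<And>u. u \<in> cvec m \<Longrightarrow> B *\<^sub>v u \<in> V"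
    and pbh: "\<And>w l. w \<in> cvec n \<Longrightarrow> adj A *\<^sub>v w = l \<cdot>\<^sub>v w \<Longrightarrow> adj B *\<^sub>v w = 0\<^sub>v m \<Longrightarrow> w = 0\<^sub>v n"
  shows "V = cvec n"
proof (rule subspace_full[OF V], rule ccontr)
  fix a assume a: "a \<in> cvec n" "\<And>v. v \<in> V \<Longrightarrow> a \<bullet>c v = 0" "a \<noteq> 0\<^sub>v n"
  have Vc: "V \<subseteq> cvec n" using V unfolding vec_subspace_def by auto
  define U where "U = {w \<in> cvec n. \<forall>v \<in> V. w \<bullet>c v = 0}"
  have U: "vec_subspace n U" unfolding vec_subspace_def U_def using Vc
    by (auto simp: cscalar_add_left[where n=n] cscalar_smult_left[where n=n] subset_iff)
  have "U \<noteq> {0\<^sub>v n}" using a unfolding U_def by auto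
  moreover have "\<exists>z' \<in> U. adj A *\<^sub>v z = 1\<^sub>m n *\<^sub>v z'" if z: "z \<in> U" for z
  proof (intro bexI[of _ "adj A *\<^sub>v z"])
    have zc: "z \<in> cvec n" and zV: "\<And>v. v \<in> V \<Longrightarrow> z \<bullet>c v = 0" using z unfolding U_def by auto
    have Az: "adj A *\<^sub>v z \<in> cvec n" using A zc by (metis mat_adjoint_carrier mult_mat_vec_carrier)
    show "adj A *\<^sub>v z = 1\<^sub>m n *\<^sub>v (adj A *\<^sub>v z)" using Az by simp
    show "adj A *\<^sub>v z \<in> U" unfolding U_def using Az cscalar_adjoint2[OF A zc] Vc AV zV by auto
  qed
  ultimately obtain z l where z: "z \<in> U" "z \<noteq> 0\<^sub>v n" "adj A *\<^sub>v z = l \<cdot>\<^sub>v (1\<^sub>m n *\<^sub>v z)"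
    using pencil_eigenvector[OF U _ mat_adjoint_carrier[OF A] one_carrier_mat] by blast
  have zc: "z \<in> cvec n" using z U_def by auto
  have Bz: "adj B *\<^sub>v z \<in> cvec m" using B zc by (metis mat_adjoint_carrier mult_mat_vec_carrier)
  have "(adj B *\<^sub>v z) \<bullet>c u = 0" if "u \<in> cvec m" for u
    using cscalar_adjoint2[OF B zc that] BV[OF that] z(1) unfolding U_def by auto
  from this[OF Bz] have "adj B *\<^sub>v z = 0\<^sub>v m" using cscalar_self_eq_0[OF Bz] by simp
  with pbh[OF zc, of l] z zc show False by simp
qed

section \<open>Limits of matrices and the trace inner product\<close>

lemma mat_adjoint_mult:
  fixes A B :: "complex mat"
  assumes A: "A \<in> cmat n k" and B: "B \<in> cmat k m"
  shows "adj (A * B) = adj B * adj A"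
proof (intro eq_matI)
  fix i j assume "i < dim_row (adj B * adj A)" "j < dim_col (adj B * adj A)"
  hence ij: "i < m" "j < n" using A B by auto
  have "adj (A * B) $$ (i, j) = cnj ((A * B) $$ (j, i))" using ij A B by simp
  also have "\<dots> = (\<Sum>q<k. cnj (A $$ (j, q)) * cnj (B $$ (q, i)))"
    by (simp add: mult_mat_index_sum[OF A B ij(2,1)] del: index_mult_mat)
  also have "\<dots> = (\<Sum>q<k. adj B $$ (i, q) * adj A $$ (q, j))"
    using A B ij by (intro sum.cong) auto
  also have "\<dots> = (adj B * adj A) $$ (i, j)"
    by (rule mult_mat_index_sum[symmetric]) (use A B ij in auto)
  finally show "adj (A * B) $$ (i, j) = (adj B * adj A) $$ (i, j)" .
qed (use A B in auto)

lemma mat_adjoint_add: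
  fixes A B :: "complex mat"
  assumes "A \<in> cmat n k" "B \<in> cmat n k"
  shows "adj (A + B) = adj A + adj B"
  using assms by (intro eq_matI) auto

lemma mat_adjoint_minus:
  fixes A B :: "complex mat"
  assumes "A \<in> cmat n k" "B \<in> cmat n k"
  shows "adj (A - B) = adj A - adj B"
  using assms by (intro eq_matI) auto

lemma mat_adjoint_smult:
  "adj ((a::complex) \<cdot>\<^sub>m A) = cnj a \<cdot>\<^sub>m adj A"
  by (intro eq_matI) auto

definition mat_tendsto :: "nat \<Rightarrow> nat \<Rightarrow> (nat \<Rightarrow> complex mat) \<Rightarrow> complex mat \<Rightarrow> bool" where
  "mat_tendsto n m X Y \<longleftrightarrow> (\<forall>i<n. \<forall>j<m. (\<lambda>k. X k $$ (i, j)) \<longlonglongrightarrow> Y $$ (i, j))"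

lemma mat_tendsto_subseq:
  assumes "mat_tendsto n m X Y" "strict_mono r"
  shows "mat_tendsto n m (\<lambda>k. X (r k)) Y"
  using assms LIMSEQ_subseq_LIMSEQ unfolding mat_tendsto_def by (fastforce simp: o_def)

text \<open>The theorem of Bolzano and Weierstrass, passing to a further subsequence for each index.\<close>

lemma finite_family_convergent_subseq:
  fixes f :: "nat \<Rightarrow> 'i \<Rightarrow> complex"
  assumes "finite I" "\<And>i k. i \<in> I \<Longrightarrow> cmod (f k i) \<le> C"
  shows "\<exists>r l. strict_mono (r :: nat \<Rightarrow> nat) \<and> (\<forall>i\<in>I. (\<lambda>k. f (r k) i) \<longlonglongrightarrow> l i)"
  using assms
proof (induction I rule: finite_induct)
  case empty
  show ?case by (intro exI[of _ id]) (auto simp: strict_mono_def)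
next
  case (insert a I)
  have "\<exists>r l. strict_mono (r :: nat \<Rightarrow> nat) \<and> (\<forall>i\<in>I. (\<lambda>k. f (r k) i) \<longlonglongrightarrow> l i)"
    by (rule insert.IH) (use insert.prems in auto)
  then obtain r l where r: "strict_mono (r :: nat \<Rightarrow> nat)" "\<And>i. i \<in> I \<Longrightarrow> (\<lambda>k. f (r k) i) \<longlonglongrightarrow> l i" by metis
  have "\<forall>k. f (r k) a \<in> cball 0 C" using insert.prems by auto
  moreover have "seq_compact (cball (0::complex) C)" by (simp add: compact_imp_seq_compact)
  ultimately obtain y s where s: "strict_mono (s :: nat \<Rightarrow> nat)" "((\<lambda>k. f (r k) a) \<circ> s) \<longlonglongrightarrow> y"
    unfolding seq_compact_def by metis
  show ?case
  proof (intro exI[of _ "r \<circ> s"] exI[of _ "l(a := y)"] conjI ballI)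
    show "strict_mono (r \<circ> s)" using r s by (simp add: strict_mono_o)
    fix i assume i: "i \<in> insert a I"
    show "(\<lambda>k. f ((r \<circ> s) k) i) \<longlonglongrightarrow> (l(a := y)) i"
    proof (cases "i = a")
      case True thus ?thesis using s(2) by (simp add: o_def)
    next
      case False thus ?thesis using LIMSEQ_subseq_LIMSEQ[OF r(2) s(1), of i] i by (simp add: o_def)
    qed
  qed
qed

lemma mat_convergent_subseq:
  assumes "\<And>k i j. i < n \<Longrightarrow> j < m \<Longrightarrow> cmod (X k $$ (i, j)) \<le> C"
  shows "\<exists>r Y. strict_mono (r :: nat \<Rightarrow> nat) \<and> Y \<in> cmat n m \<and> mat_tendsto n m (\<lambda>k. X (r k)) Y"
proof -
  have "finite ({..<n} \<times> {..<m})" by simp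
  from finite_family_convergent_subseq[OF this, of "\<lambda>k ij. X k $$ ij" C] assms
  obtain r l where r: "strict_mono (r :: nat \<Rightarrow> nat)" "\<And>ij. ij \<in> {..<n} \<times> {..<m} \<Longrightarrow> (\<lambda>k. X (r k) $$ ij) \<longlonglongrightarrow> l ij"
    by blast
  show ?thesis
    by (intro exI[of _ r] exI[of _ "mat n m l"]) (use r in \<open>auto simp: mat_tendsto_def\<close>)
qed

lemma mat_tendsto_mult:
  assumes X: "\<And>k. X k \<in> cmat n q" "X' \<in> cmat n q" "mat_tendsto n q X X'"
    and Y: "\<And>k. Y k \<in> cmat q m" "Y' \<in> cmat q m" "mat_tendsto q m Y Y'"
  shows "mat_tendsto n m (\<lambda>k. X k * Y k) (X' * Y')"
  unfolding mat_tendsto_def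
proof (intro allI impI)
  fix i j assume ij: "i < n" "j < m"
  show "(\<lambda>k. (X k * Y k) $$ (i, j)) \<longlonglongrightarrow> (X' * Y') $$ (i, j)"
    using X(3) Y(3) ij unfolding mult_mat_index_sum[OF X(1) Y(1) ij] mult_mat_index_sum[OF X(2) Y(2) ij] mat_tendsto_def
    by (intro tendsto_sum tendsto_mult) auto
qed

lemma mat_tendsto_const: "mat_tendsto n m (\<lambda>k. X) X"
  unfolding mat_tendsto_def by auto

lemma mat_tendsto_add:
  assumes "\<And>k. X k \<in> cmat n m" "X' \<in> cmat n m" "mat_tendsto n m X X'"
    and "\<And>k. Y k \<in> cmat n m" "Y' \<in> cmat n m" "mat_tendsto n m Y Y'"
  shows "mat_tendsto n m (\<lambda>k. X k + Y k) (X' + Y')"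
proof -
  have "(X k + Y k) $$ (i,j) = X k $$ (i,j) + Y k $$ (i,j)" "(X' + Y') $$ (i,j) = X' $$ (i,j) + Y' $$ (i,j)"
    if "i < n" "j < m" for i j k
    using assms(4)[of k] assms(5) that by auto
  thus ?thesis using assms(3,6) unfolding mat_tendsto_def by (auto intro: tendsto_add)
qed

lemma form_sum:
  fixes X :: "complex mat"
  assumes X: "X \<in> cmat n m" and v: "v \<in> cvec m" and w: "w \<in> cvec n"
  shows "(X *\<^sub>v v) \<bullet>c w = (\<Sum>i<n. \<Sum>j<m. X $$ (i, j) * v $ j * cnj (w $ i))"
  using w by (simp add: cscalar_sum mult_mat_vec_index_sum[OF X v] sum_distrib_right del: index_mult_mat_vec)

lemma mat_tendsto_form:
  assumes X: "\<And>k. X k \<in> cmat n m" "X' \<in> cmat n m" "mat_tendsto n m X X'"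
    and v: "v \<in> cvec m" and w: "w \<in> cvec n"
  shows "(\<lambda>k. (X k *\<^sub>v v) \<bullet>c w) \<longlonglongrightarrow> (X' *\<^sub>v v) \<bullet>c w"
  using X(3) unfolding form_sum[OF X(1) v w] form_sum[OF X(2) v w] mat_tendsto_def
  by (intro tendsto_sum tendsto_mult tendsto_const) auto

lemma mat_tendsto_hermitian:
  assumes X: "\<And>k. X k \<in> cmat n n" "X' \<in> cmat n n" "mat_tendsto n n X X'"
    and h: "\<And>k. adj (X k) = X k"
  shows "adj X' = X'"
proof (intro eq_matI)
  fix i j assume "i < dim_row X'" "j < dim_col X'"
  hence ij: "i < n" "j < n" using X by auto
  have "X k $$ (i, j) = cnj (X k $$ (j, i))" for k
    using mat_adjoint_index[of i "X k" j] X(1)[of k] ij unfolding h by auto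
  hence eq: "(\<lambda>k. cnj (X k $$ (j, i))) = (\<lambda>k. X k $$ (i, j))" by (intro ext) (rule sym)
  have "(\<lambda>k. cnj (X k $$ (j, i))) \<longlonglongrightarrow> cnj (X' $$ (j, i))"
    using X(3) ij unfolding mat_tendsto_def by (intro tendsto_cnj) auto
  moreover have "(\<lambda>k. X k $$ (i, j)) \<longlonglongrightarrow> X' $$ (i, j)" using X(3) ij unfolding mat_tendsto_def by auto
  ultimately have "X' $$ (i, j) = cnj (X' $$ (j, i))" unfolding eq by (blast intro: LIMSEQ_unique)
  thus "adj X' $$ (i, j) = X' $$ (i, j)" using ij X by simp
qed (use X in auto)

lemma mat_tendsto_pos_semidef:
  assumes X: "\<And>k. pos_semidef n (X k)" "X' \<in> cmat n n" "mat_tendsto n n X X'"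
  shows "pos_semidef n X'"
  unfolding pos_semidef_def
proof (intro conjI ballI)
  note XD = pos_semidefD[OF X(1)]
  show "adj X' = X'" by (rule mat_tendsto_hermitian[OF XD(1) X(2,3) XD(2)])
  fix v :: "complex vec" assume v: "v \<in> cvec n"
  have "(\<lambda>k. qform (X k) v) \<longlonglongrightarrow> qform X' v"
    by (intro tendsto_Re mat_tendsto_form[OF XD(1) X(2,3) v v])
  thus "0 \<le> qform X' v" using XD(3)[OF v] by (intro LIMSEQ_le_const) auto
qed fact

text \<open>The inner product \<open>Re (tr (X * adj Y))\<close>, which makes the Hermitian matrices a Euclidean space.\<close>

definition frob :: "nat \<Rightarrow> complex mat \<Rightarrow> complex mat \<Rightarrow> real" where
  "frob p X Y = (\<Sum>i<p. \<Sum>j<p. Re (X $$ (i, j) * cnj (Y $$ (i, j))))"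

definition outer :: "nat \<Rightarrow> complex vec \<Rightarrow> complex vec \<Rightarrow> complex mat" where
  "outer p v w = mat p p (\<lambda>(i, j). v $ i * cnj (w $ j))"

lemma outer_carrier[simp]: "outer p v w \<in> cmat p p"
  unfolding outer_def by simp

lemma mult_outer:
  assumes A: "A \<in> cmat p n" and B: "B \<in> cmat n p" and v: "v \<in> cvec n" and w: "w \<in> cvec n"
  shows "A * outer n v w * B = outer p (A *\<^sub>v v) (adj B *\<^sub>v w)"
proof (intro eq_matI)
  fix i j assume "i < dim_row (outer p (A *\<^sub>v v) (adj B *\<^sub>v w))" "j < dim_col (outer p (A *\<^sub>v v) (adj B *\<^sub>v w))"
  hence ij: "i < p" "j < p" by (auto simp: outer_def)
  have B': "adj B \<in> cmat p n" using B by simp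
  have "(A * outer n v w * B) $$ (i, j) = (\<Sum>q<n. (\<Sum>l<n. A $$ (i, l) * (v $ l * cnj (w $ q))) * B $$ (q, j))"
    using A B ij by (simp add: mult_mat_index_sum[of _ p n _ p] mult_mat_index_sum[of _ p n _ n] outer_def del: index_mult_mat)
  also have "\<dots> = (\<Sum>q<n. (\<Sum>l<n. A $$ (i, l) * v $ l) * (cnj (w $ q) * B $$ (q, j)))"
    by (simp add: sum_distrib_left sum_distrib_right mult_ac)
  also have "\<dots> = (\<Sum>l<n. A $$ (i, l) * v $ l) * cnj (\<Sum>q<n. adj B $$ (j, q) * w $ q)"
    using ij B by (simp add: sum_distrib_left mult_ac)
  also have "\<dots> = (A *\<^sub>v v) $ i * cnj ((adj B *\<^sub>v w) $ j)"
    unfolding mult_mat_vec_index_sum[OF A v ij(1)] mult_mat_vec_index_sum[OF B' w ij(2)] ..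
  finally show "(A * outer n v w * B) $$ (i, j) = outer p (A *\<^sub>v v) (adj B *\<^sub>v w) $$ (i, j)"
    using ij by (simp add: outer_def)
qed (use A B in \<open>auto simp: outer_def\<close>)

text \<open>Pairing with rank one matrices evaluates the form of \<open>Z\<close>; all variations of the nearest point below
are of this kind.\<close>

lemma frob_outer:
  assumes Z: "Z \<in> cmat p p" and v: "v \<in> cvec p" and w: "w \<in> cvec p"
  shows "frob p Z (outer p v w) = Re ((Z *\<^sub>v w) \<bullet>c v)"
  unfolding form_sum[OF Z w v] frob_def by (auto simp: outer_def mult_ac intro!: sum.cong)

lemma outer_form:
  assumes v: "v \<in> cvec p" and w: "w \<in> cvec p"
  shows "qform (outer p v v) w = (cmod (w \<bullet>c v))\<^sup>2"
proof -
  have "(outer p v v *\<^sub>v w) \<bullet>c w = (\<Sum>i<p. \<Sum>j<p. v $ i * cnj (w $ i) * (w $ j * cnj (v $ j)))"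
    unfolding form_sum[OF outer_carrier w w] by (auto simp: outer_def mult_ac intro!: sum.cong)
  also have "\<dots> = cnj (w \<bullet>c v) * (w \<bullet>c v)"
    using v w by (simp add: cscalar_sum[where n=p] sum_product mult_ac)
  also have "\<dots> = of_real ((cmod (w \<bullet>c v))\<^sup>2)" by (metis complex_norm_square mult.commute of_real_power)
  finally show ?thesis by simp
qed

lemma outer_hermitian: "adj (outer p v v) = outer p v v"
  by (intro eq_matI) (auto simp: outer_def)

lemma frob_add_smult:
  assumes "Z \<in> cmat p p" "D \<in> cmat p p"
  shows "frob p (Z + complex_of_real t \<cdot>\<^sub>m D) (Z + complex_of_real t \<cdot>\<^sub>m D) = frob p Z Z + 2 * t * frob p Z D + t\<^sup>2 * frob p D D"
proof -
  have *: "Re ((z + of_real t * d) * cnj (z + of_real t * d)) = Re (z * cnj z) + 2 * t * Re (z * cnj d) + t\<^sup>2 * Re (d * cnj d)" for z d :: complex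
    by (simp add: algebra_simps power2_eq_square)
  have "frob p (Z + complex_of_real t \<cdot>\<^sub>m D) (Z + complex_of_real t \<cdot>\<^sub>m D)
     = (\<Sum>i<p. \<Sum>j<p. Re (Z $$ (i,j) * cnj (Z $$ (i,j))) + 2 * t * Re (Z $$ (i,j) * cnj (D $$ (i,j))) + t\<^sup>2 * Re (D $$ (i,j) * cnj (D $$ (i,j))))"
    unfolding frob_def using assms by (intro sum.cong refl, subst *[symmetric]) simp
  also have "\<dots> = frob p Z Z + 2 * t * frob p Z D + t\<^sup>2 * frob p D D"
    unfolding frob_def by (simp only: sum.distrib sum_distrib_left)
  finally show ?thesis .
qed

lemma frob_self: "frob p X X = (\<Sum>i<p. \<Sum>j<p. (cmod (X $$ (i, j)))\<^sup>2)"
proof -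
  have "Re (z * cnj z) = (cmod z)\<^sup>2" for z by (metis complex_norm_square Re_complex_of_real of_real_power)
  thus ?thesis unfolding frob_def by simp
qed

lemma frob_self_nonneg: "0 \<le> frob p X X"
  unfolding frob_self by (simp add: sum_nonneg)

lemma frob_entry: "i < p \<Longrightarrow> j < p \<Longrightarrow> (cmod (X $$ (i, j)))\<^sup>2 \<le> frob p X X"
  unfolding frob_self
  by (rule order_trans[OF member_le_sum[of j "{..<p}" "\<lambda>j. (cmod (X $$ (i, j)))\<^sup>2"]
        member_le_sum[of i "{..<p}" "\<lambda>i. \<Sum>j<p. (cmod (X $$ (i, j)))\<^sup>2"]]) (auto simp: sum_nonneg)

text \<open>First order optimality: if no small step from \<open>Z\<close> in the direction \<open>D\<close> decreases the norm, the
linear term of the expansion in \<open>t\<close> cannot be negative.\<close>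

lemma frob_variation:
  assumes Z: "Z \<in> cmat p p" "D \<in> cmat p p" and t0: "t0 > 0"
    and le: "\<And>t. 0 < t \<Longrightarrow> t \<le> t0 \<Longrightarrow> frob p Z Z \<le> frob p (Z + complex_of_real t \<cdot>\<^sub>m D) (Z + complex_of_real t \<cdot>\<^sub>m D)"
  shows "0 \<le> frob p Z D"
proof (rule ccontr)
  assume neg: "\<not> 0 \<le> frob p Z D"
  define g where "g = frob p D D"
  define f where "f = - frob p Z D"
  have f: "f > 0" using neg f_def by simp
  have g: "g \<ge> 0" using frob_self_nonneg g_def by simp
  \<comment> \<open>Small enough for the quadratic term to be at most half of the linear one.\<close>
  define t where "t = min t0 (f / (g + 1))"
  have t: "0 < t" "t \<le> t0" unfolding t_def using t0 f g by auto
  have "0 \<le> t * (t * g - 2 * f)"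
    using le[OF t] frob_add_smult[OF Z, of t] by (simp add: f_def g_def power2_eq_square algebra_simps)
  hence "2 * f \<le> t * g" using t by (simp add: zero_le_mult_iff)
  also have "t * g \<le> f / (g + 1) * g" unfolding t_def using g by (intro mult_right_mono) auto
  also have "\<dots> \<le> f" using f g by (simp add: field_simps)
  finally show False using f by simp
qed

section \<open>The Kalman--Yakubovich--Popov lemma\<close>

text \<open>The Hermitian matrix of the form \<open>2 * Re ((H *\<^sub>v (J *\<^sub>v z)) \<bullet>c (N *\<^sub>v z))\<close>. When \<open>J\<close> reads off the
state \<open>x\<close> from \<open>z\<close> and \<open>N\<close> the velocity \<open>A *\<^sub>v x + B *\<^sub>v u\<close>, it is the derivative of the storage
\<open>qform H x\<close> along the trajectories of the system.\<close>

definition lyap :: "complex mat \<Rightarrow> complex mat \<Rightarrow> complex mat \<Rightarrow> complex mat" where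
  "lyap N J H = adj J * H * N + adj N * H * J"

definition entry_norm :: "nat \<Rightarrow> complex mat \<Rightarrow> real" where
  "entry_norm n X = (\<Sum>i<n. \<Sum>j<n. cmod (X $$ (i, j)))"

lemma entry_norm_nonneg: "0 \<le> entry_norm n X"
  unfolding entry_norm_def by (simp add: sum_nonneg)

lemma entry_le_entry_norm: "i < n \<Longrightarrow> j < n \<Longrightarrow> cmod (X $$ (i, j)) \<le> entry_norm n X"
  unfolding entry_norm_def
  by (rule order_trans[OF member_le_sum[of j "{..<n}" "\<lambda>j. cmod (X $$ (i, j))"]
        member_le_sum[of i "{..<n}" "\<lambda>i. \<Sum>j<n. cmod (X $$ (i, j))"]]) (auto simp: sum_nonneg)

lemma entry_norm_smult:
  assumes "X \<in> cmat n n"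
  shows "entry_norm n (a \<cdot>\<^sub>m X) = cmod a * entry_norm n X"
  using assms by (simp add: entry_norm_def norm_mult sum_distrib_left)

lemma entry_norm_form:
  assumes X: "X \<in> cmat n n" and v: "v \<in> cvec n"
  shows "cmod ((X *\<^sub>v v) \<bullet>c v) \<le> entry_norm n X * (\<Sum>i<n. cmod (v $ i))\<^sup>2"
proof -
  define M where "M = (\<Sum>i<n. cmod (v $ i))"
  have M: "cmod (v $ i) \<le> M" if "i < n" for i unfolding M_def using that by (intro member_le_sum) auto
  have M0: "M \<ge> 0" unfolding M_def by (simp add: sum_nonneg)
  have "cmod ((X *\<^sub>v v) \<bullet>c v) \<le> (\<Sum>i<n. \<Sum>j<n. cmod (X $$ (i, j) * v $ j * cnj (v $ i)))"
    unfolding form_sum[OF X v v] by (intro order_trans[OF norm_sum] sum_mono norm_sum)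
  also have "\<dots> \<le> (\<Sum>i<n. \<Sum>j<n. cmod (X $$ (i, j)) * M\<^sup>2)"
    using M M0 by (intro sum_mono) (auto simp: norm_mult power2_eq_square mult.assoc intro!: mult_left_mono mult_mono)
  also have "\<dots> = entry_norm n X * M\<^sup>2" unfolding entry_norm_def by (simp add: sum_distrib_right)
  finally show ?thesis unfolding M_def .
qed

context
  fixes N J :: "complex mat" and n p :: nat
  assumes N: "N \<in> cmat n p" and J: "J \<in> cmat n p"
begin

lemma lyap_parts:
  "adj J \<in> cmat p n" "adj N \<in> cmat p n"
  "H \<in> cmat n n \<Longrightarrow> adj J * H \<in> cmat p n" "H \<in> cmat n n \<Longrightarrow> adj N * H \<in> cmat p n"
  "H \<in> cmat n n \<Longrightarrow> adj J * H * N \<in> cmat p p" "H \<in> cmat n n \<Longrightarrow> adj N * H * J \<in> cmat p p"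
  using N J by (simp, simp, (metis mat_adjoint_carrier mult_carrier_mat)+)

lemma lyap_carrier: "H \<in> cmat n n \<Longrightarrow> lyap N J H \<in> cmat p p"
  unfolding lyap_def using N J by (metis add_carrier_mat mat_adjoint_carrier mult_carrier_mat)

lemma lyap_form:
  assumes H: "H \<in> cmat n n" "adj H = H" and z: "z \<in> cvec p"
  shows "qform (lyap N J H) z = 2 * Re ((H *\<^sub>v (J *\<^sub>v z)) \<bullet>c (N *\<^sub>v z))"
proof -
  have c: "N *\<^sub>v z \<in> cvec n" "J *\<^sub>v z \<in> cvec n" "H *\<^sub>v (N *\<^sub>v z) \<in> cvec n" "H *\<^sub>v (J *\<^sub>v z) \<in> cvec n"
    using N J H z by auto
  note a = lyap_parts(1,2) and m = lyap_parts(3,4)[OF H(1)] and m2 = lyap_parts(5,6)[OF H(1)]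
  have "lyap N J H *\<^sub>v z = adj J *\<^sub>v (H *\<^sub>v (N *\<^sub>v z)) + adj N *\<^sub>v (H *\<^sub>v (J *\<^sub>v z))"
    unfolding lyap_def add_mult_distrib_mat_vec[OF m2 z]
    using assoc_mult_mat_vec[OF m(1) N z] assoc_mult_mat_vec[OF m(2) J z] assoc_mult_mat_vec[OF a(1) H(1) c(1)]
      assoc_mult_mat_vec[OF a(2) H(1) c(2)] by simp
  moreover have "adj J *\<^sub>v (H *\<^sub>v (N *\<^sub>v z)) \<in> cvec p" "adj N *\<^sub>v (H *\<^sub>v (J *\<^sub>v z)) \<in> cvec p"
    using a c by (metis mult_mat_vec_carrier)+
  ultimately have "(lyap N J H *\<^sub>v z) \<bullet>c z = (H *\<^sub>v (N *\<^sub>v z)) \<bullet>c (J *\<^sub>v z) + (H *\<^sub>v (J *\<^sub>v z)) \<bullet>c (N *\<^sub>v z)"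
    using cscalar_adjoint2[OF J c(3) z] cscalar_adjoint2[OF N c(4) z] z by (simp add: cscalar_add_left[where n=p])
  thus ?thesis using hermitian_cscalar_cnj[OF H c(1,2)] by simp
qed

lemma lyap_hermitian:
  assumes H: "H \<in> cmat n n" "adj H = H"
  shows "adj (lyap N J H) = lyap N J H"
proof -
  note a = lyap_parts(1,2) and m = lyap_parts(3,4)[OF H(1)] and m2 = lyap_parts(5,6)[OF H(1)]
  have "adj (adj J * H * N) = adj N * H * J"
    using mat_adjoint_mult[OF m(1) N] mat_adjoint_mult[OF a(1) H(1)] H assoc_mult_mat[OF a(2) H(1) J] by simp
  moreover have "adj (adj N * H * J) = adj J * H * N"
    using mat_adjoint_mult[OF m(2) J] mat_adjoint_mult[OF a(2) H(1)] H assoc_mult_mat[OF a(1) H(1) N] by simp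
  ultimately show ?thesis unfolding lyap_def mat_adjoint_add[OF m2] using comm_add_mat[OF m2] by simp
qed

lemma lyap_smult:
  assumes H: "H \<in> cmat n n"
  shows "lyap N J (a \<cdot>\<^sub>m H) = a \<cdot>\<^sub>m lyap N J H"
proof -
  note a = lyap_parts(1,2) and m = lyap_parts(3,4)[OF H] and m2 = lyap_parts(5,6)[OF H]
  show ?thesis unfolding lyap_def mult_smult_distrib[OF a(1) H] mult_smult_distrib[OF a(2) H]
      mult_smult_assoc_mat[OF m(1) N] mult_smult_assoc_mat[OF m(2) J] add_smult_distrib_left_mat[OF m2] ..
qed

lemma lyap_add:
  assumes H: "H \<in> cmat n n" and G: "G \<in> cmat n n"
  shows "lyap N J (H + G) = lyap N J H + lyap N J G"
proof -
  note a = lyap_parts(1,2) and m = lyap_parts(3,4)[OF H] lyap_parts(3,4)[OF G]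
    and m2 = lyap_parts(5,6)[OF H] lyap_parts(5,6)[OF G]
  show ?thesis unfolding lyap_def mult_add_distrib_mat[OF a(1) H G] mult_add_distrib_mat[OF a(2) H G]
      add_mult_distrib_mat[OF m(1,3) N] add_mult_distrib_mat[OF m(2,4) J]
    using m2 by (intro eq_matI) auto
qed

lemma lyap_tendsto:
  assumes H: "\<And>k. H k \<in> cmat n n" "H' \<in> cmat n n" "mat_tendsto n n H H'"
  shows "mat_tendsto p p (\<lambda>k. lyap N J (H k)) (lyap N J H')"
proof -
  note a = lyap_parts(1,2) and m = lyap_parts(3,4) and m2 = lyap_parts(5,6)
  note t1 = mat_tendsto_mult[OF a(1) a(1) mat_tendsto_const H]
  note t2 = mat_tendsto_mult[OF a(2) a(2) mat_tendsto_const H]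
  show ?thesis unfolding lyap_def
    by (rule mat_tendsto_add[OF m2(1)[OF H(1)] m2(1)[OF H(2)] _ m2(2)[OF H(1)] m2(2)[OF H(2)]])
      (rule mat_tendsto_mult[OF m(1)[OF H(1)] m(1)[OF H(2)] t1 N N mat_tendsto_const]
            mat_tendsto_mult[OF m(2)[OF H(1)] m(2)[OF H(2)] t2 J J mat_tendsto_const])+
qed

lemma lyap_outer:
  assumes a: "a \<in> cvec n"
  shows "lyap N J (outer n a a) = outer p (adj J *\<^sub>v a) (adj N *\<^sub>v a) + outer p (adj N *\<^sub>v a) (adj J *\<^sub>v a)"
  unfolding lyap_def using N J a by (simp add: mult_outer[of _ p n])

lemma pos_semidef_smult:
  assumes "pos_semidef q P" "0 \<le> t"
  shows "pos_semidef q (complex_of_real t \<cdot>\<^sub>m P)"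
proof -
  note PD = pos_semidefD[OF assms(1)]
  have e: "(complex_of_real t \<cdot>\<^sub>m P) *\<^sub>v v = complex_of_real t \<cdot>\<^sub>v (P *\<^sub>v v)" if "v \<in> cvec q" for v
    using that PD(1) by (intro eq_vecI) auto
  have "Re ((complex_of_real t \<cdot>\<^sub>m P *\<^sub>v v) \<bullet>c v) = t * qform P v" if v: "v \<in> cvec q" for v
    unfolding e[OF v] using cscalar_smult_left[of "P *\<^sub>v v" q v "complex_of_real t"] PD(1) v by simp
  thus ?thesis unfolding pos_semidef_def using PD assms(2) by (auto simp: mat_adjoint_smult)
qed

text \<open>A sequence of normalised matrices \<open>H\<close> for which \<open>lyap N J H + P\<close> tends to \<open>0\<close> would have a limit \<open>Y\<close> of
norm \<open>1\<close> with \<open>lyap N J Y \<le> 0\<close>, which \<open>ctrl\<close> excludes. The estimate is what makes the cone of all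
\<open>lyap N J H + P\<close> closed.\<close>

lemma lyap_coercive:
  assumes ctrl: "\<And>H. H \<in> cmat n n \<Longrightarrow> adj H = H \<Longrightarrow>
      (\<And>z. z \<in> cvec p \<Longrightarrow> Re ((H *\<^sub>v (J *\<^sub>v z)) \<bullet>c (N *\<^sub>v z)) \<le> 0) \<Longrightarrow> H = 0\<^sub>m n n"
  shows "\<exists>C. \<forall>H P. H \<in> cmat n n \<and> adj H = H \<and> pos_semidef p P \<longrightarrow>
     entry_norm n H \<le> C * entry_norm p (lyap N J H + P)"
proof (rule ccontr)
  assume "\<nexists>C. \<forall>H P. H \<in> cmat n n \<and> adj H = H \<and> pos_semidef p P \<longrightarrow>
     entry_norm n H \<le> C * entry_norm p (lyap N J H + P)"
  hence "\<forall>C. \<exists>H P. H \<in> cmat n n \<and> adj H = H \<and> pos_semidef p P \<and>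
     C * entry_norm p (lyap N J H + P) < entry_norm n H" by (meson not_le)
  \<comment> \<open>Constants tending to infinity; normalisation later turns them into residuals tending to 0.\<close>
  hence "\<forall>k. \<exists>H P. H \<in> cmat n n \<and> adj H = H \<and> pos_semidef p P \<and>
     real (Suc k) * entry_norm p (lyap N J H + P) < entry_norm n H" by blast
  then obtain H P where H: "\<And>k. H k \<in> cmat n n" "\<And>k. adj (H k) = H k" and P: "\<And>k. pos_semidef p (P k)"
    and lt: "\<And>k. real (Suc k) * entry_norm p (lyap N J (H k) + P k) < entry_norm n (H k)" by metis
  define h where "h k = entry_norm n (H k)" for k
  have h: "h k > 0" for k using lt[of k] entry_norm_nonneg[of p "lyap N J (H k) + P k"] unfolding h_def
    by (smt (verit) mult_nonneg_nonneg of_nat_0_le_iff)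
  define H' where "H' k = complex_of_real (1 / h k) \<cdot>\<^sub>m H k" for k
  define P' where "P' k = complex_of_real (1 / h k) \<cdot>\<^sub>m P k" for k
  have H': "H' k \<in> cmat n n" "adj (H' k) = H' k" for k
    unfolding H'_def using H by (auto simp: mat_adjoint_smult)
  have P': "pos_semidef p (P' k)" for k unfolding P'_def using h[of k] by (intro pos_semidef_smult P) simp
  have nH': "entry_norm n (H' k) = 1" for k
    unfolding H'_def entry_norm_smult[OF H(1)] using h[of k] by (simp add: norm_divide h_def[symmetric])
  have LP: "lyap N J (H' k) + P' k = complex_of_real (1 / h k) \<cdot>\<^sub>m (lyap N J (H k) + P k)" for k
    unfolding H'_def P'_def lyap_smult[OF H(1)] 
    by (rule add_smult_distrib_left_mat[OF lyap_carrier[OF H(1)] pos_semidefD(1)[OF P], symmetric])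
  have LPc: "lyap N J (H k) + P k \<in> cmat p p" for k using lyap_carrier[OF H(1)] pos_semidefD(1)[OF P] by (metis add_carrier_mat)
  have small: "entry_norm p (lyap N J (H' k) + P' k) \<le> 1 / real (Suc k)" for k
    unfolding LP entry_norm_smult[OF LPc] using lt[of k] h[of k] by (simp add: norm_divide h_def[symmetric] field_simps)
  obtain r Y where r: "strict_mono (r :: nat \<Rightarrow> nat)" and Y: "Y \<in> cmat n n" and lim: "mat_tendsto n n (\<lambda>k. H' (r k)) Y"
    using mat_convergent_subseq[of n n H' 1] entry_le_entry_norm nH' by metis
  have Yh: "adj Y = Y" using mat_tendsto_hermitian[OF _ Y lim] H' by auto
  have "Y = 0\<^sub>m n n"
  proof (rule ctrl[OF Y Yh])
    fix z :: "complex vec" assume z: "z \<in> cvec p"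
    define b where "b = (\<Sum>i<p. cmod (z $ i))\<^sup>2"
    have Nz: "N *\<^sub>v z \<in> cvec n" "J *\<^sub>v z \<in> cvec n" using N J z by auto
    have "2 * Re ((H' k *\<^sub>v (J *\<^sub>v z)) \<bullet>c (N *\<^sub>v z)) \<le> 1 / real (Suc k) * b" for k
    proof -
      have c: "lyap N J (H' k) \<in> cmat p p" "P' k \<in> cmat p p" "lyap N J (H' k) + P' k \<in> cmat p p"
        using lyap_carrier[OF H'(1)] pos_semidefD(1)[OF P'] by auto
      have "((lyap N J (H' k) + P' k) *\<^sub>v z) \<bullet>c z = (lyap N J (H' k) *\<^sub>v z) \<bullet>c z + (P' k *\<^sub>v z) \<bullet>c z"
        unfolding add_mult_distrib_mat_vec[OF c(1,2) z] using c z by (intro cscalar_add_left) auto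
      hence "2 * Re ((H' k *\<^sub>v (J *\<^sub>v z)) \<bullet>c (N *\<^sub>v z)) = Re (((lyap N J (H' k) + P' k) *\<^sub>v z) \<bullet>c z) - qform (P' k) z"
        using lyap_form[OF H' z, of k] by simp
      also have "\<dots> \<le> cmod (((lyap N J (H' k) + P' k) *\<^sub>v z) \<bullet>c z)"
        using pos_semidefD(3)[OF P' z, of k] complex_Re_le_cmod by (smt (verit))
      also have "\<dots> \<le> entry_norm p (lyap N J (H' k) + P' k) * b" unfolding b_def by (rule entry_norm_form[OF c(3) z])
      also have "\<dots> \<le> 1 / real (Suc k) * b" using small[of k] by (intro mult_right_mono) (auto simp: b_def)
      finally show ?thesis .
    qed
    hence "2 * Re ((H' (r k) *\<^sub>v (J *\<^sub>v z)) \<bullet>c (N *\<^sub>v z)) \<le> 1 / real (Suc (r k)) * b" for k by blast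
    moreover have "(\<lambda>k. 2 * Re ((H' (r k) *\<^sub>v (J *\<^sub>v z)) \<bullet>c (N *\<^sub>v z))) \<longlonglongrightarrow> 2 * Re ((Y *\<^sub>v (J *\<^sub>v z)) \<bullet>c (N *\<^sub>v z))"
      by (intro tendsto_mult tendsto_const tendsto_Re mat_tendsto_form[OF H'(1) Y lim Nz(2,1)])
    moreover have "(\<lambda>k. 1 / real (Suc (r k)) * b) \<longlonglongrightarrow> 0 * b"
      using LIMSEQ_subseq_LIMSEQ[OF lim_inverse_n'[THEN LIMSEQ_Suc] r] by (intro tendsto_mult tendsto_const) (simp add: o_def)
    ultimately have "2 * Re ((Y *\<^sub>v (J *\<^sub>v z)) \<bullet>c (N *\<^sub>v z)) \<le> 0 * b"
      by (intro LIMSEQ_le[where X = "\<lambda>k. 2 * Re ((H' (r k) *\<^sub>v (J *\<^sub>v z)) \<bullet>c (N *\<^sub>v z))"]) auto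
    thus "Re ((Y *\<^sub>v (J *\<^sub>v z)) \<bullet>c (N *\<^sub>v z)) \<le> 0" by simp
  qed
  moreover have "(\<lambda>k. entry_norm n (H' (r k))) \<longlonglongrightarrow> entry_norm n Y"
    unfolding entry_norm_def using lim unfolding mat_tendsto_def by (intro tendsto_sum tendsto_norm) auto
  hence "entry_norm n Y = 1" unfolding nH' by (simp add: LIMSEQ_const_iff)
  ultimately show False by (simp add: entry_norm_def)
qed

end

lemma pos_semidef_add:
  assumes "pos_semidef n P" "pos_semidef n Q"
  shows "pos_semidef n (P + Q)"
proof -
  note PD = pos_semidefD[OF assms(1)] and QD = pos_semidefD[OF assms(2)]
  have "qform (P + Q) v = qform P v + qform Q v" if v: "v \<in> cvec n" for v
    unfolding add_mult_distrib_mat_vec[OF PD(1) QD(1) v]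
    using cscalar_add_left[of "P *\<^sub>v v" n "Q *\<^sub>v v" v] PD(1) QD(1) v by auto
  thus ?thesis unfolding pos_semidef_def using PD QD mat_adjoint_add[OF PD(1) QD(1)] by auto
qed

lemma outer_pos_semidef: "v \<in> cvec p \<Longrightarrow> pos_semidef p (outer p v v)"
  unfolding pos_semidef_def using outer_form outer_hermitian by auto

lemma frob_add_right:
  assumes "X \<in> cmat p p" "Y \<in> cmat p p"
  shows "frob p Z (X + Y) = frob p Z X + frob p Z Y"
  unfolding frob_def using assms by (simp add: distrib_left sum.distrib)

lemma frob_smult_right:
  assumes "X \<in> cmat p p"
  shows "frob p Z (complex_of_real t \<cdot>\<^sub>m X) = t * frob p Z X"
  unfolding frob_def using assms by (simp add: sum_distrib_left distrib_left sum.distrib mult_ac)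

text \<open>The subtracted form is \<open>t * (cmod ((P *\<^sub>v w) \<bullet>c v))\<^sup>2\<close>, which the Cauchy--Schwarz inequality keeps
below \<open>qform P w\<close>.\<close>

lemma pos_semidef_deflate:
  assumes P: "pos_semidef p P" and v: "v \<in> cvec p" and q: "qform P v > 0"
    and t: "0 \<le> t" "t \<le> 1 / qform P v"
  shows "pos_semidef p (P + complex_of_real t \<cdot>\<^sub>m (complex_of_real (-1) \<cdot>\<^sub>m outer p (P *\<^sub>v v) (P *\<^sub>v v)))"
proof -
  note PD = pos_semidefD[OF P]
  let ?O = "outer p (P *\<^sub>v v) (P *\<^sub>v v)"
  let ?X = "complex_of_real t \<cdot>\<^sub>m (complex_of_real (-1) \<cdot>\<^sub>m ?O)"
  have Pv: "P *\<^sub>v v \<in> cvec p" using PD v by auto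
  have X: "?X \<in> cmat p p" by simp
  have Xh: "adj ?X = ?X" by (simp add: mat_adjoint_smult outer_hermitian)
  have e: "?X *\<^sub>v w = complex_of_real (- t) \<cdot>\<^sub>v (?O *\<^sub>v w)" if "w \<in> cvec p" for w
    using that by (intro eq_vecI) (auto simp: outer_def)
  have "0 \<le> qform (P + ?X) w" if w: "w \<in> cvec p" for w
  proof -
    have Ow: "?O *\<^sub>v w \<in> cvec p" using w by (metis mult_mat_vec_carrier outer_carrier)
    have "((P + ?X) *\<^sub>v w) \<bullet>c w = (P *\<^sub>v w) \<bullet>c w + complex_of_real (- t) * ((?O *\<^sub>v w) \<bullet>c w)"
      unfolding add_mult_distrib_mat_vec[OF PD(1) X w] e[OF w]
      using cscalar_add_left[of "P *\<^sub>v w" p "complex_of_real (- t) \<cdot>\<^sub>v (?O *\<^sub>v w)" w] cscalar_smult_left[OF Ow w] PD(1) w Ow by auto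
    hence "qform (P + ?X) w = qform P w - t * (cmod (w \<bullet>c (P *\<^sub>v v)))\<^sup>2"
      using outer_form[OF Pv w] by simp
    moreover have "w \<bullet>c (P *\<^sub>v v) = (P *\<^sub>v w) \<bullet>c v" using hermitian_cscalar[OF PD(1,2) w v] by simp
    moreover have "t * (cmod ((P *\<^sub>v w) \<bullet>c v))\<^sup>2 \<le> 1 / qform P v * (cmod ((P *\<^sub>v w) \<bullet>c v))\<^sup>2"
      by (intro mult_right_mono t) auto
    moreover have "1 / qform P v * (cmod ((P *\<^sub>v w) \<bullet>c v))\<^sup>2 \<le> qform P w" using pos_semidef_cauchy[OF P v w q] by simp
    ultimately show ?thesis by simp
  qed
  thus ?thesis unfolding pos_semidef_def using PD(1,2) X Xh mat_adjoint_add[OF PD(1) X] by auto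
qed

context
  fixes N J Q0 :: "complex mat" and n p :: nat
  assumes N: "N \<in> cmat n p" and J: "J \<in> cmat n p"
    and Q0: "Q0 \<in> cmat p p" "adj Q0 = Q0"
    and ctrl: "\<And>H. H \<in> cmat n n \<Longrightarrow> adj H = H \<Longrightarrow>
      (\<And>z. z \<in> cvec p \<Longrightarrow> Re ((H *\<^sub>v (J *\<^sub>v z)) \<bullet>c (N *\<^sub>v z)) \<le> 0) \<Longrightarrow> H = 0\<^sub>m n n"
begin

text \<open>Along a minimising sequence the residuals are bounded, hence so are the \<open>H k\<close> by coercivity. A common
subsequence makes both converge, and the limit of the \<open>P k\<close> is recovered from these two limits.\<close>

lemma nearest_point:
  "\<exists>H P. H \<in> cmat n n \<and> adj H = H \<and> pos_semidef p P \<and>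
    (\<forall>H' P'. H' \<in> cmat n n \<and> adj H' = H' \<and> pos_semidef p P' \<longrightarrow>
      frob p (lyap N J H + P - Q0) (lyap N J H + P - Q0) \<le> frob p (lyap N J H' + P' - Q0) (lyap N J H' + P' - Q0))"
proof -
  define fs where "fs X = frob p X X" for X
  define adm where "adm H P \<longleftrightarrow> H \<in> cmat n n \<and> adj H = H \<and> pos_semidef p P" for H P :: "complex mat"
  define X where "X H P = lyap N J H + P - Q0" for H P
  define S where "S = {fs (X H P) | H P. adm H P}"
  have "0\<^sub>m p p *\<^sub>v v = (0\<^sub>v p :: complex vec)" if "v \<in> cvec p" for v
    using that by (intro eq_vecI) auto
  hence "adm (0\<^sub>m n n) (0\<^sub>m p p)" unfolding adm_def pos_semidef_def by (auto intro!: eq_matI)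
  hence Sne: "S \<noteq> {}" unfolding S_def by auto
  have Sbd: "bdd_below S" unfolding S_def fs_def using frob_self_nonneg by (intro bdd_belowI[of _ 0]) auto
  define \<mu> where "\<mu> = Inf S"
  have "\<exists>H P. adm H P \<and> fs (X H P) < \<mu> + 1 / real (Suc k)" for k
  proof -
    have "Inf S < \<mu> + 1 / real (Suc k)" unfolding \<mu>_def by simp
    then obtain s where "s \<in> S" "s < \<mu> + 1 / real (Suc k)" using cInf_lessD[OF Sne] by blast
    thus ?thesis unfolding S_def by auto
  qed
  then obtain H P where HP: "\<And>k. adm (H k) (P k)" and lt: "\<And>k. fs (X (H k) (P k)) < \<mu> + 1 / real (Suc k)" by metis
  have H: "H k \<in> cmat n n" "adj (H k) = H k" and P: "pos_semidef p (P k)" for k using HP[of k] unfolding adm_def by auto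
  have LP: "lyap N J (H k) \<in> cmat p p" "P k \<in> cmat p p" for k
    using lyap_carrier[OF N J H(1)] pos_semidefD(1)[OF P] by auto
  have Xc: "X (H k) (P k) \<in> cmat p p" for k unfolding X_def using LP Q0 by (metis minus_carrier_mat)
  define s where "s = sqrt (\<mu> + 1)"
  have Xb: "cmod (X (H k) (P k) $$ (i, j)) \<le> s" if ij: "i < p" "j < p" for i j k
  proof -
    have "(cmod (X (H k) (P k) $$ (i, j)))\<^sup>2 \<le> fs (X (H k) (P k))" unfolding fs_def by (rule frob_entry[OF ij])
    also have "\<dots> \<le> \<mu> + 1" using lt[of k] by (smt (verit) divide_le_eq_1 of_nat_0_less_iff of_nat_Suc of_nat_0_le_iff)
    finally show ?thesis unfolding s_def by (simp add: real_le_rsqrt)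
  qed
  obtain C where C: "\<And>k. entry_norm n (H k) \<le> C * entry_norm p (lyap N J (H k) + P k)"
    using lyap_coercive[OF N J ctrl] H P by metis
  define E where "E = (\<Sum>i<p. \<Sum>j<p. s + cmod (Q0 $$ (i, j)))"
  have nE: "entry_norm p (lyap N J (H k) + P k) \<le> E" for k
    unfolding entry_norm_def E_def
  proof (intro sum_mono)
    fix i j assume "i \<in> {..<p}" "j \<in> {..<p}"
    hence ij: "i < p" "j < p" by auto
    have "(lyap N J (H k) + P k) $$ (i, j) = X (H k) (P k) $$ (i, j) + Q0 $$ (i, j)"
      unfolding X_def using ij LP(1)[of k] LP(2)[of k] Q0 by simp
    thus "cmod ((lyap N J (H k) + P k) $$ (i, j)) \<le> s + cmod (Q0 $$ (i, j))"
      using Xb[OF ij, of k] norm_triangle_ineq[of "X (H k) (P k) $$ (i, j)" "Q0 $$ (i, j)"] by simp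
  qed
  have Hb: "cmod (H k $$ (i, j)) \<le> \<bar>C\<bar> * E" if ij: "i < n" "j < n" for i j k
  proof -
    have "cmod (H k $$ (i, j)) \<le> C * entry_norm p (lyap N J (H k) + P k)"
      using entry_le_entry_norm[OF ij] C order_trans by blast
    also have "\<dots> \<le> \<bar>C\<bar> * E" using nE[of k] entry_norm_nonneg[of p "lyap N J (H k) + P k"] by (intro mult_mono) auto
    finally show ?thesis .
  qed
  obtain r H' where r: "strict_mono (r :: nat \<Rightarrow> nat)" and H': "H' \<in> cmat n n" and limH: "mat_tendsto n n (\<lambda>k. H (r k)) H'"
    using mat_convergent_subseq[of n n H, OF Hb] by blast
  obtain r' X' where r': "strict_mono (r' :: nat \<Rightarrow> nat)" and X': "X' \<in> cmat p p"
    and limX: "mat_tendsto p p (\<lambda>k. X (H (r (r' k))) (P (r (r' k)))) X'"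
    using mat_convergent_subseq[of p p "\<lambda>k. X (H (r k)) (P (r k))", OF Xb] by blast
  define u where "u = r \<circ> r'"
  have u: "strict_mono u" unfolding u_def using r r' by (simp add: strict_mono_o)
  have limH: "mat_tendsto n n (\<lambda>k. H (u k)) H'" using mat_tendsto_subseq[OF limH r'] unfolding u_def by simp
  have limX: "mat_tendsto p p (\<lambda>k. X (H (u k)) (P (u k))) X'" using limX unfolding u_def by simp
  have H'h: "adj H' = H'" by (rule mat_tendsto_hermitian[OF H(1) H' limH H(2)])
  have limL: "mat_tendsto p p (\<lambda>k. lyap N J (H (u k))) (lyap N J H')" by (rule lyap_tendsto[OF N J H(1) H' limH])
  have LH': "lyap N J H' \<in> cmat p p" by (rule lyap_carrier[OF N J H'])
  define P' where "P' = X' - lyap N J H' + Q0"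
  have P'c: "P' \<in> cmat p p" unfolding P'_def using X' LH' Q0 by auto
  have "mat_tendsto p p (\<lambda>k. P (u k)) P'" unfolding mat_tendsto_def
  proof (intro allI impI)
    fix i j assume ij: "i < p" "j < p"
    have "P (u k) $$ (i, j) = X (H (u k)) (P (u k)) $$ (i, j) - lyap N J (H (u k)) $$ (i, j) + Q0 $$ (i, j)" for k
      unfolding X_def using ij LP(1)[of "u k"] LP(2)[of "u k"] Q0 by simp
    moreover have "P' $$ (i, j) = X' $$ (i, j) - lyap N J H' $$ (i, j) + Q0 $$ (i, j)"
      unfolding P'_def using ij X' LH' Q0 by simp
    ultimately show "(\<lambda>k. P (u k) $$ (i, j)) \<longlonglongrightarrow> P' $$ (i, j)"
      using limX limL ij unfolding mat_tendsto_def by (simp add: tendsto_add tendsto_diff)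
  qed
  hence P': "pos_semidef p P'" by (rule mat_tendsto_pos_semidef[OF P P'c])
  have X'eq: "X H' P' = X'" unfolding X_def P'_def using X' LH' Q0 by (intro eq_matI) auto
  have "(\<lambda>k. fs (X (H (u k)) (P (u k)))) \<longlonglongrightarrow> fs X'"
    unfolding fs_def frob_self using limX unfolding mat_tendsto_def
    by (intro tendsto_sum tendsto_power tendsto_norm) auto
  moreover have "(\<lambda>k. \<mu> + 1 / real (Suc (u k))) \<longlonglongrightarrow> \<mu> + 0"
    using LIMSEQ_subseq_LIMSEQ[OF lim_inverse_n'[THEN LIMSEQ_Suc] u] by (intro tendsto_add tendsto_const) (simp add: o_def)
  ultimately have le: "fs X' \<le> \<mu>"
    using lt by (intro LIMSEQ_le[where X = "\<lambda>k. fs (X (H (u k)) (P (u k)))"]) (auto intro: less_imp_le)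
  have "fs (X H' P') \<le> fs (X G R)" if "adm G R" for G R
  proof -
    have "fs (X G R) \<in> S" unfolding S_def using that by auto
    hence "\<mu> \<le> fs (X G R)" unfolding \<mu>_def using Sbd by (rule cInf_lower)
    thus ?thesis using le X'eq by simp
  qed
  thus ?thesis using H' H'h P' unfolding adm_def X_def fs_def by blast
qed

text \<open>The Kalman--Yakubovich--Popov lemma, by projecting \<open>Q0\<close> onto the closed convex cone of all
\<open>lyap N J H + P\<close> with \<open>H\<close> Hermitian and \<open>P\<close> semidefinite. Let \<open>Z\<close> be the residual at the nearest point.
Varying \<open>P\<close> by \<open>outer p v v\<close> shows that \<open>Z\<close> is semidefinite, varying \<open>H\<close> by \<open>outer n a a\<close> and its negative
shows that \<open>N * Z * adj J\<close> is skew-Hermitian, and deflating \<open>P\<close> shows \<open>Z * P = 0\<close>.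

Suppose \<open>Z\<close> is not \<open>0\<close>. If \<open>J\<close> annihilates a nonzero vector of the range of \<open>Z\<close>, call it \<open>z\<close>. Otherwise
\<open>Z * adj J * J\<close> is a bijection of that range, skewness gives \<open>N *\<^sub>v z \<in> J ` range Z\<close> there, and the pencil
has an eigenvector \<open>z\<close> in the range of \<open>Z\<close>, whose eigenvalue is imaginary by skewness again. In both cases
\<open>lyap N J H\<close> and \<open>P\<close> contribute nothing to \<open>qform Q0 z\<close>, which is therefore \<open>- qform Z z\<close>; the frequency
condition forces \<open>Z *\<^sub>v z = 0\<close>, impossible for a nonzero vector in the range of a Hermitian matrix.\<close>

theorem kyp_lemma:
  assumes freq: "\<And>z \<omega>. z \<in> cvec p \<Longrightarrow>
      J *\<^sub>v z = 0\<^sub>v n \<or> N *\<^sub>v z = (\<i> * complex_of_real \<omega>) \<cdot>\<^sub>v (J *\<^sub>v z) \<Longrightarrow> 0 \<le> qform Q0 z"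
  shows "\<exists>H. H \<in> cmat n n \<and> adj H = H \<and>
    (\<forall>z \<in> cvec p. 2 * Re ((H *\<^sub>v (J *\<^sub>v z)) \<bullet>c (N *\<^sub>v z)) \<le> qform Q0 z)"
proof -
  obtain H P where H: "H \<in> cmat n n" "adj H = H" and P: "pos_semidef p P"
    and opt: "\<And>H' P'. H' \<in> cmat n n \<Longrightarrow> adj H' = H' \<Longrightarrow> pos_semidef p P' \<Longrightarrow>
      frob p (lyap N J H + P - Q0) (lyap N J H + P - Q0) \<le> frob p (lyap N J H' + P' - Q0) (lyap N J H' + P' - Q0)"
    using nearest_point by metis
  note PD = pos_semidefD[OF P]
  define Z where "Z = lyap N J H + P - Q0"
  have L: "lyap N J H \<in> cmat p p" by (rule lyap_carrier[OF N J H(1)])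
  have Z: "Z \<in> cmat p p" unfolding Z_def using L PD Q0 by auto
  have Zh: "adj Z = Z" unfolding Z_def
    using mat_adjoint_minus[of "lyap N J H + P" p p Q0] mat_adjoint_add[OF L PD(1)] lyap_hermitian[OF N J H] PD L Q0 by simp
  \<comment> \<open>The two families of variations: of \<open>P\<close> within the semidefinite cone, of \<open>H\<close> in any direction.\<close>
  have var_P: "0 \<le> frob p Z D" if D: "D \<in> cmat p p" and t0: "t0 > 0"
    and psd: "\<And>t. 0 < t \<Longrightarrow> t \<le> t0 \<Longrightarrow> pos_semidef p (P + complex_of_real t \<cdot>\<^sub>m D)" for D t0
  proof (rule frob_variation[OF Z D t0])
    fix t :: real assume t: "0 < t" "t \<le> t0"
    have "lyap N J H + (P + complex_of_real t \<cdot>\<^sub>m D) - Q0 = Z + complex_of_real t \<cdot>\<^sub>m D"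
      unfolding Z_def using L PD(1) Q0 D by (intro eq_matI) auto
    thus "frob p Z Z \<le> frob p (Z + complex_of_real t \<cdot>\<^sub>m D) (Z + complex_of_real t \<cdot>\<^sub>m D)"
      using opt[OF H psd[OF t]] unfolding Z_def[symmetric] by simp
  qed
  have var_H: "0 \<le> frob p Z (lyap N J D)" if D: "D \<in> cmat n n" "adj D = D" for D
  proof (rule frob_variation[OF Z lyap_carrier[OF N J D(1)]])
    fix t :: real assume "0 < t" "t \<le> 1"
    have tD: "complex_of_real t \<cdot>\<^sub>m D \<in> cmat n n" using D by simp
    have "lyap N J (H + complex_of_real t \<cdot>\<^sub>m D) + P - Q0 = Z + complex_of_real t \<cdot>\<^sub>m lyap N J D"
      unfolding Z_def lyap_add[OF N J H(1) tD] lyap_smult[OF N J D(1)]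
      using L lyap_carrier[OF N J D(1)] PD(1) Q0 by (intro eq_matI) auto
    moreover have "adj (H + complex_of_real t \<cdot>\<^sub>m D) = H + complex_of_real t \<cdot>\<^sub>m D"
      using mat_adjoint_add[OF H(1) tD] H D by (simp add: mat_adjoint_smult)
    ultimately show "frob p Z Z \<le> frob p (Z + complex_of_real t \<cdot>\<^sub>m lyap N J D) (Z + complex_of_real t \<cdot>\<^sub>m lyap N J D)"
      using opt[OF _ _ P, of "H + complex_of_real t \<cdot>\<^sub>m D"] H(1) tD unfolding Z_def[symmetric] by simp
  qed simp
  have Zpsd: "pos_semidef p Z" unfolding pos_semidef_def
  proof (intro conjI ballI Z Zh)
    fix v :: "complex vec" assume v: "v \<in> cvec p"
    have "0 \<le> frob p Z (outer p v v)"
      by (rule var_P[of _ 1]) (auto intro!: pos_semidef_add[OF P] pos_semidef_smult outer_pos_semidef[OF v])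
    thus "0 \<le> qform Z v" unfolding frob_outer[OF Z v v] .
  qed
  have ZP: "Z *\<^sub>v (P *\<^sub>v v) = 0\<^sub>v p" if v: "v \<in> cvec p" for v
  proof (cases "qform P v > 0")
    case False
    hence "P *\<^sub>v v = 0\<^sub>v p" using pos_semidef_zero_form[OF P v] PD(3)[OF v] by simp
    thus ?thesis using mult_mat_vec_zero[OF Z] by simp
  next
    case True
    have Pv: "P *\<^sub>v v \<in> cvec p" using PD v by auto
    have "0 \<le> frob p Z (complex_of_real (-1) \<cdot>\<^sub>m outer p (P *\<^sub>v v) (P *\<^sub>v v))"
    proof (rule var_P[of _ "1 / qform P v"])
      show "pos_semidef p (P + complex_of_real t \<cdot>\<^sub>m (complex_of_real (-1) \<cdot>\<^sub>m outer p (P *\<^sub>v v) (P *\<^sub>v v)))"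
        if "0 < t" "t \<le> 1 / qform P v" for t
        by (rule pos_semidef_deflate[OF P v True]) (use that in auto)
    qed (use True in auto)
    hence "qform Z (P *\<^sub>v v) \<le> 0"
      unfolding frob_smult_right[OF outer_carrier] frob_outer[OF Z Pv Pv] by simp
    hence "qform Z (P *\<^sub>v v) = 0" using pos_semidefD(3)[OF Zpsd Pv] by simp
    thus ?thesis by (rule pos_semidef_zero_form[OF Zpsd Pv])
  qed
  \<comment> \<open>Taking adjoints in \<open>Z * P = 0\<close>.\<close>
  have PZ: "P *\<^sub>v (Z *\<^sub>v w) = 0\<^sub>v p" if w: "w \<in> cvec p" for w
  proof -
    have Zw: "Z *\<^sub>v w \<in> cvec p" using Z w by auto
    have PZw: "P *\<^sub>v (Z *\<^sub>v w) \<in> cvec p" using PD(1) Zw by auto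
    have "(P *\<^sub>v (Z *\<^sub>v w)) \<bullet>c (P *\<^sub>v (Z *\<^sub>v w)) = (Z *\<^sub>v w) \<bullet>c (P *\<^sub>v (P *\<^sub>v (Z *\<^sub>v w)))"
      by (rule hermitian_cscalar[OF PD(1,2) Zw PZw])
    also have "\<dots> = w \<bullet>c (Z *\<^sub>v (P *\<^sub>v (P *\<^sub>v (Z *\<^sub>v w))))"
      by (rule hermitian_cscalar[OF Z Zh w]) (use PD(1) PZw in auto)
    also have "\<dots> = 0" using ZP[OF PZw] w by simp
    finally show ?thesis using cscalar_self_eq_0[OF PZw] by simp
  qed
  define Y where "Y = N * (Z * adj J)"
  define Y' where "Y' = J * (Z * adj N)"
  have Ja: "adj J \<in> cmat p n" and Na: "adj N \<in> cmat p n" using J N by auto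
  have ZJ: "Z * adj J \<in> cmat p n" and ZN: "Z * adj N \<in> cmat p n" using Z Ja Na by auto
  have Y: "Y \<in> cmat n n" "Y' \<in> cmat n n" unfolding Y_def Y'_def using N J ZJ ZN by auto
  have Yv: "Y *\<^sub>v a = N *\<^sub>v (Z *\<^sub>v (adj J *\<^sub>v a))" "Y' *\<^sub>v a = J *\<^sub>v (Z *\<^sub>v (adj N *\<^sub>v a))" if a: "a \<in> cvec n" for a
    unfolding Y_def Y'_def using assoc_mult_mat_vec[OF N ZJ a] assoc_mult_mat_vec[OF Z Ja a] assoc_mult_mat_vec[OF J ZN a] assoc_mult_mat_vec[OF Z Na a] by auto
  have Yadj: "adj Y = Y'" unfolding Y_def Y'_def
    using mat_adjoint_mult[OF N ZJ] mat_adjoint_mult[OF Z Ja] Zh assoc_mult_mat[OF J Z Na] by simp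
  have Yadj': "adj Y' = Y" using Yadj mat_adjoint_adjoint by metis
  have Yzero: "qform Y a = 0" if a: "a \<in> cvec n" for a
  proof -
    have c: "adj J *\<^sub>v a \<in> cvec p" "adj N *\<^sub>v a \<in> cvec p"
      using Ja Na a by (metis mult_mat_vec_carrier)+
    have Zc: "Z *\<^sub>v (adj J *\<^sub>v a) \<in> cvec p" using Z c by auto
    have fr: "frob p Z (lyap N J (outer n a a)) = 2 * qform Y a"
      unfolding lyap_outer[OF N J a] frob_add_right[OF outer_carrier outer_carrier] frob_outer[OF Z c(1,2)] frob_outer[OF Z c(2,1)]
      using hermitian_cscalar_cnj[OF Z Zh c(2,1)] cscalar_adjoint[OF N Zc a] Yv[OF a] by simp
    have "0 \<le> frob p Z (lyap N J (outer n a a))"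
      by (rule var_H) (auto simp: outer_hermitian)
    moreover have "0 \<le> frob p Z (lyap N J (complex_of_real (-1) \<cdot>\<^sub>m outer n a a))"
      by (rule var_H) (auto simp: outer_hermitian mat_adjoint_smult)
    ultimately show ?thesis using fr
      unfolding lyap_smult[OF N J outer_carrier] frob_smult_right[OF lyap_carrier[OF N J outer_carrier]] by simp
  qed
  have Yskew: "Y *\<^sub>v a + Y' *\<^sub>v a = 0\<^sub>v n" if a: "a \<in> cvec n" for a
  proof -
    have f: "qform (Y + Y') a = 0" if a: "a \<in> cvec n" for a
    proof -
      have "((Y + Y') *\<^sub>v a) \<bullet>c a = (Y *\<^sub>v a) \<bullet>c a + (Y' *\<^sub>v a) \<bullet>c a"
        unfolding add_mult_distrib_mat_vec[OF Y a] using Y a by (intro cscalar_add_left[where n=n]) auto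
      moreover have "(Y' *\<^sub>v a) \<bullet>c a = cnj ((Y *\<^sub>v a) \<bullet>c a)"
        using cscalar_adjoint[OF Y(2) a a] Yadj' cscalar_cnj[of "Y *\<^sub>v a" n a] Y a by simp
      ultimately show ?thesis using Yzero[OF a] by simp
    qed
    have "pos_semidef n (Y + Y')" unfolding pos_semidef_def
      using Y f mat_adjoint_add[OF Y] Yadj Yadj' comm_add_mat[OF Y] by auto
    from pos_semidef_zero_form[OF this a f[OF a]] show ?thesis
      unfolding add_mult_distrib_mat_vec[OF Y a] .
  qed
  define U where "U = {Z *\<^sub>v w | w. w \<in> cvec p}"
  have U: "vec_subspace p U" unfolding vec_subspace_def
  proof (intro conjI ballI allI)
    show "U \<subseteq> cvec p" unfolding U_def using Z by auto
    show "0\<^sub>v p \<in> U" unfolding U_def using mult_mat_vec_zero[OF Z] by (auto intro!: exI[of _ "0\<^sub>v p"])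
    fix x assume "x \<in> U"
    then obtain w where w: "w \<in> cvec p" "x = Z *\<^sub>v w" unfolding U_def by auto
    fix a show "a \<cdot>\<^sub>v x \<in> U" unfolding U_def w(2) using mult_mat_vec[OF Z w(1), of a] w(1)
      by (intro CollectI exI[of _ "a \<cdot>\<^sub>v w"]) auto
    fix y assume "y \<in> U"
    then obtain w' where w': "w' \<in> cvec p" "y = Z *\<^sub>v w'" unfolding U_def by auto
    show "x + y \<in> U" unfolding U_def w(2) w'(2) using mult_add_distrib_mat_vec[OF Z w(1) w'(1)] w(1) w'(1)
      by (intro CollectI exI[of _ "w + w'"]) auto
  qed
  have Uc: "z \<in> cvec p" if "z \<in> U" for z using that U unfolding vec_subspace_def by auto
  have orth: "z = 0\<^sub>v p" if z: "z \<in> U" "Z *\<^sub>v z = 0\<^sub>v p" for z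
  proof -
    obtain w where w: "w \<in> cvec p" "z = Z *\<^sub>v w" using z unfolding U_def by auto
    have "z \<bullet>c z = w \<bullet>c (Z *\<^sub>v z)" using hermitian_cscalar[OF Z Zh w(1) Uc[OF z(1)]] w(2) by simp
    thus ?thesis using z w(1) cscalar_self_eq_0[OF Uc[OF z(1)]] by simp
  qed
  have Q0_form: "qform Q0 z = 2 * Re ((H *\<^sub>v (J *\<^sub>v z)) \<bullet>c (N *\<^sub>v z)) + qform P z - qform Z z" if zc: "z \<in> cvec p" for z
  proof -
    have Q0eq: "Q0 = lyap N J H + P - Z" unfolding Z_def using L PD(1) Q0 by (intro eq_matI) auto
    have LPc: "lyap N J H + P \<in> cmat p p" using L PD(1) by auto
    have c: "lyap N J H *\<^sub>v z \<in> cvec p" "P *\<^sub>v z \<in> cvec p" "Z *\<^sub>v z \<in> cvec p" using L PD(1) Z zc by auto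
    have "(Q0 *\<^sub>v z) \<bullet>c z = (lyap N J H *\<^sub>v z) \<bullet>c z + (P *\<^sub>v z) \<bullet>c z - (Z *\<^sub>v z) \<bullet>c z"
      unfolding Q0eq minus_mult_distrib_mat_vec[OF LPc Z zc] add_mult_distrib_mat_vec[OF L PD(1) zc]
      using c zc cscalar_minus_left[of "lyap N J H *\<^sub>v z + P *\<^sub>v z" p "Z *\<^sub>v z" z] cscalar_add_left[OF c(1,2) zc] by simp
    thus ?thesis using lyap_form[OF N J H zc] by simp
  qed
  have key: "z = 0\<^sub>v p" if z: "z \<in> U" and nn: "0 \<le> qform Q0 z"
    and hz: "Re ((H *\<^sub>v (J *\<^sub>v z)) \<bullet>c (N *\<^sub>v z)) = 0" for z
  proof -
    note zc = Uc[OF z]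
    obtain w where w: "w \<in> cvec p" "z = Z *\<^sub>v w" using z unfolding U_def by auto
    have "qform Z z \<le> 0" using nn hz Q0_form[OF zc] PZ[OF w(1)] w(2) zc by simp
    hence "qform Z z = 0" using pos_semidefD(3)[OF Zpsd zc] by simp
    from pos_semidef_zero_form[OF Zpsd zc this] show ?thesis by (rule orth[OF z])
  qed
  have Jinj: "z = 0\<^sub>v p" if z: "z \<in> U" and Jz: "J *\<^sub>v z = 0\<^sub>v n" for z
  proof (rule key[OF z])
    show "0 \<le> qform Q0 z" using freq[OF Uc[OF z]] Jz by auto
    have "N *\<^sub>v z \<in> cvec n" using N Uc[OF z] by auto
    thus "Re ((H *\<^sub>v (J *\<^sub>v z)) \<bullet>c (N *\<^sub>v z)) = 0" using Jz mult_mat_vec_zero[OF H(1)] by simp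
  qed
  \<comment> \<open>Every vector of the range of \<open>Z\<close> already comes from the range of \<open>adj J\<close>.\<close>
  have rep: "\<exists>a \<in> cvec n. z = Z *\<^sub>v (adj J *\<^sub>v a)" if z: "z \<in> U" for z
  proof -
    define M where "M = Z * adj J * J"
    have M: "M \<in> cmat p p" unfolding M_def using ZJ J by auto
    have Mv: "M *\<^sub>v v = Z *\<^sub>v (adj J *\<^sub>v (J *\<^sub>v v))" if v: "v \<in> cvec p" for v
      unfolding M_def using assoc_mult_mat_vec[OF ZJ J v] assoc_mult_mat_vec[OF Z Ja, of "J *\<^sub>v v"] J v by auto
    have Jc: "J *\<^sub>v v \<in> cvec n" "adj J *\<^sub>v (J *\<^sub>v v) \<in> cvec p" if v: "v \<in> cvec p" for v
      using J Ja v by (metis mult_mat_vec_carrier)+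
    have "\<exists>z' \<in> U. M *\<^sub>v z' = z"
    proof (rule subspace_inj_surj[OF U M _ _ z])
      fix y assume y: "y \<in> U"
      show "M *\<^sub>v y \<in> U" unfolding Mv[OF Uc[OF y]] U_def using Jc[OF Uc[OF y]] by auto
      assume My: "M *\<^sub>v y = 0\<^sub>v p"
      obtain w where w: "w \<in> cvec p" "y = Z *\<^sub>v w" using y unfolding U_def by auto
      have "0 = (M *\<^sub>v y) \<bullet>c w" using My w by simp
      also have "\<dots> = (adj J *\<^sub>v (J *\<^sub>v y)) \<bullet>c y"
        using Mv[OF Uc[OF y]] hermitian_cscalar[OF Z Zh Jc(2)[OF Uc[OF y]] w(1)] w(2) by simp
      also have "\<dots> = (J *\<^sub>v y) \<bullet>c (J *\<^sub>v y)" by (rule cscalar_adjoint2[OF J Jc(1)[OF Uc[OF y]] Uc[OF y]])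
      finally have "J *\<^sub>v y = 0\<^sub>v n" using cscalar_self_eq_0[OF Jc(1)[OF Uc[OF y]]] by simp
      thus "y = 0\<^sub>v p" by (rule Jinj[OF y])
    qed
    then obtain z' where z': "z' \<in> U" "M *\<^sub>v z' = z" by auto
    show ?thesis using z' Mv[OF Uc[OF z'(1)]] Jc(1)[OF Uc[OF z'(1)]] by auto
  qed
  have U0: "U = {0\<^sub>v p}"
  proof (rule ccontr)
    assume ne: "U \<noteq> {0\<^sub>v p}"
    have "\<exists>z' \<in> U. N *\<^sub>v z = J *\<^sub>v z'" if z: "z \<in> U" for z
    proof -
      obtain a where a: "a \<in> cvec n" "z = Z *\<^sub>v (adj J *\<^sub>v a)" using rep[OF z] by auto
      define b where "b = adj N *\<^sub>v a"
      have b: "b \<in> cvec p" unfolding b_def using Na a by (metis mult_mat_vec_carrier)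
      have Zb: "Z *\<^sub>v b \<in> cvec p" using Z b by auto
      have JZb: "J *\<^sub>v (Z *\<^sub>v b) \<in> cvec n" using J Zb by auto
      have Nz: "N *\<^sub>v z \<in> cvec n" using N Uc[OF z] by auto
      have sum0: "N *\<^sub>v z + J *\<^sub>v (Z *\<^sub>v b) = 0\<^sub>v n" using Yskew[OF a(1)] Yv[OF a(1)] a(2) b_def by simp
      have "N *\<^sub>v z = (- 1) \<cdot>\<^sub>v (J *\<^sub>v (Z *\<^sub>v b))"
      proof (intro eq_vecI)
        fix i assume "i < dim_vec ((- 1) \<cdot>\<^sub>v (J *\<^sub>v (Z *\<^sub>v b)))"
        hence i: "i < n" using J by simp
        have "(N *\<^sub>v z + J *\<^sub>v (Z *\<^sub>v b)) $ i = 0" unfolding sum0 using i by simp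
        moreover have "(N *\<^sub>v z + J *\<^sub>v (Z *\<^sub>v b)) $ i = (N *\<^sub>v z) $ i + (J *\<^sub>v (Z *\<^sub>v b)) $ i"
          by (rule index_add_vec(1)) (use i J in simp)
        moreover have "((- 1) \<cdot>\<^sub>v (J *\<^sub>v (Z *\<^sub>v b))) $ i = - (J *\<^sub>v (Z *\<^sub>v b)) $ i"
          using i J JZb by (subst index_smult_vec(1)) auto
        ultimately show "(N *\<^sub>v z) $ i = ((- 1) \<cdot>\<^sub>v (J *\<^sub>v (Z *\<^sub>v b))) $ i" by (simp add: add_eq_0_iff2)
      qed (use N J in auto)
      also have "\<dots> = J *\<^sub>v ((- 1) \<cdot>\<^sub>v (Z *\<^sub>v b))" using mult_mat_vec[OF J Zb] by simp
      finally have "N *\<^sub>v z = J *\<^sub>v ((- 1) \<cdot>\<^sub>v (Z *\<^sub>v b))" .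
      moreover have "(- 1) \<cdot>\<^sub>v (Z *\<^sub>v b) \<in> U" using U b unfolding vec_subspace_def U_def by blast
      ultimately show ?thesis by blast
    qed
    from pencil_eigenvector[OF U ne N J this] obtain z l where z: "z \<in> U" "z \<noteq> 0\<^sub>v p" "N *\<^sub>v z = l \<cdot>\<^sub>v (J *\<^sub>v z)" by auto
    note zc = Uc[OF z(1)]
    have Jzc: "J *\<^sub>v z \<in> cvec n" using J zc by auto
    obtain a where a: "a \<in> cvec n" "z = Z *\<^sub>v (adj J *\<^sub>v a)" using rep[OF z(1)] by auto
    have Jac: "adj J *\<^sub>v a \<in> cvec p" using Ja a by (metis mult_mat_vec_carrier)
    define q where "q = qform Z (adj J *\<^sub>v a)"
    have q: "q > 0"
      using pos_semidef_zero_form[OF Zpsd Jac] pos_semidefD(3)[OF Zpsd Jac] z(2) a(2) unfolding q_def by fastforce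
    have qeq: "(Z *\<^sub>v (adj J *\<^sub>v a)) \<bullet>c (adj J *\<^sub>v a) = of_real q"
      using hermitian_cscalar_cnj[OF Z Zh Jac Jac] unfolding q_def
      by (metis Reals_cnj_iff of_real_Re)
    have "(Y *\<^sub>v a) \<bullet>c a = (N *\<^sub>v z) \<bullet>c a" using Yv[OF a(1)] a(2) by simp
    also have "\<dots> = l * (z \<bullet>c (adj J *\<^sub>v a))"
      unfolding z(3) cscalar_smult_left[OF Jzc a(1)] cscalar_adjoint[OF J zc a(1)] ..
    also have "\<dots> = l * of_real q" using a(2) qeq by simp
    finally have "Re l * q = 0" using Yzero[OF a(1)] by simp
    hence l: "l = \<i> * complex_of_real (Im l)" using q by (simp add: complex_eq_iff)
    have HJ: "H *\<^sub>v (J *\<^sub>v z) \<in> cvec n" using H Jzc by auto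
    have "(H *\<^sub>v (J *\<^sub>v z)) \<bullet>c (J *\<^sub>v z) \<in> \<real>"
      using hermitian_cscalar_cnj[OF H Jzc Jzc] by (metis Reals_cnj_iff)
    hence im: "Im ((H *\<^sub>v (J *\<^sub>v z)) \<bullet>c (J *\<^sub>v z)) = 0" by (simp add: complex_is_Real_iff)
    have "z = 0\<^sub>v p"
    proof (rule key[OF z(1)])
      show "0 \<le> qform Q0 z" using freq[OF zc, of "Im l"] z(3) l by metis
      show "Re ((H *\<^sub>v (J *\<^sub>v z)) \<bullet>c (N *\<^sub>v z)) = 0"
        unfolding z(3) cscalar_smult_right[OF Jzc HJ] using im arg_cong[OF l, of Re] by simp
    qed
    thus False using z by simp
  qed
  have "2 * Re ((H *\<^sub>v (J *\<^sub>v z)) \<bullet>c (N *\<^sub>v z)) \<le> qform Q0 z" if z: "z \<in> cvec p" for z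
  proof -
    have "Z *\<^sub>v z = 0\<^sub>v p" using U0 z unfolding U_def by auto
    thus ?thesis using Q0_form[OF z] PD(3)[OF z] z by simp
  qed
  thus ?thesis using H by blast
qed

end

section \<open>Resolvents, minors and minimal realizations\<close>

lemma spectrum_iff:
  assumes A: "(A :: complex mat) \<in> cmat n n"
  shows "s \<in> spectrum A \<longleftrightarrow> (\<exists>v \<in> cvec n. v \<noteq> 0\<^sub>v n \<and> A *\<^sub>v v = s \<cdot>\<^sub>v v)"
  using A unfolding spectrum_def eigenvalue_def eigenvector_def by auto

lemma shifted_mult_vec:
  assumes A: "(A :: complex mat) \<in> cmat n n" and v: "v \<in> cvec n"
  shows "(s \<cdot>\<^sub>m 1\<^sub>m n - A) *\<^sub>v v = s \<cdot>\<^sub>v v - A *\<^sub>v v"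
proof -
  have "(s \<cdot>\<^sub>m 1\<^sub>m n) *\<^sub>v v = s \<cdot>\<^sub>v v" using v by (intro eq_vecI) auto
  thus ?thesis using minus_mult_distrib_mat_vec[of "s \<cdot>\<^sub>m 1\<^sub>m n" n n A v] A v by simp
qed

lemma resolvent:
  assumes A: "(A :: complex mat) \<in> cmat n n" and s: "s \<notin> spectrum A"
  defines "R \<equiv> (resolvent_mat n A s)"
  shows "R \<in> cmat n n" "(s \<cdot>\<^sub>m 1\<^sub>m n - A) * R = 1\<^sub>m n" "R * (s \<cdot>\<^sub>m 1\<^sub>m n - A) = 1\<^sub>m n"
proof -
  have S: "s \<cdot>\<^sub>m 1\<^sub>m n - A \<in> cmat n n" using A by (metis minus_carrier_mat)
  have inj: "v = 0\<^sub>v n" if v: "v \<in> cvec n" "(s \<cdot>\<^sub>m 1\<^sub>m n - A) *\<^sub>v v = 0\<^sub>v n" for v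
  proof (rule ccontr)
    assume ne: "v \<noteq> 0\<^sub>v n"
    have e: "s \<cdot>\<^sub>v v - A *\<^sub>v v = 0\<^sub>v n" using v shifted_mult_vec[OF A v(1)] by simp
    have "A *\<^sub>v v = s \<cdot>\<^sub>v v"
    proof (intro eq_vecI)
      fix i assume "i < dim_vec (s \<cdot>\<^sub>v v)"
      hence i: "i < n" using v by simp
      have "(s \<cdot>\<^sub>v v - A *\<^sub>v v) $ i = 0" unfolding e using i by simp
      thus "(A *\<^sub>v v) $ i = (s \<cdot>\<^sub>v v) $ i" using i v A by simp
    qed (use A v in auto)
    thus False using s spectrum_iff[OF A] v(1) ne by auto
  qed
  show "R \<in> cmat n n" "(s \<cdot>\<^sub>m 1\<^sub>m n - A) * R = 1\<^sub>m n" "R * (s \<cdot>\<^sub>m 1\<^sub>m n - A) = 1\<^sub>m n"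
    unfolding R_def using inv_mat[OF S inj] by auto
qed

lemma resolvent_vec:
  assumes A: "(A :: complex mat) \<in> cmat n n" and s: "s \<notin> spectrum A" and v: "v \<in> cvec n"
  defines "x \<equiv> (resolvent_mat n A s) *\<^sub>v v"
  shows "x \<in> cvec n" "s \<cdot>\<^sub>v x = A *\<^sub>v x + v"
proof -
  note R = resolvent[OF A s]
  have S: "s \<cdot>\<^sub>m 1\<^sub>m n - A \<in> cmat n n" using A by (metis minus_carrier_mat)
  show x: "x \<in> cvec n" unfolding x_def using R v by auto
  have "v = (s \<cdot>\<^sub>m 1\<^sub>m n - A) *\<^sub>v x"
    unfolding x_def using assoc_mult_mat_vec[OF S R(1) v] R(2) v by simp
  also have "\<dots> = s \<cdot>\<^sub>v x - A *\<^sub>v x" by (rule shifted_mult_vec[OF A x])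
  finally have e: "v = s \<cdot>\<^sub>v x - A *\<^sub>v x" .
  show "s \<cdot>\<^sub>v x = A *\<^sub>v x + v"
    unfolding e using x A by (intro eq_vecI) auto
qed

text \<open>Together with the previous lemma: a state is described by its equation \<open>s \<cdot>\<^sub>v x = A *\<^sub>v x + v\<close> rather
than by an inverse matrix.\<close>

lemma resolvent_unique:
  assumes A: "(A :: complex mat) \<in> cmat n n" and s: "s \<notin> spectrum A" and v: "v \<in> cvec n"
    and x: "x \<in> cvec n" and e: "s \<cdot>\<^sub>v x = A *\<^sub>v x + v"
  shows "x = resolvent_mat n A s *\<^sub>v v"
proof -
  note R = resolvent[OF A s]
  have S: "s \<cdot>\<^sub>m 1\<^sub>m n - A \<in> cmat n n" using A by (metis minus_carrier_mat)
  have "(s \<cdot>\<^sub>m 1\<^sub>m n - A) *\<^sub>v x = s \<cdot>\<^sub>v x - A *\<^sub>v x" by (rule shifted_mult_vec[OF A x])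
  also have "\<dots> = v" unfolding e using A x v by (intro eq_vecI) auto
  finally have "(resolvent_mat n A s) *\<^sub>v v = (resolvent_mat n A s * (s \<cdot>\<^sub>m 1\<^sub>m n - A)) *\<^sub>v x"
    using assoc_mult_mat_vec[OF R(1) S x] by simp
  thus ?thesis using R(3) x by simp
qed

lemma char_poly_shifted:
  assumes A: "(A :: complex mat) \<in> cmat n n"
  shows "poly (char_poly A) s = det (s \<cdot>\<^sub>m 1\<^sub>m n - A)"
proof -
  have "- (char_matrix A s) = s \<cdot>\<^sub>m 1\<^sub>m n - A" using A unfolding char_matrix_def by (intro eq_matI) auto
  thus ?thesis using char_poly_matrix[OF A] by simp
qed

text \<open>In this form a left or right eigenvector that is invisible to the input or output makes a bordered
determinant vanish.\<close>

lemma det_zero_of_append_kernel: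
  fixes M :: "complex mat"
  assumes M: "M \<in> cmat (n + k) (n + k)" and x: "x \<in> cvec n" "x \<noteq> 0\<^sub>v n"
    and Mx: "M *\<^sub>v (x @\<^sub>v 0\<^sub>v k) = 0\<^sub>v n @\<^sub>v 0\<^sub>v k"
  shows "det M = 0"
proof -
  have z: "0\<^sub>v n @\<^sub>v 0\<^sub>v k = (0\<^sub>v (n + k) :: complex vec)" by (intro eq_vecI) auto
  have "x @\<^sub>v 0\<^sub>v k \<noteq> 0\<^sub>v (n + k)"
    unfolding z[symmetric] using append_vec_eq[OF x(1) zero_carrier_vec] x(2) by auto
  moreover have "x @\<^sub>v 0\<^sub>v k \<in> cvec (n + k)" using x by auto
  ultimately show ?thesis using det_0_iff_vec_prod_zero_field[OF M] Mx unfolding z by blast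
qed

text \<open>The Rosenbrock matrix of the realization. Its determinant is polynomial in \<open>s\<close> and is the numerator
of the corresponding minor of the transfer function over the characteristic polynomial.\<close>

definition system_matrix :: "nat \<Rightarrow> complex mat \<Rightarrow> complex mat \<Rightarrow> complex mat \<Rightarrow> complex mat \<Rightarrow> complex \<Rightarrow> complex mat" where
  "system_matrix n A B C D s = four_block_mat (s \<cdot>\<^sub>m 1\<^sub>m n - A) B (- C) D"

lemma system_matrix_det_poly:
  assumes A: "A \<in> cmat n n" and B: "B \<in> cmat n k" and C: "C \<in> cmat k n" and D: "D \<in> cmat k k"
  shows "\<exists>p. \<forall>s. det (system_matrix n A B C D s) = poly p s"
proof -
  define P where "P = mat (n + k) (n + k) (\<lambda>(i, j). if i < n then
      (if j < n then (if i = j then [:- (A $$ (i, j)), 1:] else [:- (A $$ (i, j)):]) else [:B $$ (i, j - n):])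
      else (if j < n then [:- (C $$ (i - n, j)):] else [:D $$ (i - n, j - n):]))"
  have S: "system_matrix n A B C D s \<in> cmat (n + k) (n + k)" for s
    unfolding system_matrix_def using A D by (intro four_block_carrier_mat) (auto intro: minus_carrier_mat)
  have "poly (det P) s = det (system_matrix n A B C D s)" for s
    by (rule poly_det_cong[OF S]) (use A B C D in \<open>auto simp: P_def system_matrix_def\<close>)
  thus ?thesis by metis
qed

text \<open>The factorization behind the Schur complement: the matrix is the product of a lower and an upper
block triangular one.\<close>

lemma system_matrix_det:
  assumes A: "A \<in> cmat n n" and B: "B \<in> cmat n k" and C: "C \<in> cmat k n" and D: "D \<in> cmat k k"
    and s: "s \<notin> spectrum A"
  shows "det (system_matrix n A B C D s) =
    poly (char_poly A) s * det (C * resolvent_mat n A s * B + D)"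
proof -
  define S where "S = s \<cdot>\<^sub>m 1\<^sub>m n - A"
  define R where "R = inv_mat S"
  have S: "S \<in> cmat n n" unfolding S_def using A by (metis minus_carrier_mat)
  have R: "R \<in> cmat n n" "S * R = 1\<^sub>m n" unfolding R_def S_def using resolvent[OF A s] by auto
  have RB: "R * B \<in> cmat n k" using R B by auto
  have CRB: "C * (R * B) \<in> cmat k k" using C RB by auto
  have X: "C * (R * B) + D \<in> cmat k k" using CRB D by auto
  have SRB: "S * (R * B) = B" using assoc_mult_mat[OF S R(1) B] R(2) B by simp
  have mC: "- C \<in> cmat k n" using C by simp
  have "four_block_mat S (0\<^sub>m n k) (- C) (1\<^sub>m k) * four_block_mat (1\<^sub>m n) (R * B) (0\<^sub>m k n) (C * (R * B) + D)
     = four_block_mat (S * 1\<^sub>m n + 0\<^sub>m n k * 0\<^sub>m k n) (S * (R * B) + 0\<^sub>m n k * (C * (R * B) + D))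
        (- C * 1\<^sub>m n + 1\<^sub>m k * 0\<^sub>m k n) (- C * (R * B) + 1\<^sub>m k * (C * (R * B) + D))"
    by (rule mult_four_block_mat[OF S _ mC _ _ RB _ X]) auto
  also have "\<dots> = four_block_mat S B (- C) D"
  proof (rule cong_four_block_mat)
    show "S * 1\<^sub>m n + 0\<^sub>m n k * 0\<^sub>m k n = S" using S by simp
    show "S * (R * B) + 0\<^sub>m n k * (C * (R * B) + D) = B" unfolding SRB left_mult_zero_mat[OF X] using B by simp
    show "- C * 1\<^sub>m n + 1\<^sub>m k * 0\<^sub>m k n = - C" using C by simp
    have "- C * (R * B) = - (C * (R * B))" using C R B by simp
    thus "- C * (R * B) + 1\<^sub>m k * (C * (R * B) + D) = D"
    proof -
      have "- Y + (Y + D) = D" if "Y \<in> cmat k k" for Y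
        using that D by (intro eq_matI) auto
      from this[OF CRB] show ?thesis using left_mult_one_mat[OF X] \<open>- C * (R * B) = - (C * (R * B))\<close> by simp
    qed
  qed
  finally have f: "system_matrix n A B C D s = four_block_mat S (0\<^sub>m n k) (- C) (1\<^sub>m k) * four_block_mat (1\<^sub>m n) (R * B) (0\<^sub>m k n) (C * (R * B) + D)"
    unfolding system_matrix_def S_def[symmetric] by simp
  have "det (system_matrix n A B C D s) = det (four_block_mat S (0\<^sub>m n k) (- C) (1\<^sub>m k)) * det (four_block_mat (1\<^sub>m n) (R * B) (0\<^sub>m k n) (C * (R * B) + D))"
    unfolding f by (rule det_mult[of _ "n + k"]) (use S X in \<open>auto intro!: four_block_carrier_mat\<close>)
  also have "det (four_block_mat S (0\<^sub>m n k) (- C) (1\<^sub>m k)) = det S"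
    using det_four_block_mat_upper_right_zero[OF S refl mC one_carrier_mat] by simp
  also have "det (four_block_mat (1\<^sub>m n) (R * B) (0\<^sub>m k n) (C * (R * B) + D)) = det (C * (R * B) + D)"
    using det_four_block_mat_lower_left_zero[OF one_carrier_mat RB refl X] by simp
  also have "C * (R * B) = C * R * B" using assoc_mult_mat[OF C R(1) B] by simp
  finally show ?thesis unfolding char_poly_shifted[OF A] S_def R_def .
qed

text \<open>The case of a \<open>1 \<times> 1\<close> minor, obtained by keeping one row of \<open>C\<close> and one column of \<open>B\<close>.\<close>

lemma realization_entry_rational:
  assumes A: "A \<in> cmat n n" and B: "B \<in> cmat n m" and C: "C \<in> cmat m n" and D: "D \<in> cmat m m"
    and i: "i < m" and j: "j < m"
  shows "\<exists>p. \<forall>s. s \<notin> spectrum A \<longrightarrow>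
    poly (char_poly A) s * (C * resolvent_mat n A s * B + D) $$ (i, j) = poly p s"
proof -
  define C1 where "C1 = mat 1 n (\<lambda>(_, q). C $$ (i, q))"
  define B1 where "B1 = mat n 1 (\<lambda>(q, _). B $$ (q, j))"
  define D1 where "D1 = mat 1 1 (\<lambda>_. D $$ (i, j))"
  have c: "C1 \<in> cmat 1 n" "B1 \<in> cmat n 1" "D1 \<in> cmat 1 1" unfolding C1_def B1_def D1_def by auto
  obtain p where p: "\<And>s. det (system_matrix n A B1 C1 D1 s) = poly p s"
    using system_matrix_det_poly[OF A c(2,1,3)] by auto
  have "poly (char_poly A) s * (C * resolvent_mat n A s * B + D) $$ (i, j) = poly p s" if s: "s \<notin> spectrum A" for s
  proof -
    define R where "R = resolvent_mat n A s"
    have R: "R \<in> cmat n n" unfolding R_def using resolvent[OF A s] by auto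
    have CR: "C * R \<in> cmat m n" "C1 * R \<in> cmat 1 n" using C c R by auto
    have X: "C1 * R * B1 \<in> cmat 1 1" using CR c by auto
    have "(C1 * R * B1 + D1) $$ (0, 0) = (C * R * B + D) $$ (i, j)"
    proof -
      have z1: "0 < (1::nat)" by simp
      have "(C1 * R * B1) $$ (0, 0) = (C * R * B) $$ (i, j)"
        unfolding mult_mat_index_sum[OF CR(2) c(2) z1 z1] mult_mat_index_sum[OF CR(1) B i j]
      proof (intro sum.cong refl)
        fix x assume "x \<in> {..<n}"
        hence x: "x < n" by simp
        show "(C1 * R) $$ (0, x) * B1 $$ (x, 0) = (C * R) $$ (i, x) * B $$ (x, j)"
          unfolding mult_mat_index_sum[OF c(1) R z1 x] mult_mat_index_sum[OF C R i x]
          using x by (simp add: C1_def B1_def)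
      qed
      thus ?thesis using X c(3) i j CR B D by (simp add: D1_def)
    qed
    moreover have "det (C1 * R * B1 + D1) = (C1 * R * B1 + D1) $$ (0, 0)"
      by (rule det_single) (use X c in auto)
    ultimately show ?thesis using system_matrix_det[OF A c(2,1,3) s] p[of s] unfolding R_def by simp
  qed
  thus ?thesis by blast
qed

context
  fixes m n :: nat and F :: "complex \<Rightarrow> complex mat" and A B C D :: "complex mat"
  assumes min: "minimal_realization m n F A B C D"
begin

lemma realization_carrier:
  "A \<in> cmat n n" "B \<in> cmat n m" "C \<in> cmat m n" "D \<in> cmat m m"
  "s \<notin> spectrum A \<Longrightarrow> F s = C * resolvent_mat n A s * B + D"
  using min unfolding minimal_realization_def realization_def by auto

text \<open>Every minor of \<open>F\<close> is a bordered determinant over the characteristic polynomial. If all these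
numerators vanish at an eigenvalue \<open>l\<close>, the factor \<open>s - l\<close> cancels from all of them at once, leaving a common
denominator of degree \<open>n - 1\<close>, which contradicts the minimality of \<open>n\<close>. Only borders whose columns and rows
are taken from \<open>B\<close> and \<open>C\<close> occur.\<close>

lemma minimal_realization_no_cancellation:
  assumes root: "poly (char_poly A) l = 0"
    and canc: "\<And>k B' C' D'. B' \<in> cmat n k \<Longrightarrow> C' \<in> cmat k n \<Longrightarrow> D' \<in> cmat k k \<Longrightarrow>
      (\<And>j. j < k \<Longrightarrow> \<exists>j' < m. col B' j = col B j') \<Longrightarrow> (\<And>i. i < k \<Longrightarrow> \<exists>i' < m. row C' i = row C i') \<Longrightarrow>
      det (system_matrix n A B' C' D' l) = 0"
  shows False
proof -
  note abcd_carrier = realization_carrier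
  have deg: "degree (char_poly A) = n" "char_poly A \<noteq> 0"
    using degree_monic_char_poly[OF abcd_carrier(1)] by auto
  obtain d where d: "char_poly A = [:- l, 1:] * d" using root by (auto simp: poly_eq_0_iff_dvd dvd_def)
  have d0: "d \<noteq> 0" using d deg(2) by auto
  have degd: "degree d < n"
    using arg_cong[OF d, of degree] deg d0 by (subst (asm) degree_mult_eq) auto
  have "minors_denominator m F d" unfolding minors_denominator_def
  proof (intro conjI allI impI d0)
    fix I J :: "nat set" assume IJ: "I \<subseteq> {..<m} \<and> J \<subseteq> {..<m} \<and> card I = card J"
    define k where "k = card I"
    have cI: "card {i. i < m \<and> i \<in> I} = k" "card {i. i < m \<and> i \<in> J} = k"
    proof -
      have "{i. i < m \<and> i \<in> I} = I" "{i. i < m \<and> i \<in> J} = J" using IJ by auto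
      thus "card {i. i < m \<and> i \<in> I} = k" "card {i. i < m \<and> i \<in> J} = k" using IJ k_def by auto
    qed
    have pI: "pick I i < m" "pick J i < m" if "i < k" for i using pick_le cI that by metis+
    define C' where "C' = mat k n (\<lambda>(i, q). C $$ (pick I i, q))"
    define B' where "B' = mat n k (\<lambda>(q, j). B $$ (q, pick J j))"
    define D' where "D' = mat k k (\<lambda>(i, j). D $$ (pick I i, pick J j))"
    have c: "B' \<in> cmat n k" "C' \<in> cmat k n" "D' \<in> cmat k k" unfolding C'_def B'_def D'_def by auto
    obtain p where p: "\<And>s. det (system_matrix n A B' C' D' s) = poly p s"
      using system_matrix_det_poly[OF abcd_carrier(1) c] by auto
    have "det (system_matrix n A B' C' D' l) = 0"
    proof (rule canc[OF c])
      fix j assume j: "j < k"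
      show "\<exists>j' < m. col B' j = col B j'"
        by (intro exI[of _ "pick J j"] conjI eq_vecI) (use pI[OF j] j abcd_carrier in \<open>auto simp: B'_def\<close>)
      show "\<exists>j' < m. row C' j = row C j'"
        by (intro exI[of _ "pick I j"] conjI eq_vecI) (use pI[OF j] j abcd_carrier in \<open>auto simp: C'_def\<close>)
    qed
    hence "poly p l = 0" using p by simp
    then obtain q where q: "p = [:- l, 1:] * q" by (auto simp: poly_eq_0_iff_dvd dvd_def)
    have "poly d s * det (submatrix (F s) I J) = poly q s" if s: "s \<notin> spectrum A" for s
    proof -
      define R where "R = resolvent_mat n A s"
      have R: "R \<in> cmat n n" unfolding R_def using resolvent[OF abcd_carrier(1) s] by auto
      have CR: "C * R \<in> cmat m n" "C' * R \<in> cmat k n" using abcd_carrier c R by auto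
      have Fs: "F s = C * R * B + D" using abcd_carrier(5)[OF s] unfolding R_def .
      have Fc: "F s \<in> cmat m m" unfolding Fs using CR abcd_carrier by auto
      have "submatrix (F s) I J = C' * R * B' + D'"
      proof (intro eq_matI)
        fix i j assume "i < dim_row (C' * R * B' + D')" "j < dim_col (C' * R * B' + D')"
        hence ij: "i < k" "j < k" using c by auto
        have "submatrix (F s) I J $$ (i, j) = F s $$ (pick I i, pick J j)"
          by (rule submatrix_index) (use ij cI Fc in auto)
        also have "\<dots> = (C * R * B) $$ (pick I i, pick J j) + D $$ (pick I i, pick J j)"
          unfolding Fs using pI(1)[OF ij(1)] pI(2)[OF ij(2)] CR abcd_carrier by simp
        also have "(C * R * B) $$ (pick I i, pick J j) = (C' * R * B') $$ (i, j)"
          unfolding mult_mat_index_sum[OF CR(2) c(1) ij] mult_mat_index_sum[OF CR(1) abcd_carrier(2) pI(1)[OF ij(1)] pI(2)[OF ij(2)]]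
        proof (intro sum.cong refl)
          fix x assume "x \<in> {..<n}"
          hence x: "x < n" by simp
          show "(C * R) $$ (pick I i, x) * B $$ (x, pick J j) = (C' * R) $$ (i, x) * B' $$ (x, j)"
            unfolding mult_mat_index_sum[OF c(2) R ij(1) x] mult_mat_index_sum[OF abcd_carrier(3) R pI(1)[OF ij(1)] x]
            using ij x by (simp add: C'_def B'_def)
        qed
        finally show "submatrix (F s) I J $$ (i, j) = (C' * R * B' + D') $$ (i, j)"
          using ij CR c by (simp add: D'_def)
      qed (use cI Fc c CR in \<open>auto simp: dim_submatrix\<close>)
      hence "poly (char_poly A) s * det (submatrix (F s) I J) = poly p s"
        using system_matrix_det[OF abcd_carrier(1) c s] p[of s] unfolding R_def by simp
      hence "(s - l) * (poly d s * det (submatrix (F s) I J)) = (s - l) * poly q s"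
        unfolding d q by (simp add: algebra_simps)
      moreover have "l \<in> spectrum A" using spectrum_root_char_poly[OF abcd_carrier(1)] root by auto
      hence "s - l \<noteq> 0" using s by auto
      ultimately show ?thesis by simp
    qed
    hence "{s. poly d s * det (submatrix (F s) I J) \<noteq> poly q s} \<subseteq> spectrum A" by auto
    from finite_subset[OF this card_finite_spectrum(1)[OF abcd_carrier(1)]]
    show "\<exists>p. \<forall>\<^sub>F s in cofinite. poly d s * det (submatrix (F s) I J) = poly p s"
      unfolding eventually_cofinite by blast
  qed
  hence "mcmillan_degree m F \<le> degree d" unfolding mcmillan_degree_def by (intro Least_le) auto
  moreover have "n = mcmillan_degree m F" using min unfolding minimal_realization_def by auto
  ultimately show False using degd by simp
qed

text \<open>A vector violating the claim, extended by \<open>0\<close>, lies in the kernel of every bordered matrix at \<open>l\<close>.\<close>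

lemma minimal_realization_observable:
  assumes x: "x \<in> cvec n" and Ax: "A *\<^sub>v x = l \<cdot>\<^sub>v x" and Cx: "C *\<^sub>v x = 0\<^sub>v m"
  shows "x = 0\<^sub>v n"
proof (rule ccontr)
  assume ne: "x \<noteq> 0\<^sub>v n"
  note abcd_carrier = realization_carrier
  have S: "l \<cdot>\<^sub>m 1\<^sub>m n - A \<in> cmat n n" using abcd_carrier by (metis minus_carrier_mat)
  have Sx: "(l \<cdot>\<^sub>m 1\<^sub>m n - A) *\<^sub>v x = 0\<^sub>v n" unfolding shifted_mult_vec[OF abcd_carrier(1) x] Ax using x by simp
  show False
  proof (rule minimal_realization_no_cancellation)
    show "poly (char_poly A) l = 0" unfolding char_poly_shifted[OF abcd_carrier(1)]
      using det_0_iff_vec_prod_zero_field[OF S] Sx x ne by auto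
    fix k and B' C' D' :: "complex mat"
    assume c: "B' \<in> cmat n k" "C' \<in> cmat k n" "D' \<in> cmat k k"
      and rows: "\<And>i. i < k \<Longrightarrow> \<exists>i' < m. row C' i = row C i'"
    have C'x: "- C' *\<^sub>v x = 0\<^sub>v k"
    proof (intro eq_vecI)
      fix i assume "i < dim_vec (0\<^sub>v k :: complex vec)"
      hence i: "i < k" by simp
      obtain i' where i': "i' < m" "row C' i = row C i'" using rows[OF i] by auto
      have "row C i' \<bullet> x = (C *\<^sub>v x) $ i'" using i' abcd_carrier by simp
      hence "row C' i \<bullet> x = 0" unfolding i'(2) Cx using i' by simp
      thus "(- C' *\<^sub>v x) $ i = 0\<^sub>v k $ i" using i c x by simp
    qed (use c in auto)
    have M: "system_matrix n A B' C' D' l \<in> cmat (n + k) (n + k)"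
      unfolding system_matrix_def using S c by auto
    have "system_matrix n A B' C' D' l *\<^sub>v (x @\<^sub>v 0\<^sub>v k) = 0\<^sub>v n @\<^sub>v 0\<^sub>v k"
      unfolding system_matrix_def
      using four_block_mat_mult_vec[OF S c(1) _ c(3) x, of "- C'" "0\<^sub>v k"] c Sx C'x mult_mat_vec_zero[OF c(1)] mult_mat_vec_zero[OF c(3)] by simp
    thus "det (system_matrix n A B' C' D' l) = 0" by (rule det_zero_of_append_kernel[OF M x ne])
  qed
qed

text \<open>Dually, the conjugate of a vector violating the claim, extended by \<open>0\<close>, lies in the kernel of the
transpose of every bordered matrix at \<open>cnj l\<close>.\<close>

lemma minimal_realization_controllable:
  assumes w: "w \<in> cvec n" and Aw: "adj A *\<^sub>v w = l \<cdot>\<^sub>v w" and Bw: "adj B *\<^sub>v w = 0\<^sub>v m"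
  shows "w = 0\<^sub>v n"
proof (rule ccontr)
  assume ne: "w \<noteq> 0\<^sub>v n"
  note abcd_carrier = realization_carrier
  define x where "x = conjugate w"
  have x: "x \<in> cvec n" unfolding x_def using w by auto
  have xne: "x \<noteq> 0\<^sub>v n" unfolding x_def using ne w by (metis conjugate_zero_iff_vec)
  have S: "cnj l \<cdot>\<^sub>m 1\<^sub>m n - A \<in> cmat n n" using abcd_carrier by (metis minus_carrier_mat)
  have Sx: "transpose_mat (cnj l \<cdot>\<^sub>m 1\<^sub>m n - A) *\<^sub>v x = 0\<^sub>v n"
  proof (intro eq_vecI)
    fix i assume "i < dim_vec (0\<^sub>v n :: complex vec)"
    hence i: "i < n" by simp
    have Ad: "adj A \<in> cmat n n" using abcd_carrier by simp
    have "(transpose_mat (cnj l \<cdot>\<^sub>m 1\<^sub>m n - A) *\<^sub>v x) $ i = (\<Sum>j<n. ((if i = j then cnj l else 0) - A $$ (j, i)) * cnj (w $ j))"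
      by (subst mult_mat_vec_index_sum[of _ n n]) (use S x i abcd_carrier w in \<open>auto simp: x_def intro!: sum.cong\<close>)
    also have "\<dots> = (\<Sum>j<n. (if i = j then cnj l * cnj (w $ j) else 0)) - (\<Sum>j<n. A $$ (j, i) * cnj (w $ j))"
      unfolding sum_subtractf[symmetric] by (intro sum.cong) (auto simp: algebra_simps)
    also have "(\<Sum>j<n. A $$ (j, i) * cnj (w $ j)) = cnj ((adj A *\<^sub>v w) $ i)"
      unfolding mult_mat_vec_index_sum[OF Ad w i] using i abcd_carrier by simp
    also have "\<dots> = cnj l * cnj (w $ i)" unfolding Aw using i w by simp
    finally show "(transpose_mat (cnj l \<cdot>\<^sub>m 1\<^sub>m n - A) *\<^sub>v x) $ i = 0\<^sub>v n $ i" using i by simp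
  qed (use S in auto)
  have ST: "transpose_mat (cnj l \<cdot>\<^sub>m 1\<^sub>m n - A) \<in> cmat n n" using S by (metis transpose_carrier_mat)
  show False
  proof (rule minimal_realization_no_cancellation)
    show "poly (char_poly A) (cnj l) = 0" unfolding char_poly_shifted[OF abcd_carrier(1)]
      using det_0_iff_vec_prod_zero_field[OF ST] Sx x xne det_transpose[OF S] by auto
    fix k and B' C' D' :: "complex mat"
    assume c: "B' \<in> cmat n k" "C' \<in> cmat k n" "D' \<in> cmat k k"
      and cols: "\<And>i. i < k \<Longrightarrow> \<exists>i' < m. col B' i = col B i'"
    have mC: "- C' \<in> cmat k n" using c by simp
    have cT: "transpose_mat B' \<in> cmat k n" "transpose_mat (- C') \<in> cmat n k" "transpose_mat D' \<in> cmat k k" using c by auto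
    have B'x: "transpose_mat B' *\<^sub>v x = 0\<^sub>v k"
    proof (intro eq_vecI)
      fix i assume "i < dim_vec (0\<^sub>v k :: complex vec)"
      hence i: "i < k" by simp
      obtain i' where i': "i' < m" "col B' i = col B i'" using cols[OF i] by auto
      have Bd: "adj B \<in> cmat m n" using abcd_carrier by simp
      have "col B i' \<bullet> x = (\<Sum>j<n. B $$ (j, i') * cnj (w $ j))"
        using i' abcd_carrier w by (auto simp: scalar_prod_def x_def lessThan_atLeast0)
      also have "\<dots> = cnj ((adj B *\<^sub>v w) $ i')"
        unfolding mult_mat_vec_index_sum[OF Bd w i'(1)] using i' abcd_carrier by simp
      also have "\<dots> = 0" unfolding Bw using i' by simp
      finally have "col B' i \<bullet> x = 0" unfolding i'(2) .
      thus "(transpose_mat B' *\<^sub>v x) $ i = 0\<^sub>v k $ i" using i c x by simp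
    qed (use c in auto)
    have M: "system_matrix n A B' C' D' (cnj l) \<in> cmat (n + k) (n + k)"
      unfolding system_matrix_def using S c by auto
    have "transpose_mat (system_matrix n A B' C' D' (cnj l)) *\<^sub>v (x @\<^sub>v 0\<^sub>v k) = 0\<^sub>v n @\<^sub>v 0\<^sub>v k"
      unfolding system_matrix_def transpose_four_block_mat[OF S c(1) mC c(3)]
      using four_block_mat_mult_vec[OF ST cT(2,1,3) x zero_carrier_vec] Sx B'x mult_mat_vec_zero[OF cT(2)] mult_mat_vec_zero[OF cT(3)] by simp
    hence "det (transpose_mat (system_matrix n A B' C' D' (cnj l))) = 0"
      by (rule det_zero_of_append_kernel[OF _ x xne, rotated]) (use M in simp)
    thus "det (system_matrix n A B' C' D' (cnj l)) = 0" using det_transpose[OF M] by simp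
  qed
qed

end

section \<open>Stability and Lyapunov inequalities\<close>

lemma smult_vec_eq_zero:
  fixes v :: "complex vec"
  assumes v: "v \<in> cvec n" and a: "a \<noteq> 0" and e: "a \<cdot>\<^sub>v v = 0\<^sub>v n"
  shows "v = 0\<^sub>v n"
proof (intro eq_vecI)
  fix i assume "i < dim_vec (0\<^sub>v n :: complex vec)"
  hence i: "i < n" by simp
  have "(a \<cdot>\<^sub>v v) $ i = 0" unfolding e using i by simp
  thus "v $ i = 0\<^sub>v n $ i" using i v a by simp
qed (use v in auto)

lemma vec_eq_cscalar:
  fixes v w :: "complex vec"
  assumes v: "v \<in> cvec n" and w: "w \<in> cvec n"
    and e: "\<And>u. u \<in> cvec n \<Longrightarrow> v \<bullet>c u = w \<bullet>c u"
  shows "v = w"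
proof -
  have d: "v - w \<in> cvec n" using v w by auto
  have "(v - w) \<bullet>c (v - w) = 0" using cscalar_minus_left[OF v w d] e[OF d] by simp
  hence "v - w = 0\<^sub>v n" using cscalar_self_eq_0[OF d] by simp
  hence "\<forall>i<n. v $ i = w $ i" using v w by (metis eq_iff_diff_eq_0 index_minus_vec(1) index_zero_vec(1) carrier_vecD)
  thus ?thesis using v w by (intro eq_vecI) auto
qed

lemma mat_eq_vecI:
  fixes X Y :: "complex mat"
  assumes X: "X \<in> cmat n k" and Y: "Y \<in> cmat n k"
    and e: "\<And>v. v \<in> cvec k \<Longrightarrow> X *\<^sub>v v = Y *\<^sub>v v"
  shows "X = Y"
proof (rule mat_col_eqI)
  fix j assume "j < dim_col Y"
  hence j: "j < k" using Y by simp
  show "col X j = col Y j" using e[of "unit_vec k j"] mat_mult_unit_vec[OF X j] mat_mult_unit_vec[OF Y j] by simp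
qed (use X Y in auto)

text \<open>The matrix \<open>- (H * A + adj A * H)\<close> is semidefinite and its form vanishes on the kernel of \<open>H\<close>, so it
annihilates \<open>v\<close>; what is left of this equation is the claim.\<close>

lemma dissipative_kernel_invariant:
  assumes A: "A \<in> cmat n n" and H: "H \<in> cmat n n" "adj H = H"
    and neg: "\<And>x. x \<in> cvec n \<Longrightarrow> Re ((H *\<^sub>v x) \<bullet>c (A *\<^sub>v x)) \<le> 0"
    and v: "v \<in> cvec n" and Hv: "H *\<^sub>v v = 0\<^sub>v n"
  shows "H *\<^sub>v (A *\<^sub>v v) = 0\<^sub>v n"
proof -
  note I = one_carrier_mat[of n, where 'a = complex]
  let ?Q = "complex_of_real (-1) \<cdot>\<^sub>m lyap A (1\<^sub>m n) H"
  have L: "lyap A (1\<^sub>m n) H \<in> cmat n n" by (rule lyap_carrier[OF A I H(1)])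
  have Qv: "?Q *\<^sub>v x = complex_of_real (-1) \<cdot>\<^sub>v (lyap A (1\<^sub>m n) H *\<^sub>v x)" if "x \<in> cvec n" for x
    using L that by (intro eq_vecI) auto
  have Qf: "qform ?Q x = - 2 * Re ((H *\<^sub>v x) \<bullet>c (A *\<^sub>v x))" if x: "x \<in> cvec n" for x
    unfolding Qv[OF x] using cscalar_smult_left[of "lyap A (1\<^sub>m n) H *\<^sub>v x" n x "complex_of_real (-1)"]
      lyap_form[OF A I H x] L x by simp
  have Q: "pos_semidef n ?Q" unfolding pos_semidef_def
    using Qf neg L lyap_hermitian[OF A I H] by (auto simp: mat_adjoint_smult)
  have Av: "A *\<^sub>v v \<in> cvec n" using A v by auto
  have "qform ?Q v = 0" unfolding Qf[OF v] Hv using Av by simp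
  from pos_semidef_zero_form[OF Q v this] have z: "complex_of_real (-1) \<cdot>\<^sub>v (lyap A (1\<^sub>m n) H *\<^sub>v v) = 0\<^sub>v n"
    unfolding Qv[OF v] .
  have z: "lyap A (1\<^sub>m n) H *\<^sub>v v = 0\<^sub>v n"
    by (rule smult_vec_eq_zero[OF _ _ z]) (use L v in auto)
  have Aa: "adj A \<in> cmat n n" using A by simp
  have I': "adj (1\<^sub>m n :: complex mat) = 1\<^sub>m n" by (intro eq_matI) auto
  have HA: "H * A \<in> cmat n n" "adj A * H \<in> cmat n n" using H A Aa by auto
  have "lyap A (1\<^sub>m n) H = H * A + adj A * H"
    unfolding lyap_def I' using H HA by simp
  hence "0\<^sub>v n = H *\<^sub>v (A *\<^sub>v v) + adj A *\<^sub>v (H *\<^sub>v v)"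
    using z add_mult_distrib_mat_vec[OF HA v] assoc_mult_mat_vec[OF H(1) A v] assoc_mult_mat_vec[OF Aa H(1) v] by simp
  also have "\<dots> = H *\<^sub>v (A *\<^sub>v v)" unfolding Hv mult_mat_vec_zero[OF Aa] using H Av by simp
  finally show ?thesis by simp
qed

text \<open>Pass to discrete time by the Cayley transform \<open>T = (1 + A) * (1 - A)\<inverse>\<close>. The form does not increase
along \<open>T\<close>, and the eigenvalues of \<open>T\<close> lie in the open unit disc, so \<open>qform H (T\<^sup>k x)\<close> decreases to \<open>0\<close>. The
decay is quantified by comparing with \<open>T' = T / \<rho>\<close>, whose powers are still bounded.\<close>

lemma stable_lyapunov_nonneg:
  assumes A: "A \<in> cmat n n" and H: "H \<in> cmat n n" "adj H = H"
    and neg: "\<And>x. x \<in> cvec n \<Longrightarrow> Re ((H *\<^sub>v x) \<bullet>c (A *\<^sub>v x)) \<le> 0"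
    and stable: "\<And>l. l \<in> spectrum A \<Longrightarrow> Re l < 0"
    and x: "x \<in> cvec n"
  shows "0 \<le> qform H x"
proof (cases "n = 0")
  case True
  hence "x = 0\<^sub>v n" using x by (intro eq_vecI) auto
  thus ?thesis using mult_mat_vec_zero[OF H(1)] by simp
next
  case n0: False
  have s1: "1 \<notin> spectrum A" using stable by force
  define R where "R = resolvent_mat n A 1"
  note Rm = resolvent[OF A s1, folded R_def]
  have Rv: "R *\<^sub>v x \<in> cvec n" "x = R *\<^sub>v x - A *\<^sub>v (R *\<^sub>v x)" if x: "x \<in> cvec n" for x
  proof -
    note rv = resolvent_vec[OF A s1 x, folded R_def]
    show "R *\<^sub>v x \<in> cvec n" by (rule rv(1))
    have "R *\<^sub>v x = A *\<^sub>v (R *\<^sub>v x) + x" using rv(2) by simp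
    moreover have "x = (A *\<^sub>v (R *\<^sub>v x) + x) - A *\<^sub>v (R *\<^sub>v x)" using A x by (intro eq_vecI) auto
    ultimately show "x = R *\<^sub>v x - A *\<^sub>v (R *\<^sub>v x)" by simp
  qed
  define T where "T = (1\<^sub>m n + A) * R"
  have IA: "1\<^sub>m n + A \<in> cmat n n" using A by auto
  have T: "T \<in> cmat n n" unfolding T_def using IA Rm by auto
  have Tv: "T *\<^sub>v x = R *\<^sub>v x + A *\<^sub>v (R *\<^sub>v x)" if x: "x \<in> cvec n" for x
    unfolding T_def using assoc_mult_mat_vec[OF IA Rm(1) x] add_mult_distrib_mat_vec[OF one_carrier_mat A Rv(1)[OF x]] Rv(1)[OF x] by simp
  define q where "q x = qform H x" for x
  have qT: "q (T *\<^sub>v x) \<le> q x" if x: "x \<in> cvec n" for x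
  proof -
    define y where "y = R *\<^sub>v x"
    have y: "y \<in> cvec n" "A *\<^sub>v y \<in> cvec n" unfolding y_def using Rv[OF x] A by auto
    have e1: "x = y - 1 \<cdot>\<^sub>v (A *\<^sub>v y)" using Rv(2)[OF x] y unfolding y_def by simp
    have e2: "T *\<^sub>v x = y - (- 1) \<cdot>\<^sub>v (A *\<^sub>v y)" unfolding Tv[OF x] y_def[symmetric] using y by (intro eq_vecI) auto
    have "q x = qform H y - 2 * Re ((H *\<^sub>v y) \<bullet>c (A *\<^sub>v y)) + qform H (A *\<^sub>v y)"
      unfolding q_def using hermitian_form_minus[OF H y(2,1), of 1] e1 by simp
    moreover have "q (T *\<^sub>v x) = qform H y + 2 * Re ((H *\<^sub>v y) \<bullet>c (A *\<^sub>v y)) + qform H (A *\<^sub>v y)"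
      unfolding q_def e2 using hermitian_form_minus[OF H y(2,1), of "- 1"] by simp
    ultimately show ?thesis using neg[OF y(1)] by simp
  qed
  have specT: "cmod \<mu> < 1" if mu: "\<mu> \<in> spectrum T" for \<mu>
  proof -
    obtain v where v: "v \<in> cvec n" "v \<noteq> 0\<^sub>v n" "T *\<^sub>v v = \<mu> \<cdot>\<^sub>v v" using mu spectrum_iff[OF T] by auto
    define y where "y = R *\<^sub>v v"
    have y: "y \<in> cvec n" "A *\<^sub>v y \<in> cvec n" unfolding y_def using Rv[OF v(1)] A by auto
    have e1: "v = y - A *\<^sub>v y" using Rv(2)[OF v(1)] unfolding y_def .
    have e2: "y + A *\<^sub>v y = \<mu> \<cdot>\<^sub>v v" using Tv[OF v(1)] v(3) unfolding y_def by simp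
    have pt: "(1 + \<mu>) * (A *\<^sub>v y) $ i = (\<mu> - 1) * y $ i" if i: "i < n" for i
    proof -
      have "(y + A *\<^sub>v y) $ i = \<mu> * (y - A *\<^sub>v y) $ i" unfolding e2 e1[symmetric] using i v by simp
      hence "y $ i + (A *\<^sub>v y) $ i = \<mu> * (y $ i - (A *\<^sub>v y) $ i)" using i y A by simp
      thus ?thesis by (simp add: algebra_simps)
    qed
    have y0: "y \<noteq> 0\<^sub>v n"
    proof
      assume "y = 0\<^sub>v n"
      hence "v = 0\<^sub>v n" using e1 mult_mat_vec_zero[OF A] by simp
      thus False using v by simp
    qed
    \<comment> \<open>Eigenvalues of \<open>T\<close> and of \<open>A\<close> correspond under the Cayley transform.\<close>
    have mu1: "1 + \<mu> \<noteq> 0"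
    proof
      assume "1 + \<mu> = 0"
      moreover hence "\<mu> - 1 = - 2" by (simp add: add_eq_0_iff2)
      ultimately have "\<forall>i<n. y $ i = 0" using pt by fastforce
      hence "y = 0\<^sub>v n" using y by (intro eq_vecI) auto
      thus False using y0 by simp
    qed
    have "A *\<^sub>v y = ((\<mu> - 1) / (1 + \<mu>)) \<cdot>\<^sub>v y"
    proof (intro eq_vecI)
      fix i assume "i < dim_vec (((\<mu> - 1) / (1 + \<mu>)) \<cdot>\<^sub>v y)"
      hence i: "i < n" using y by simp
      show "(A *\<^sub>v y) $ i = (((\<mu> - 1) / (1 + \<mu>)) \<cdot>\<^sub>v y) $ i"
        using pt[OF i] mu1 i y by (simp add: field_simps del: index_mult_mat_vec)
    qed (use y A in auto)
    hence "(\<mu> - 1) / (1 + \<mu>) \<in> spectrum A" using spectrum_iff[OF A] y y0 by auto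
    from stable[OF this] have neg: "Re ((\<mu> - 1) / (1 + \<mu>)) < 0" .
    have Re_mult_real: "Re (z * of_real r) = Re z * r" for z r by simp
    have "Re ((\<mu> - 1) * cnj (1 + \<mu>)) = Re ((\<mu> - 1) / (1 + \<mu>) * ((1 + \<mu>) * cnj (1 + \<mu>)))" using mu1 by simp
    also have "(1 + \<mu>) * cnj (1 + \<mu>) = of_real ((cmod (1 + \<mu>))\<^sup>2)" by (metis complex_norm_square of_real_power)
    also have "Re ((\<mu> - 1) / (1 + \<mu>) * of_real ((cmod (1 + \<mu>))\<^sup>2)) = Re ((\<mu> - 1) / (1 + \<mu>)) * (cmod (1 + \<mu>))\<^sup>2"
      by (rule Re_mult_real)
    also have "\<dots> < 0" using neg mu1 by (simp add: mult_less_0_iff)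
    finally have "(cmod \<mu>)\<^sup>2 < 1" unfolding cmod_power2 by (simp add: power2_eq_square algebra_simps)
    thus ?thesis by (simp add: power_less_one_iff abs_square_less_1)
  qed
  \<comment> \<open>A bound below 1 on the moduli of the eigenvalues; inserting 0 makes it nonnegative.\<close>
  define \<rho>0 where "\<rho>0 = Max (insert 0 (cmod ` spectrum T))"
  have fin: "finite (insert 0 (cmod ` spectrum T))" using card_finite_spectrum(1)[OF T] by simp
  have r0: "0 \<le> \<rho>0" "\<rho>0 < 1" "\<And>\<mu>. \<mu> \<in> spectrum T \<Longrightarrow> cmod \<mu> \<le> \<rho>0"
    unfolding \<rho>0_def using fin specT by auto
  define \<rho> where "\<rho> = (\<rho>0 + 1) / 2"
  have r: "0 < \<rho>" "\<rho> < 1" "\<rho>0 < \<rho>" unfolding \<rho>_def using r0 by auto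
  define T' where "T' = complex_of_real (1 / \<rho>) \<cdot>\<^sub>m T"
  have T': "T' \<in> cmat n n" unfolding T'_def using T by simp
  have T'v: "T *\<^sub>v v = complex_of_real \<rho> \<cdot>\<^sub>v (T' *\<^sub>v v)" if "v \<in> cvec n" for v
    unfolding T'_def using T that r by (intro eq_vecI) auto
  have "spectral_radius T' < 1"
  proof -
    from spectral_radius_mem_max(1)[OF T'] n0 obtain \<nu> where nu: "\<nu> \<in> spectrum T'" "spectral_radius T' = cmod \<nu>" by auto
    then obtain v where v: "v \<in> cvec n" "v \<noteq> 0\<^sub>v n" "T' *\<^sub>v v = \<nu> \<cdot>\<^sub>v v" using spectrum_iff[OF T'] by auto
    have "T *\<^sub>v v = (complex_of_real \<rho> * \<nu>) \<cdot>\<^sub>v v" unfolding T'v[OF v(1)] v(3) using v by (intro eq_vecI) auto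
    hence "complex_of_real \<rho> * \<nu> \<in> spectrum T" using spectrum_iff[OF T] v by auto
    from r0(3)[OF this] r have "\<rho> * cmod \<nu> \<le> \<rho>0" by (simp add: norm_mult)
    hence "\<rho> * cmod \<nu> < \<rho> * 1" using r by linarith
    hence "cmod \<nu> < 1" using r(1) by (simp only: mult_less_cancel_left_pos)
    thus ?thesis using nu by simp
  qed
  then obtain c where c: "\<And>k. norm_bound (T' ^\<^sub>m k) c"
    using spectral_radius_jnf_norm_bound_less_1_upper_triangular[OF T'] by auto
  have Tk: "T' ^\<^sub>m k \<in> cmat n n" for k using T' by simp
  have qk: "\<rho> ^ (2 * k) * q (T' ^\<^sub>m k *\<^sub>v y) \<le> q y" if "y \<in> cvec n" for k y
    using that
  proof (induction k arbitrary: y)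
    case 0
    thus ?case using T' by simp
  next
    case (Suc k)
    have T'y: "T' *\<^sub>v y \<in> cvec n" using T' Suc.prems by auto
    have HT'y: "H *\<^sub>v (T' *\<^sub>v y) \<in> cvec n" using H T'y by auto
    have "T' ^\<^sub>m Suc k *\<^sub>v y = T' ^\<^sub>m k *\<^sub>v (T' *\<^sub>v y)" using assoc_mult_mat_vec[OF Tk T' Suc.prems] by simp
    hence "\<rho> ^ (2 * Suc k) * q (T' ^\<^sub>m Suc k *\<^sub>v y) = \<rho>\<^sup>2 * (\<rho> ^ (2 * k) * q (T' ^\<^sub>m k *\<^sub>v (T' *\<^sub>v y)))"
      by (simp add: power2_eq_square)
    also have "\<dots> \<le> \<rho>\<^sup>2 * q (T' *\<^sub>v y)" using Suc.IH[OF T'y] by (intro mult_left_mono) auto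
    also have "\<dots> = q (T *\<^sub>v y)"
      unfolding T'v[OF Suc.prems] q_def mult_mat_vec[OF H(1) T'y]
      using cscalar_smult_left[OF HT'y, of "complex_of_real \<rho> \<cdot>\<^sub>v (T' *\<^sub>v y)" "complex_of_real \<rho>"] cscalar_smult_right[OF T'y HT'y, of "complex_of_real \<rho>"] T'y
      by (simp add: power2_eq_square)
    also have "\<dots> \<le> q y" by (rule qT[OF Suc.prems])
    finally show ?case .
  qed
  define M where "M = entry_norm n H * (\<Sum>i<n. \<Sum>j<n. \<bar>c\<bar> * cmod (x $ j))\<^sup>2"
  have "- (\<rho> ^ (2 * k)) * M \<le> q x" for k
  proof -
    define y where "y = T' ^\<^sub>m k *\<^sub>v x"
    have y: "y \<in> cvec n" unfolding y_def using Tk x by (metis mult_mat_vec_carrier)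
    have "cmod (y $ i) \<le> (\<Sum>j<n. \<bar>c\<bar> * cmod (x $ j))" if i: "i < n" for i
    proof -
      have "cmod (y $ i) \<le> (\<Sum>j<n. cmod ((T' ^\<^sub>m k) $$ (i, j) * x $ j))"
        unfolding y_def mult_mat_vec_index_sum[OF Tk x i] by (rule norm_sum)
      also have "\<dots> \<le> (\<Sum>j<n. \<bar>c\<bar> * cmod (x $ j))"
      proof (intro sum_mono)
        fix j assume "j \<in> {..<n}"
        hence "cmod ((T' ^\<^sub>m k) $$ (i, j)) \<le> c" using c[of k] Tk[of k] T' i unfolding norm_bound_def by auto
        thus "cmod ((T' ^\<^sub>m k) $$ (i, j) * x $ j) \<le> \<bar>c\<bar> * cmod (x $ j)"
          by (auto simp: norm_mult intro!: mult_right_mono)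
      qed
      finally show ?thesis .
    qed
    hence "(\<Sum>i<n. cmod (y $ i)) \<le> (\<Sum>i<n. \<Sum>j<n. \<bar>c\<bar> * cmod (x $ j))" by (intro sum_mono) auto
    hence "(\<Sum>i<n. cmod (y $ i))\<^sup>2 \<le> (\<Sum>i<n. \<Sum>j<n. \<bar>c\<bar> * cmod (x $ j))\<^sup>2" by (intro power_mono) (auto simp: sum_nonneg)
    hence "entry_norm n H * (\<Sum>i<n. cmod (y $ i))\<^sup>2 \<le> M" unfolding M_def by (intro mult_left_mono entry_norm_nonneg)
    hence "cmod ((H *\<^sub>v y) \<bullet>c y) \<le> M" using entry_norm_form[OF H(1) y] by linarith
    hence "- M \<le> q y" unfolding q_def using abs_Re_le_cmod[of "(H *\<^sub>v y) \<bullet>c y"] by linarith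
    hence "\<rho> ^ (2 * k) * (- M) \<le> \<rho> ^ (2 * k) * q y" using r by (intro mult_left_mono) auto
    thus ?thesis using qk[OF x, of k] unfolding y_def[symmetric] by simp
  qed
  moreover have "(\<lambda>k. - (\<rho> ^ (2 * k)) * M) \<longlonglongrightarrow> - (0::real) * M"
  proof (intro tendsto_mult tendsto_minus tendsto_const)
    have "(\<lambda>k. (\<rho>\<^sup>2) ^ k) \<longlonglongrightarrow> 0"
      by (rule LIMSEQ_realpow_zero) (use r in \<open>auto simp: power_less_one_iff\<close>)
    thus "(\<lambda>k. \<rho> ^ (2 * k)) \<longlonglongrightarrow> 0" by (simp add: power_mult)
  qed
  ultimately have "- 0 * M \<le> q x" by (intro LIMSEQ_le_const2[where X = "\<lambda>k. - (\<rho> ^ (2 * k)) * M"]) auto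
  thus ?thesis unfolding q_def by simp
qed

text \<open>Boundedness near \<open>0\<close> from the right; functions of \<open>s\<close> are examined along the ray \<open>s = l + \<epsilon>\<close>, which
stays in the right half plane when \<open>l\<close> is on its boundary.\<close>

definition bounded_right :: "(real \<Rightarrow> complex) \<Rightarrow> bool" where
  "bounded_right f \<longleftrightarrow> (\<exists>K. \<forall>\<^sub>F \<epsilon> in at_right 0. cmod (f \<epsilon>) \<le> K)"

lemma bounded_right_cong:
  assumes "bounded_right f" "\<forall>\<^sub>F \<epsilon> in at_right 0. g \<epsilon> = f \<epsilon>"
  shows "bounded_right g"
proof -
  obtain K where K: "\<forall>\<^sub>F \<epsilon> in at_right 0. cmod (f \<epsilon>) \<le> K" using assms unfolding bounded_right_def by auto
  have "\<forall>\<^sub>F \<epsilon> in at_right 0. cmod (g \<epsilon>) \<le> K" using K assms(2) by eventually_elim simp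
  thus ?thesis unfolding bounded_right_def by auto
qed

lemma bounded_right_lin:
  assumes "bounded_right f" "bounded_right g" "bounded_right h"
  shows "bounded_right (\<lambda>\<epsilon>. h \<epsilon> * f \<epsilon> + g \<epsilon>)"
proof -
  obtain K L M where K: "\<forall>\<^sub>F \<epsilon> in at_right 0. cmod (f \<epsilon>) \<le> K" "\<forall>\<^sub>F \<epsilon> in at_right 0. cmod (g \<epsilon>) \<le> L"
     "\<forall>\<^sub>F \<epsilon> in at_right 0. cmod (h \<epsilon>) \<le> M"
    using assms unfolding bounded_right_def by auto
  have "\<forall>\<^sub>F \<epsilon> in at_right 0. cmod (h \<epsilon> * f \<epsilon> + g \<epsilon>) \<le> M * K + L"
    using K
  proof eventually_elim
    case (elim \<epsilon>)
    have "cmod (h \<epsilon> * f \<epsilon> + g \<epsilon>) \<le> cmod (h \<epsilon>) * cmod (f \<epsilon>) + cmod (g \<epsilon>)"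
      using norm_triangle_ineq[of "h \<epsilon> * f \<epsilon>" "g \<epsilon>"] by (simp add: norm_mult)
    also have "cmod (h \<epsilon>) * cmod (f \<epsilon>) \<le> M * K"
      using elim order_trans[OF norm_ge_zero elim(3)] by (intro mult_mono) auto
    finally show ?case using elim by simp
  qed
  thus ?thesis unfolding bounded_right_def by auto
qed

lemma bounded_right_const: "bounded_right (\<lambda>_. c)"
  unfolding bounded_right_def by (intro exI[of _ "cmod c"]) simp

lemma eventually_avoid_finite:
  assumes "finite E"
  shows "\<forall>\<^sub>F \<epsilon> in at_right 0. l + complex_of_real \<epsilon> \<notin> E"
proof -
  have "\<forall>\<^sub>F \<epsilon> in at_right 0. l + complex_of_real \<epsilon> \<noteq> e" for e
  proof (cases "Re (e - l) > 0")
    case True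
    have "\<forall>\<^sub>F \<epsilon> in at_right (0::real). \<epsilon> < Re (e - l)" using True by (intro eventually_at_rightI[of 0 "Re (e - l)"]) auto
    thus ?thesis by eventually_elim auto
  next
    case False
    have "\<forall>\<^sub>F \<epsilon> in at_right (0::real). 0 < \<epsilon>" by (simp add: eventually_at_right_less)
    thus ?thesis by eventually_elim (use False in auto)
  qed
  hence "\<forall>\<^sub>F \<epsilon> in at_right 0. \<forall>e \<in> E. l + complex_of_real \<epsilon> \<noteq> e"
    using assms by (simp add: eventually_ball_finite)
  thus ?thesis by eventually_elim auto
qed

text \<open>The resolvent is unbounded at an eigenvalue, and a controllable and observable system cannot hide
this. The property that \<open>(R \<epsilon> *\<^sub>v v) \<bullet>c w\<close> stays bounded is linear in \<open>v\<close> and in \<open>w\<close>, and it is stable under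
\<open>v \<mapsto> A *\<^sub>v v\<close> and \<open>w \<mapsto> adj A *\<^sub>v w\<close>, because \<open>A *\<^sub>v (R \<epsilon> *\<^sub>v v)\<close> and \<open>s \<epsilon> \<cdot>\<^sub>v (R \<epsilon> *\<^sub>v v)\<close> differ by \<open>v\<close>. Starting from
the range of \<open>B\<close> and the range of \<open>adj C\<close>, two applications of the Hautus test extend it to all \<open>v\<close> and \<open>w\<close>,
contrary to its failure for an eigenvector.\<close>

lemma hautus_eigenvalue_is_pole:
  assumes A: "A \<in> cmat n n" and B: "B \<in> cmat n m" and C: "C \<in> cmat q n"
    and pbhc: "\<And>w l. w \<in> cvec n \<Longrightarrow> adj A *\<^sub>v w = l \<cdot>\<^sub>v w \<Longrightarrow> adj B *\<^sub>v w = 0\<^sub>v m \<Longrightarrow> w = 0\<^sub>v n"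
    and pbho: "\<And>w l. w \<in> cvec n \<Longrightarrow> A *\<^sub>v w = l \<cdot>\<^sub>v w \<Longrightarrow> C *\<^sub>v w = 0\<^sub>v q \<Longrightarrow> w = 0\<^sub>v n"
    and bd: "\<And>u y. u \<in> cvec m \<Longrightarrow> y \<in> cvec q \<Longrightarrow>
      bounded_right (\<lambda>\<epsilon>. (C *\<^sub>v (resolvent_mat n A (l + complex_of_real \<epsilon>) *\<^sub>v (B *\<^sub>v u))) \<bullet>c y)"
  shows "l \<notin> spectrum A"
proof
  assume "l \<in> spectrum A"
  then obtain x where x: "x \<in> cvec n" "x \<noteq> 0\<^sub>v n" "A *\<^sub>v x = l \<cdot>\<^sub>v x" using spectrum_iff[OF A] by auto
  define s where "s \<epsilon> = l + complex_of_real \<epsilon>" for \<epsilon>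
  define R where "R \<epsilon> = resolvent_mat n A (s \<epsilon>)" for \<epsilon>
  have ev: "\<forall>\<^sub>F \<epsilon> in at_right 0. s \<epsilon> \<notin> spectrum A"
    unfolding s_def by (rule eventually_avoid_finite[OF card_finite_spectrum(1)[OF A]])
  have pos: "\<forall>\<^sub>F \<epsilon> in at_right (0::real). 0 < \<epsilon>" by (simp add: eventually_at_right_less)
  have R: "R \<epsilon> \<in> cmat n n" if "s \<epsilon> \<notin> spectrum A" for \<epsilon> unfolding R_def using resolvent[OF A that] by auto
  have bs: "bounded_right s"
  proof -
    have "\<forall>\<^sub>F \<epsilon> in at_right (0::real). \<epsilon> < 1" by (intro eventually_at_rightI[of 0 1]) auto
    hence "\<forall>\<^sub>F \<epsilon> in at_right 0. cmod (s \<epsilon>) \<le> cmod l + 1" using pos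
    proof eventually_elim
      case (elim \<epsilon>)
      thus ?case unfolding s_def using norm_triangle_ineq[of l "complex_of_real \<epsilon>"] by simp
    qed
    thus ?thesis unfolding bounded_right_def by auto
  qed
  define b where "b v w \<longleftrightarrow> bounded_right (\<lambda>\<epsilon>. (R \<epsilon> *\<^sub>v v) \<bullet>c w)" for v w
  have b_left: "b (a \<cdot>\<^sub>v v + v') w" if "b v w" "b v' w" "v \<in> cvec n" "v' \<in> cvec n" "w \<in> cvec n" for a v v' w
  proof -
    have "\<forall>\<^sub>F \<epsilon> in at_right 0. (R \<epsilon> *\<^sub>v (a \<cdot>\<^sub>v v + v')) \<bullet>c w = a * ((R \<epsilon> *\<^sub>v v) \<bullet>c w) + (R \<epsilon> *\<^sub>v v') \<bullet>c w"
      using ev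
    proof eventually_elim
      case (elim \<epsilon>)
      note R = R[OF elim]
      have "R \<epsilon> *\<^sub>v (a \<cdot>\<^sub>v v + v') = a \<cdot>\<^sub>v (R \<epsilon> *\<^sub>v v) + R \<epsilon> *\<^sub>v v'"
        using mult_add_distrib_mat_vec[OF R, of "a \<cdot>\<^sub>v v" v'] mult_mat_vec[OF R that(3)] that by simp
      thus ?case using cscalar_add_left[of "a \<cdot>\<^sub>v (R \<epsilon> *\<^sub>v v)" n "R \<epsilon> *\<^sub>v v'" w] cscalar_smult_left[of "R \<epsilon> *\<^sub>v v" n w a] R that by auto
    qed
    thus ?thesis using that bounded_right_lin[OF _ _ bounded_right_const] unfolding b_def by (blast intro: bounded_right_cong)
  qed
  have b_right: "b v (a \<cdot>\<^sub>v w + w')" if "b v w" "b v w'" "v \<in> cvec n" "w \<in> cvec n" "w' \<in> cvec n" for a v w w'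
  proof -
    have "\<forall>\<^sub>F \<epsilon> in at_right 0. (R \<epsilon> *\<^sub>v v) \<bullet>c (a \<cdot>\<^sub>v w + w') = cnj a * ((R \<epsilon> *\<^sub>v v) \<bullet>c w) + (R \<epsilon> *\<^sub>v v) \<bullet>c w'"
      using ev
    proof eventually_elim
      case (elim \<epsilon>)
      have Rv: "R \<epsilon> *\<^sub>v v \<in> cvec n" using R[OF elim] that by auto
      show ?case using cscalar_add_right[OF _ that(5) Rv, of "a \<cdot>\<^sub>v w"] cscalar_smult_right[OF that(4) Rv] that by simp
    qed
    thus ?thesis using that bounded_right_lin[OF _ _ bounded_right_const] unfolding b_def by (blast intro: bounded_right_cong)
  qed
  have b0: "b (0\<^sub>v n) w" "b w (0\<^sub>v n)" if w: "w \<in> cvec n" for w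
  proof -
    have "\<forall>\<^sub>F \<epsilon> in at_right 0. (R \<epsilon> *\<^sub>v 0\<^sub>v n) \<bullet>c w = 0" using ev
      by eventually_elim (use w mult_mat_vec_zero[OF R] in simp)
    thus "b (0\<^sub>v n) w" unfolding b_def by (rule bounded_right_cong[OF bounded_right_const])
    have "\<forall>\<^sub>F \<epsilon> in at_right 0. (R \<epsilon> *\<^sub>v w) \<bullet>c 0\<^sub>v n = 0" using ev
      by eventually_elim (use w R in \<open>metis cscalar_zero(2) mult_mat_vec_carrier\<close>)
    thus "b w (0\<^sub>v n)" unfolding b_def by (rule bounded_right_cong[OF bounded_right_const])
  qed
  have Rs: "A *\<^sub>v (R \<epsilon> *\<^sub>v v) = s \<epsilon> \<cdot>\<^sub>v (R \<epsilon> *\<^sub>v v) + (- 1) \<cdot>\<^sub>v v" "R \<epsilon> *\<^sub>v (A *\<^sub>v v) = s \<epsilon> \<cdot>\<^sub>v (R \<epsilon> *\<^sub>v v) + (- 1) \<cdot>\<^sub>v v"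
    if v: "v \<in> cvec n" and s: "s \<epsilon> \<notin> spectrum A" for v \<epsilon>
  proof -
    note rv = resolvent_vec[OF A s v, folded R_def]
    show e1: "A *\<^sub>v (R \<epsilon> *\<^sub>v v) = s \<epsilon> \<cdot>\<^sub>v (R \<epsilon> *\<^sub>v v) + (- 1) \<cdot>\<^sub>v v"
      unfolding rv(2) using A rv(1) v by (intro eq_vecI) auto
    have Av: "A *\<^sub>v v \<in> cvec n" "A *\<^sub>v (R \<epsilon> *\<^sub>v v) \<in> cvec n" using A v rv by auto
    have "s \<epsilon> \<cdot>\<^sub>v (A *\<^sub>v (R \<epsilon> *\<^sub>v v)) = A *\<^sub>v (A *\<^sub>v (R \<epsilon> *\<^sub>v v)) + A *\<^sub>v v"
      using mult_mat_vec[OF A rv(1), of "s \<epsilon>"] mult_add_distrib_mat_vec[OF A Av(2) v] unfolding rv(2) by simp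
    from resolvent_unique[OF A s Av(1) Av(2) this]
    show "R \<epsilon> *\<^sub>v (A *\<^sub>v v) = s \<epsilon> \<cdot>\<^sub>v (R \<epsilon> *\<^sub>v v) + (- 1) \<cdot>\<^sub>v v" unfolding R_def[symmetric] e1 by simp
  qed
  have bA_aux: "bounded_right (\<lambda>\<epsilon>. (s \<epsilon> \<cdot>\<^sub>v (R \<epsilon> *\<^sub>v v) + (- 1) \<cdot>\<^sub>v v) \<bullet>c w)" if "b v w" "v \<in> cvec n" "w \<in> cvec n" for v w
  proof -
    have "\<forall>\<^sub>F \<epsilon> in at_right 0. (s \<epsilon> \<cdot>\<^sub>v (R \<epsilon> *\<^sub>v v) + (- 1) \<cdot>\<^sub>v v) \<bullet>c w = s \<epsilon> * ((R \<epsilon> *\<^sub>v v) \<bullet>c w) + (- 1) * (v \<bullet>c w)"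
      using ev
    proof eventually_elim
      case (elim \<epsilon>)
      have Rv: "R \<epsilon> *\<^sub>v v \<in> cvec n" using R[OF elim] that by auto
      show ?case using cscalar_add_left[of "s \<epsilon> \<cdot>\<^sub>v (R \<epsilon> *\<^sub>v v)" n "(- 1) \<cdot>\<^sub>v v" w] cscalar_smult_left[OF Rv that(3)]
         cscalar_smult_left[OF that(2,3), of "- 1"] Rv that by simp
    qed
    thus ?thesis using that(1) bounded_right_lin[OF _ bounded_right_const bs] unfolding b_def by (blast intro: bounded_right_cong)
  qed
  have bA: "b (A *\<^sub>v v) w" if "b v w" "v \<in> cvec n" "w \<in> cvec n" for v w
    unfolding b_def
    by (rule bounded_right_cong[OF bA_aux[OF that]], use ev in eventually_elim) (use Rs that in auto)
  have bA': "b v (adj A *\<^sub>v w)" if "b v w" "v \<in> cvec n" "w \<in> cvec n" for v w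
    unfolding b_def
  proof (rule bounded_right_cong[OF bA_aux[OF that]], use ev in eventually_elim)
    case (elim \<epsilon>)
    have Rv: "R \<epsilon> *\<^sub>v v \<in> cvec n" using R[OF elim] that by auto
    show ?case using cscalar_adjoint[OF A Rv that(3)] Rs(1)[OF that(2) elim] by simp
  qed
  have Ca: "adj C \<in> cmat n q" using C by simp
  have Cy: "adj C *\<^sub>v y \<in> cvec n" if "y \<in> cvec q" for y using that Ca by (metis mult_mat_vec_carrier)
  have bBC: "b (B *\<^sub>v u) (adj C *\<^sub>v y)" if u: "u \<in> cvec m" and y: "y \<in> cvec q" for u y
    unfolding b_def
  proof (rule bounded_right_cong[OF bd[OF u y]], use ev in eventually_elim)
    case (elim \<epsilon>)
    have Rv: "R \<epsilon> *\<^sub>v (B *\<^sub>v u) \<in> cvec n" using R[OF elim] B u by (metis mult_mat_vec_carrier)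
    show ?case using cscalar_adjoint[OF C Rv y] unfolding R_def s_def by simp
  qed
  have full1: "b v (adj C *\<^sub>v y)" if y: "y \<in> cvec q" and v: "v \<in> cvec n" for y v
  proof -
    define V where "V = {v \<in> cvec n. b v (adj C *\<^sub>v y)}"
    have add: "x + x' \<in> V" if "x \<in> V" "x' \<in> V" for x x'
      using that b_left[of x _ x' 1] Cy[OF y] unfolding V_def by auto
    have sm: "a \<cdot>\<^sub>v x \<in> V" if "x \<in> V" for a x
      using that b_left[of x _ "0\<^sub>v n" a] Cy[OF y] b0(1) unfolding V_def by auto
    have "vec_subspace n V" unfolding vec_subspace_def using add sm b0(1)[OF Cy[OF y]] unfolding V_def by auto
    hence "V = cvec n"
      by (rule hautus_full[OF _ A B]) (use bA bBC Cy[OF y] y A B pbhc in \<open>auto simp: V_def\<close>)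
    thus ?thesis using v V_def by auto
  qed
  have full2: "\<forall>v \<in> cvec n. b v w" if w: "w \<in> cvec n" for w
  proof -
    define V where "V = {w \<in> cvec n. \<forall>v \<in> cvec n. b v w}"
    have add: "x + x' \<in> V" if "x \<in> V" "x' \<in> V" for x x'
      using that b_right[of _ x x' 1] unfolding V_def by auto
    have sm: "a \<cdot>\<^sub>v x \<in> V" if "x \<in> V" for a x
      using that b_right[of _ x "0\<^sub>v n" a] b0(2) unfolding V_def by auto
    have Aa: "adj A \<in> cmat n n" using A by simp
    have V: "vec_subspace n V" unfolding vec_subspace_def using add sm b0(2) unfolding V_def by auto
    have "V = cvec n"
    proof (rule hautus_full[OF V Aa Ca])
      show "adj A *\<^sub>v v \<in> V" if "v \<in> V" for v
        using that bA' Aa unfolding V_def by (auto intro: mult_mat_vec_carrier)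
      show "adj C *\<^sub>v u \<in> V" if "u \<in> cvec q" for u
        using that full1 Cy unfolding V_def by auto
    qed (use pbho in auto)
    thus ?thesis using w V_def by auto
  qed
  have "b x x" using full2[OF x(1)] x(1) by auto
  then obtain K where K: "\<forall>\<^sub>F \<epsilon> in at_right 0. cmod ((R \<epsilon> *\<^sub>v x) \<bullet>c x) \<le> K" unfolding b_def bounded_right_def by auto
  define N where "N = Re (x \<bullet>c x)"
  have N: "N > 0" unfolding N_def by (rule cscalar_self_pos[OF x(1,2)])
  \<comment> \<open>On the eigenvector itself the resolvent acts as multiplication by \<open>1 / \<epsilon>\<close>.\<close>
  have "\<forall>\<^sub>F \<epsilon> in at_right 0. inverse \<epsilon> * N \<le> K" using K ev pos
  proof eventually_elim
    case (elim \<epsilon>)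
    have "s \<epsilon> \<cdot>\<^sub>v (inverse (complex_of_real \<epsilon>) \<cdot>\<^sub>v x) = A *\<^sub>v (inverse (complex_of_real \<epsilon>) \<cdot>\<^sub>v x) + x"
      unfolding mult_mat_vec[OF A x(1)] x(3) using elim(3) x(1)
      by (intro eq_vecI) (auto simp: s_def field_simps)
    from resolvent_unique[OF A elim(2) x(1) _ this]
    have "R \<epsilon> *\<^sub>v x = inverse (complex_of_real \<epsilon>) \<cdot>\<^sub>v x" unfolding R_def using x(1) by simp
    hence "(R \<epsilon> *\<^sub>v x) \<bullet>c x = inverse (complex_of_real \<epsilon>) * of_real N"
      using cscalar_smult_left[OF x(1,1)] cscalar_self_Re(1)[OF x(1)] unfolding N_def by simp
    hence "cmod ((R \<epsilon> *\<^sub>v x) \<bullet>c x) = inverse \<epsilon> * N" using elim(3) N by (simp add: norm_mult norm_inverse)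
    thus ?case using elim(1) by simp
  qed
  moreover have "\<forall>\<^sub>F \<epsilon> in at_right (0::real). K / N + 1 \<le> inverse \<epsilon>"
    using filterlim_inverse_at_top_right unfolding filterlim_at_top by blast
  ultimately have "\<forall>\<^sub>F \<epsilon> in at_right (0::real). False"
  proof eventually_elim
    case (elim \<epsilon>)
    have "(K / N + 1) * N \<le> inverse \<epsilon> * N" using elim N by (intro mult_right_mono) auto
    moreover have "(K / N + 1) * N = K + N" using N by (simp add: field_simps)
    ultimately show False using elim(1) N by linarith
  qed
  thus False by (simp add: eventually_False)
qed

section \<open>The weight matrix and boundary values of transfer functions\<close>

abbreviation sq_norm :: "complex vec \<Rightarrow> real" where
  "sq_norm v \<equiv> Re (v \<bullet>c v)"

lemma sq_norm_sum: "v \<in> cvec n \<Longrightarrow> sq_norm v = (\<Sum>i<n. (cmod (v $ i))\<^sup>2)"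
  using cscalar_self[of v n] by simp

lemma mat_adjoint_four_block:
  assumes "A \<in> cmat n1 m1" "B \<in> cmat n1 m2" "C \<in> cmat n2 m1" "D \<in> cmat n2 m2"
  shows "adj (four_block_mat A B C D :: complex mat) =
    four_block_mat (adj A) (adj C) (adj B) (adj D)"
  using assms by (intro eq_matI) auto

lemma mat_adjoint_zero: "adj (0\<^sub>m n k :: complex mat) = 0\<^sub>m k n"
  by (intro eq_matI) auto

lemma mat_adjoint_one: "adj (1\<^sub>m n :: complex mat) = 1\<^sub>m n"
  by (intro eq_matI) auto

lemma mat_adjoint_uminus: "adj (- A :: complex mat) = - adj A"
  by (intro eq_matI) auto

lemma cscalar_append:
  fixes v1 v2 w1 w2 :: "complex vec"
  assumes "v1 \<in> cvec n" "w1 \<in> cvec n" "v2 \<in> cvec k" "w2 \<in> cvec k"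
  shows "(v1 @\<^sub>v v2) \<bullet>c (w1 @\<^sub>v w2) = v1 \<bullet>c w1 + v2 \<bullet>c w2"
proof -
  have "conjugate (w1 @\<^sub>v w2) = conjugate w1 @\<^sub>v conjugate w2" by (intro eq_vecI) auto
  thus ?thesis using scalar_prod_append[of v1 n v2 k "conjugate w1" "conjugate w2"] assms by simp
qed

lemma row_block_exists:
  fixes X Y :: "complex mat"
  assumes X: "X \<in> cmat n n" and Y: "Y \<in> cmat n m"
  shows "\<exists>N \<in> cmat n (n + m). \<forall>x \<in> cvec n. \<forall>u \<in> cvec m. N *\<^sub>v (x @\<^sub>v u) = X *\<^sub>v x + Y *\<^sub>v u"
proof (intro bexI[of _ "four_block_mat X Y (0\<^sub>m 0 n) (0\<^sub>m 0 m)"] ballI)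
  show "four_block_mat X Y (0\<^sub>m 0 n) (0\<^sub>m 0 m) \<in> cmat n (n + m)"
    using four_block_carrier_mat[OF X, of "0\<^sub>m 0 m" 0 m Y "0\<^sub>m 0 n"] by simp
  fix x u :: "complex vec" assume x: "x \<in> cvec n" and u: "u \<in> cvec m"
  show "four_block_mat X Y (0\<^sub>m 0 n) (0\<^sub>m 0 m) *\<^sub>v (x @\<^sub>v u) = X *\<^sub>v x + Y *\<^sub>v u"
    unfolding four_block_mat_mult_vec[OF X Y zero_carrier_mat zero_carrier_mat x u]
    using X Y x u by (intro eq_vecI) auto
qed

lemma W_mat_carrier: "H \<in> cmat n n \<Longrightarrow> W_mat m n \<eta> H \<in> cmat ((n + m) + (n + m)) ((n + m) + (n + m))"
  unfolding W_mat_def Let_def by (intro four_block_carrier_mat) auto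

lemma W_mat_hermitian:
  assumes H: "H \<in> cmat n n" "adj H = H"
  shows "adj (W_mat m n \<eta> H) = W_mat m n \<eta> H"
proof -
  have mH: "- H \<in> cmat n n" using H by simp
  note z = zero_carrier_mat
  have k: "complex_of_real (eta_ratio_neg \<eta>) \<cdot>\<^sub>m 1\<^sub>m m \<in> cmat m m" "(1\<^sub>m m :: complex mat) \<in> cmat m m" by auto
  have m1: "adj (four_block_mat (- H) (0\<^sub>m n m) (0\<^sub>m m n) (0\<^sub>m m m)) = four_block_mat (- H) (0\<^sub>m n m) (0\<^sub>m m n) (0\<^sub>m m m)"
    unfolding mat_adjoint_four_block[OF mH z z z] by (simp add: mat_adjoint_zero mat_adjoint_uminus H)
  have m2: "adj (four_block_mat (0\<^sub>m n n) (0\<^sub>m n m) (0\<^sub>m m n) (complex_of_real (eta_ratio_neg \<eta>) \<cdot>\<^sub>m 1\<^sub>m m)) =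
      four_block_mat (0\<^sub>m n n) (0\<^sub>m n m) (0\<^sub>m m n) (complex_of_real (eta_ratio_neg \<eta>) \<cdot>\<^sub>m 1\<^sub>m m)"
    unfolding mat_adjoint_four_block[OF z z z k(1)] by (simp add: mat_adjoint_zero mat_adjoint_smult mat_adjoint_one)
  have m3: "adj (four_block_mat (0\<^sub>m n n) (0\<^sub>m n m) (0\<^sub>m m n) (1\<^sub>m m :: complex mat)) =
      four_block_mat (0\<^sub>m n n) (0\<^sub>m n m) (0\<^sub>m m n) (1\<^sub>m m)"
    unfolding mat_adjoint_four_block[OF z z z k(2)] by (simp add: mat_adjoint_zero mat_adjoint_one)
  have c: "four_block_mat (- H) (0\<^sub>m n m) (0\<^sub>m m n) (0\<^sub>m m m) \<in> cmat (n + m) (n + m)"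
     "four_block_mat (0\<^sub>m n n) (0\<^sub>m n m) (0\<^sub>m m n) (complex_of_real (eta_ratio_neg \<eta>) \<cdot>\<^sub>m 1\<^sub>m m) \<in> cmat (n + m) (n + m)"
     "four_block_mat (0\<^sub>m n n) (0\<^sub>m n m) (0\<^sub>m m n) (1\<^sub>m m :: complex mat) \<in> cmat (n + m) (n + m)"
    using mH by (auto intro!: four_block_carrier_mat)
  show ?thesis unfolding W_mat_def Let_def mat_adjoint_four_block[OF c(2) c(1) c(1) c(3)] m1 m2 m3 ..
qed

text \<open>The weight turns the vector (velocity, output, state, input) into the dissipation balance: supplied
minus stored.\<close>

lemma W_mat_form:
  assumes H: "H \<in> cmat n n" "adj H = H"
    and c: "a \<in> cvec n" "y \<in> cvec m" "x \<in> cvec n" "u \<in> cvec m"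
  shows "Re ((W_mat m n \<eta> H *\<^sub>v ((a @\<^sub>v y) @\<^sub>v (x @\<^sub>v u))) \<bullet>c ((a @\<^sub>v y) @\<^sub>v (x @\<^sub>v u))) =
     - 2 * Re ((H *\<^sub>v x) \<bullet>c a) + eta_ratio_neg \<eta> * sq_norm y + sq_norm u"
proof -
  let ?k = "complex_of_real (eta_ratio_neg \<eta>)"
  have mH: "- H \<in> cmat n n" using H by simp
  note z = zero_carrier_mat
  have k: "?k \<cdot>\<^sub>m 1\<^sub>m m \<in> cmat m m" "(1\<^sub>m m :: complex mat) \<in> cmat m m" by auto
  let ?h = "four_block_mat (- H) (0\<^sub>m n m) (0\<^sub>m m n) (0\<^sub>m m m)"
  let ?w1 = "four_block_mat (0\<^sub>m n n) (0\<^sub>m n m) (0\<^sub>m m n) (?k \<cdot>\<^sub>m 1\<^sub>m m)"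
  let ?w4 = "four_block_mat (0\<^sub>m n n) (0\<^sub>m n m) (0\<^sub>m m n) (1\<^sub>m m :: complex mat)"
  have cc: "?h \<in> cmat (n + m) (n + m)" "?w1 \<in> cmat (n + m) (n + m)" "?w4 \<in> cmat (n + m) (n + m)"
    using mH by (auto intro!: four_block_carrier_mat)
  have zv: "0\<^sub>m p q *\<^sub>v v = (0\<^sub>v p :: complex vec)" if "v \<in> cvec q" for p q v
    using that by (intro eq_vecI) auto
  have ky: "(?k \<cdot>\<^sub>m 1\<^sub>m m) *\<^sub>v y = ?k \<cdot>\<^sub>v y" using c by (intro eq_vecI) auto
  have Hx: "H *\<^sub>v x \<in> cvec n" "H *\<^sub>v a \<in> cvec n" using H c by auto
  have mHx: "- H *\<^sub>v x = (- 1) \<cdot>\<^sub>v (H *\<^sub>v x)" "- H *\<^sub>v a = (- 1) \<cdot>\<^sub>v (H *\<^sub>v a)" using H c by (auto intro!: eq_vecI)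
  have hx: "?h *\<^sub>v (x @\<^sub>v u) = (- 1) \<cdot>\<^sub>v (H *\<^sub>v x) @\<^sub>v 0\<^sub>v m" "?h *\<^sub>v (a @\<^sub>v y) = (- 1) \<cdot>\<^sub>v (H *\<^sub>v a) @\<^sub>v 0\<^sub>v m"
    unfolding four_block_mat_mult_vec[OF mH z z z c(3,4)] four_block_mat_mult_vec[OF mH z z z c(1,2)] using c Hx
    by (simp_all add: zv mHx)
  have w1: "?w1 *\<^sub>v (a @\<^sub>v y) = 0\<^sub>v n @\<^sub>v (?k \<cdot>\<^sub>v y)"
    unfolding four_block_mat_mult_vec[OF z z z k(1) c(1,2)] using c by (simp add: zv ky)
  have w4: "?w4 *\<^sub>v (x @\<^sub>v u) = 0\<^sub>v n @\<^sub>v u"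
    unfolding four_block_mat_mult_vec[OF z z z k(2) c(3,4)] using c by (simp add: zv)
  have "W_mat m n \<eta> H *\<^sub>v ((a @\<^sub>v y) @\<^sub>v (x @\<^sub>v u)) =
     ((0\<^sub>v n @\<^sub>v (?k \<cdot>\<^sub>v y)) + ((- 1) \<cdot>\<^sub>v (H *\<^sub>v x) @\<^sub>v 0\<^sub>v m)) @\<^sub>v (((- 1) \<cdot>\<^sub>v (H *\<^sub>v a) @\<^sub>v 0\<^sub>v m) + (0\<^sub>v n @\<^sub>v u))"
    unfolding W_mat_def Let_def
    using four_block_mat_mult_vec[OF cc(2,1,1,3), of "a @\<^sub>v y" "x @\<^sub>v u"] c hx w1 w4 by simp
  also have "(0\<^sub>v n @\<^sub>v (?k \<cdot>\<^sub>v y)) + ((- 1) \<cdot>\<^sub>v (H *\<^sub>v x) @\<^sub>v 0\<^sub>v m) = ((- 1) \<cdot>\<^sub>v (H *\<^sub>v x)) @\<^sub>v (?k \<cdot>\<^sub>v y)"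
    using append_vec_add[of "0\<^sub>v n" n "(- 1) \<cdot>\<^sub>v (H *\<^sub>v x)" "?k \<cdot>\<^sub>v y" m "0\<^sub>v m"] Hx c by simp
  also have "((- 1) \<cdot>\<^sub>v (H *\<^sub>v a) @\<^sub>v 0\<^sub>v m) + (0\<^sub>v n @\<^sub>v u) = ((- 1) \<cdot>\<^sub>v (H *\<^sub>v a)) @\<^sub>v u"
    using append_vec_add[of "(- 1) \<cdot>\<^sub>v (H *\<^sub>v a)" n "0\<^sub>v n" "0\<^sub>v m" m u] Hx c by simp
  finally have "(W_mat m n \<eta> H *\<^sub>v ((a @\<^sub>v y) @\<^sub>v (x @\<^sub>v u))) \<bullet>c ((a @\<^sub>v y) @\<^sub>v (x @\<^sub>v u)) =
      (- ((H *\<^sub>v x) \<bullet>c a) + ?k * (y \<bullet>c y)) + (- ((H *\<^sub>v a) \<bullet>c x) + u \<bullet>c u)"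
    using c Hx by (simp add: cscalar_append[where n="n+m" and k="n+m"] cscalar_append[where n=n and k=m]
        cscalar_smult_left[where n=n] cscalar_smult_left[where n=m])
  thus ?thesis using hermitian_cscalar_cnj[OF H c(1,3)] by simp
qed

lemma one_minus_gram_form:
  assumes X: "X \<in> cmat m m" and u: "u \<in> cvec m"
  shows "Re (((1\<^sub>m m - complex_of_real k \<cdot>\<^sub>m (adj X * X)) *\<^sub>v u) \<bullet>c u) = sq_norm u - k * sq_norm (X *\<^sub>v u)"
proof -
  have Xa: "adj X \<in> cmat m m" using X by simp
  have XX: "adj X * X \<in> cmat m m" using X Xa by auto
  have kXX: "complex_of_real k \<cdot>\<^sub>m (adj X * X) \<in> cmat m m" using XX by simp
  have Xu: "X *\<^sub>v u \<in> cvec m" using X u by auto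
  have XXu: "adj X *\<^sub>v (X *\<^sub>v u) \<in> cvec m" using Xa Xu by (metis mult_mat_vec_carrier)
  have "(complex_of_real k \<cdot>\<^sub>m (adj X * X)) *\<^sub>v u = complex_of_real k \<cdot>\<^sub>v ((adj X * X) *\<^sub>v u)"
    using XX u by (intro eq_vecI) auto
  also have "(adj X * X) *\<^sub>v u = adj X *\<^sub>v (X *\<^sub>v u)" using assoc_mult_mat_vec[OF Xa X u] .
  finally have e: "(1\<^sub>m m - complex_of_real k \<cdot>\<^sub>m (adj X * X)) *\<^sub>v u = u - complex_of_real k \<cdot>\<^sub>v (adj X *\<^sub>v (X *\<^sub>v u))"
    using minus_mult_distrib_mat_vec[OF one_carrier_mat kXX u] u by simp
  show ?thesis unfolding e
    using cscalar_minus_left[OF u _ u, of "complex_of_real k \<cdot>\<^sub>v (adj X *\<^sub>v (X *\<^sub>v u))"]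
      cscalar_smult_left[OF XXu u] cscalar_adjoint2[OF X Xu u] XXu by simp
qed

lemma one_minus_gram_pos_semidef:
  assumes X: "X \<in> cmat m m"
  shows "pos_semidef m (1\<^sub>m m - complex_of_real k \<cdot>\<^sub>m (adj X * X)) \<longleftrightarrow>
    (\<forall>u \<in> cvec m. k * sq_norm (X *\<^sub>v u) \<le> sq_norm u)"
proof -
  have Xa: "adj X \<in> cmat m m" using X by simp
  have XX: "complex_of_real k \<cdot>\<^sub>m (adj X * X) \<in> cmat m m" using X Xa by auto
  have "adj (1\<^sub>m m - complex_of_real k \<cdot>\<^sub>m (adj X * X)) = 1\<^sub>m m - complex_of_real k \<cdot>\<^sub>m (adj X * X)"
    unfolding mat_adjoint_minus[OF one_carrier_mat XX] by (simp add: mat_adjoint_one mat_adjoint_smult mat_adjoint_mult[OF Xa X])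
  thus ?thesis unfolding pos_semidef_def using one_minus_gram_form[OF X] minus_carrier_mat[OF XX] by auto
qed

lemma eta_ratio_facts:
  assumes "1 < \<eta>"
  shows "0 < eta_ratio \<eta>" "eta_ratio_neg \<eta> = - eta_ratio \<eta>"
proof -
  show "0 < eta_ratio \<eta>" using assms by (cases \<eta>) (auto simp: eta_ratio_def one_ereal_def)
  show "eta_ratio_neg \<eta> = - eta_ratio \<eta>" using assms by (cases \<eta>) (auto simp: eta_ratio_def eta_ratio_neg_def one_ereal_def field_simps)
qed

lemma transfer_mult_vec:
  assumes A: "A \<in> cmat n n" and B: "B \<in> cmat n m" and C: "C \<in> cmat q n" and D: "D \<in> cmat q m"
    and s: "s \<notin> spectrum A" and u: "u \<in> cvec m"
  shows "(C * resolvent_mat n A s * B + D) *\<^sub>v u = C *\<^sub>v (resolvent_mat n A s *\<^sub>v (B *\<^sub>v u)) + D *\<^sub>v u"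
proof -
  define R where "R = resolvent_mat n A s"
  have R: "R \<in> cmat n n" unfolding R_def by (rule resolvent(1)[OF A s])
  have Bu: "B *\<^sub>v u \<in> cvec n" using B u by auto
  have CR: "C * R \<in> cmat q n" "C * R * B \<in> cmat q m" using C R B by auto
  have "(C * R * B + D) *\<^sub>v u = C *\<^sub>v (R *\<^sub>v (B *\<^sub>v u)) + D *\<^sub>v u"
    using add_mult_distrib_mat_vec[OF CR(2) D u] assoc_mult_mat_vec[OF CR(1) B u] assoc_mult_mat_vec[OF C R Bu] by simp
  thus ?thesis unfolding R_def .
qed

text \<open>The entries of the transfer function are quotients of polynomials by the characteristic polynomial,
which does not vanish at \<open>l\<close>.\<close>

lemma transfer_tendsto:
  assumes A: "A \<in> cmat n n" and B: "B \<in> cmat n m" and C: "C \<in> cmat m n" and D: "D \<in> cmat m m"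
    and l: "l \<notin> spectrum A" and u: "u \<in> cvec m" and i: "i < m"
  defines "T \<equiv> \<lambda>s. C * resolvent_mat n A s * B + D"
  shows "((\<lambda>\<epsilon>. (T (l + complex_of_real \<epsilon>) *\<^sub>v u) $ i) \<longlongrightarrow> (T l *\<^sub>v u) $ i) (at_right 0)"
proof -
  have Tc: "T s \<in> cmat m m" if "s \<notin> spectrum A" for s
    unfolding T_def using resolvent(1)[OF A that] B C D by auto
  have sp: "s \<notin> spectrum A \<longleftrightarrow> poly (char_poly A) s \<noteq> 0" for s using spectrum_root_char_poly[OF A] by auto
  have ent: "((\<lambda>\<epsilon>. T (l + complex_of_real \<epsilon>) $$ (i, j)) \<longlongrightarrow> T l $$ (i, j)) (at_right 0)" if j: "j < m" for j
  proof -
    obtain p where p: "\<And>s. s \<notin> spectrum A \<Longrightarrow> poly (char_poly A) s * T s $$ (i, j) = poly p s"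
      unfolding T_def using realization_entry_rational[OF A B C D i j] by auto
    have q: "T s $$ (i, j) = poly p s / poly (char_poly A) s" if "s \<notin> spectrum A" for s
      using p[OF that] that sp by (simp add: field_simps)
    have "((\<lambda>\<epsilon>::real. l + complex_of_real \<epsilon>) \<longlongrightarrow> l + complex_of_real 0) (at_right 0)" by (intro tendsto_intros)
    hence s: "((\<lambda>\<epsilon>::real. l + complex_of_real \<epsilon>) \<longlongrightarrow> l) (at_right 0)" by simp
    have "((\<lambda>\<epsilon>. poly p (l + complex_of_real \<epsilon>) / poly (char_poly A) (l + complex_of_real \<epsilon>)) \<longlongrightarrow> poly p l / poly (char_poly A) l) (at_right 0)"
      using l sp by (intro tendsto_divide isCont_tendsto_compose[OF poly_isCont s]) auto
    moreover have "\<forall>\<^sub>F \<epsilon> in at_right 0. poly p (l + complex_of_real \<epsilon>) / poly (char_poly A) (l + complex_of_real \<epsilon>) = T (l + complex_of_real \<epsilon>) $$ (i, j)"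
      using eventually_avoid_finite[OF card_finite_spectrum(1)[OF A], of l] by eventually_elim (simp add: q)
    ultimately show ?thesis unfolding q[OF l] by (rule Lim_transform_eventually)
  qed
  have "((\<lambda>\<epsilon>. \<Sum>j<m. T (l + complex_of_real \<epsilon>) $$ (i, j) * u $ j) \<longlongrightarrow> (\<Sum>j<m. T l $$ (i, j) * u $ j)) (at_right 0)"
    by (intro tendsto_sum tendsto_mult tendsto_const ent) auto
  moreover have "\<forall>\<^sub>F \<epsilon> in at_right 0. (\<Sum>j<m. T (l + complex_of_real \<epsilon>) $$ (i, j) * u $ j) = (T (l + complex_of_real \<epsilon>) *\<^sub>v u) $ i"
    using eventually_avoid_finite[OF card_finite_spectrum(1)[OF A], of l]
    by eventually_elim (simp add: mult_mat_vec_index_sum[OF Tc u i] del: index_mult_mat_vec)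
  ultimately show ?thesis unfolding mult_mat_vec_index_sum[OF Tc[OF l] u i] by (rule Lim_transform_eventually)
qed

text \<open>The equation \<open>t \<cdot>\<^sub>v x = A *\<^sub>v x + v\<close> bounds the sum of the entries of \<open>x\<close> by a constant over \<open>t - a\<close>.\<close>

lemma resolvent_at_top:
  assumes A: "A \<in> cmat n n" and v: "v \<in> cvec n"
  shows "\<forall>\<^sub>F t in at_top. complex_of_real t \<notin> spectrum A"
    "i < n \<Longrightarrow> ((\<lambda>t. (resolvent_mat n A (complex_of_real t) *\<^sub>v v) $ i) \<longlongrightarrow> 0) at_top"
proof -
  have fin: "finite (cmod ` spectrum A)" using card_finite_spectrum(1)[OF A] by simp
  have "\<forall>\<^sub>F t in at_top. Max (insert 0 (cmod ` spectrum A)) < t" by (rule eventually_gt_at_top)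
  thus ev: "\<forall>\<^sub>F t in at_top. complex_of_real t \<notin> spectrum A"
  proof eventually_elim
    case (elim t)
    show ?case
    proof
      assume t: "complex_of_real t \<in> spectrum A"
      have "\<bar>t\<bar> < t" using elim fin t by (force simp: image_iff)
      thus False by simp
    qed
  qed
  assume i: "i < n"
  define a where "a = entry_norm n A"
  define b where "b = (\<Sum>i<n. cmod (v $ i))"
  have "\<forall>\<^sub>F t in at_top. cmod ((resolvent_mat n A (complex_of_real t) *\<^sub>v v) $ i) \<le> b / (t - a)"
    using ev eventually_gt_at_top[of a]
  proof eventually_elim
    case (elim t)
    define x where "x = resolvent_mat n A (complex_of_real t) *\<^sub>v v"
    note rv = resolvent_vec[OF A elim(1) v, folded x_def]
    define X where "X = (\<Sum>i<n. cmod (x $ i))"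
    have xX: "cmod (x $ j) \<le> X" if "j < n" for j unfolding X_def using that by (intro member_le_sum) auto
    have t: "t > 0" using elim(2) entry_norm_nonneg[of n A] unfolding a_def by linarith
    have Ax: "(\<Sum>i<n. cmod ((A *\<^sub>v x) $ i)) \<le> a * X"
    proof -
      have "(\<Sum>i<n. cmod ((A *\<^sub>v x) $ i)) \<le> (\<Sum>i<n. \<Sum>j<n. cmod (A $$ (i, j) * x $ j))"
        using mult_mat_vec_index_sum[OF A rv(1)] by (intro sum_mono) (simp add: norm_sum del: index_mult_mat_vec)
      also have "\<dots> \<le> (\<Sum>i<n. \<Sum>j<n. cmod (A $$ (i, j)) * X)"
        using xX by (intro sum_mono) (auto simp: norm_mult intro: mult_left_mono)
      also have "\<dots> = a * X" unfolding a_def entry_norm_def by (simp add: sum_distrib_right)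
      finally show ?thesis .
    qed
    have "t * X = (\<Sum>i<n. cmod ((complex_of_real t \<cdot>\<^sub>v x) $ i))"
      unfolding X_def sum_distrib_left using t rv(1) by (intro sum.cong) (auto simp: norm_mult)
    also have "\<dots> \<le> (\<Sum>i<n. cmod ((A *\<^sub>v x) $ i) + cmod (v $ i))"
      unfolding rv(2) using A v by (intro sum_mono) (auto intro: norm_triangle_ineq simp del: index_mult_mat_vec)
    also have "\<dots> \<le> a * X + b" using Ax unfolding b_def by (simp add: sum.distrib)
    finally have "X \<le> b / (t - a)" using elim(2) by (simp add: field_simps)
    thus ?case using xX[OF i] unfolding x_def by linarith
  qed
  moreover have "((\<lambda>t. b / (t - a)) \<longlongrightarrow> 0) at_top"
  proof (rule tendsto_divide_0[OF tendsto_const filterlim_at_top_imp_at_infinity])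
    show "filterlim (\<lambda>t. t - a) at_top at_top" unfolding filterlim_at_top
    proof
      fix Z show "\<forall>\<^sub>F t in at_top. Z \<le> t - a" using eventually_ge_at_top[of "Z + a"] by eventually_elim simp
    qed
  qed
  ultimately show "((\<lambda>t. (resolvent_mat n A (complex_of_real t) *\<^sub>v v) $ i) \<longlongrightarrow> 0) at_top"
    by (rule Lim_null_comparison)
qed

lemma sq_norm_limit_le:
  fixes f :: "'x \<Rightarrow> complex vec" and y :: "complex vec"
  assumes ev: "\<forall>\<^sub>F x in Fl. f x \<in> cvec m \<and> k * sq_norm (f x) \<le> b" and nt: "Fl \<noteq> bot"
    and lim: "\<And>i. i < m \<Longrightarrow> ((\<lambda>x. f x $ i) \<longlongrightarrow> y $ i) Fl" and y: "y \<in> cvec m"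
  shows "k * sq_norm y \<le> b"
proof (rule tendsto_upperbound[OF _ _ nt])
  show "((\<lambda>x. k * (\<Sum>i<m. (cmod (f x $ i))\<^sup>2)) \<longlongrightarrow> k * sq_norm y) Fl"
    unfolding sq_norm_sum[OF y] using lim by (intro tendsto_mult tendsto_const tendsto_sum tendsto_power tendsto_norm) auto
  show "\<forall>\<^sub>F x in Fl. k * (\<Sum>i<m. (cmod (f x $ i))\<^sup>2) \<le> b"
    using ev by eventually_elim (use sq_norm_sum in auto)
qed

section \<open>The Cayley transform of a realization\<close>

lemma one_plus_inv:
  assumes X: "X \<in> cmat m m" and sp: "- 1 \<notin> spectrum X"
  shows "inv_mat (1\<^sub>m m + X) \<in> cmat m m"
    "v \<in> cvec m \<Longrightarrow> inv_mat (1\<^sub>m m + X) *\<^sub>v (v + X *\<^sub>v v) = v"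
    "v \<in> cvec m \<Longrightarrow> inv_mat (1\<^sub>m m + X) *\<^sub>v v + X *\<^sub>v (inv_mat (1\<^sub>m m + X) *\<^sub>v v) = v"
proof -
  have P: "1\<^sub>m m + X \<in> cmat m m" using X by auto
  have Pv: "(1\<^sub>m m + X) *\<^sub>v v = v + X *\<^sub>v v" if "v \<in> cvec m" for v
    using add_mult_distrib_mat_vec[OF one_carrier_mat X that] that by simp
  have inj: "v = 0\<^sub>v m" if v: "v \<in> cvec m" "(1\<^sub>m m + X) *\<^sub>v v = 0\<^sub>v m" for v
  proof (rule ccontr)
    assume ne: "v \<noteq> 0\<^sub>v m"
    have e: "v + X *\<^sub>v v = 0\<^sub>v m" using v Pv by simp
    have "X *\<^sub>v v = (- 1) \<cdot>\<^sub>v v"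
    proof (intro eq_vecI)
      fix i assume "i < dim_vec ((- 1) \<cdot>\<^sub>v v)"
      hence i: "i < m" using v by simp
      have "(v + X *\<^sub>v v) $ i = 0" unfolding e using i by simp
      hence "v $ i + (X *\<^sub>v v) $ i = 0" using i X by simp
      hence "(X *\<^sub>v v) $ i = - (v $ i)" by (simp add: add_eq_0_iff)
      thus "(X *\<^sub>v v) $ i = ((- 1) \<cdot>\<^sub>v v) $ i" using i v(1) by simp
    qed (use X v in auto)
    thus False using sp spectrum_iff[OF X] v(1) ne by auto
  qed
  note I = inv_mat[OF P inj]
  show "inv_mat (1\<^sub>m m + X) \<in> cmat m m" by (rule I(1))
  show "inv_mat (1\<^sub>m m + X) *\<^sub>v (v + X *\<^sub>v v) = v" if v: "v \<in> cvec m"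
    using assoc_mult_mat_vec[OF I(1) P v] I(3) Pv[OF v] v by simp
  show "inv_mat (1\<^sub>m m + X) *\<^sub>v v + X *\<^sub>v (inv_mat (1\<^sub>m m + X) *\<^sub>v v) = v" if v: "v \<in> cvec m"
  proof -
    have Iv: "inv_mat (1\<^sub>m m + X) *\<^sub>v v \<in> cvec m" using I(1) v by auto
    show ?thesis using assoc_mult_mat_vec[OF P I(1) v] I(2) Pv[OF Iv] v by simp
  qed
qed

lemma vec_sum_diff:
  fixes v w :: "complex vec"
  assumes "v \<in> cvec m" "w \<in> cvec m"
  shows "(v + w) + (v - w) = 2 \<cdot>\<^sub>v v" "(v + w) - (v - w) = 2 \<cdot>\<^sub>v w"
    "(1 / 2) \<cdot>\<^sub>v (v + w) + (1 / 2) \<cdot>\<^sub>v (v - w) = v" "(1 / 2) \<cdot>\<^sub>v (v + w) - (1 / 2) \<cdot>\<^sub>v (v - w) = w"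
    "v - w = (- 1) \<cdot>\<^sub>v (v + w) \<Longrightarrow> v = 0\<^sub>v m"
proof -
  show "(v + w) + (v - w) = 2 \<cdot>\<^sub>v v" "(v + w) - (v - w) = 2 \<cdot>\<^sub>v w"
    "(1 / 2) \<cdot>\<^sub>v (v + w) + (1 / 2) \<cdot>\<^sub>v (v - w) = v" "(1 / 2) \<cdot>\<^sub>v (v + w) - (1 / 2) \<cdot>\<^sub>v (v - w) = w"
    using assms by (auto intro!: eq_vecI simp: field_simps)
  assume e: "v - w = (- 1) \<cdot>\<^sub>v (v + w)"
  show "v = 0\<^sub>v m"
  proof (intro eq_vecI)
    fix i assume "i < dim_vec (0\<^sub>v m :: complex vec)"
    hence i: "i < m" by simp
    have "(v - w) $ i = ((- 1) \<cdot>\<^sub>v (v + w)) $ i" by (simp only: e)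
    hence "v $ i - w $ i = - (v $ i + w $ i)" using i assms by simp
    thus "v $ i = 0\<^sub>v m $ i" using i by simp
  qed (use assms in auto)
qed

text \<open>The four blocks in the upper half of \<open>M_mat\<close>. They realize the Cayley transform of the function that
\<open>(A, B, C, D)\<close> realizes.\<close>

definition cayley_A :: "nat \<Rightarrow> complex mat \<Rightarrow> complex mat \<Rightarrow> complex mat \<Rightarrow> complex mat \<Rightarrow> complex mat" where
  "cayley_A m A B C D = A - B * inv_mat (1\<^sub>m m + D) * C"

definition cayley_B :: "nat \<Rightarrow> complex mat \<Rightarrow> complex mat \<Rightarrow> complex mat" where
  "cayley_B m B D = (- complex_of_real (sqrt 2)) \<cdot>\<^sub>m (B * inv_mat (1\<^sub>m m + D))"

definition cayley_C :: "nat \<Rightarrow> complex mat \<Rightarrow> complex mat \<Rightarrow> complex mat" where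
  "cayley_C m C D = complex_of_real (sqrt 2) \<cdot>\<^sub>m (inv_mat (1\<^sub>m m + D) * C)"

definition cayley_D :: "nat \<Rightarrow> complex mat \<Rightarrow> complex mat" where
  "cayley_D m D = inv_mat (1\<^sub>m m + D) * (1\<^sub>m m - D)"

lemma polynomial_fraction_coprime:
  fixes p q :: "complex poly"
  assumes q: "q \<noteq> 0"
  shows "\<exists>p' q'. q' \<noteq> 0 \<and> coprime p' q' \<and> (\<forall>s. poly q s \<noteq> 0 \<longrightarrow> poly q' s \<noteq> 0 \<and> poly p s / poly q s = poly p' s / poly q' s)"
  using q
proof (induction "degree q" arbitrary: p q rule: less_induct)
  case less
  show ?case
  proof (cases "coprime p q")
    case True
    thus ?thesis using less.prems by blast
  next
    case False
    then obtain d where d: "d dvd p" "d dvd q" "\<not> is_unit d" by (rule not_coprimeE)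
    obtain p1 q1 where pq: "p = d * p1" "q = d * q1" using d(1,2) by (auto elim!: dvdE)
    have nz: "d \<noteq> 0" "q1 \<noteq> 0" using less.prems pq by auto
    have "degree d \<noteq> 0" using d(3) nz by (simp add: is_unit_iff_degree)
    hence "degree q1 < degree q" unfolding pq(2) using nz by (simp add: degree_mult_eq)
    from less.hyps[OF this nz(2), of p1] show ?thesis unfolding pq by auto
  qed
qed

context
  fixes m n :: nat and F :: "complex \<Rightarrow> complex mat" and A B C D :: "complex mat" and \<eta> :: ereal
  assumes rat: "rational_matrix m F"
    and min: "minimal_realization m n F A B C D"
    and spD: "- 1 \<notin> spectrum D"
    and eta: "1 < \<eta>"
begin

abbreviation "R0 \<equiv> inv_mat (1\<^sub>m m + D)"
abbreviation "Ah \<equiv> cayley_A m A B C D"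
abbreviation "Bh \<equiv> cayley_B m B D"
abbreviation "Ch \<equiv> cayley_C m C D"
abbreviation "Dh \<equiv> cayley_D m D"
abbreviation "G0 s \<equiv> Ch * resolvent_mat n Ah s * Bh + Dh"
abbreviation "root2 \<equiv> complex_of_real (sqrt 2)"

lemma abcd_carrier: "A \<in> cmat n n" "B \<in> cmat n m" "C \<in> cmat m n" "D \<in> cmat m m"
  by (rule realization_carrier[OF min])+

lemma root2: "root2 \<noteq> 0" "root2 * root2 = 2" "root2 * (root2 * z) = 2 * z"
proof -
  show "root2 \<noteq> 0" by simp
  show r: "root2 * root2 = 2" by (simp flip: of_real_mult)
  show "root2 * (root2 * z) = 2 * z" using r by (simp add: mult.assoc[symmetric] del: of_real_mult)
qed

lemmas R0_props = one_plus_inv[OF abcd_carrier(4) spD]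

lemma R0_carrier_vec: "v \<in> cvec m \<Longrightarrow> R0 *\<^sub>v v \<in> cvec m"
  using R0_props(1) by auto

lemma hat_carrier: "Ah \<in> cmat n n" "Bh \<in> cmat n m" "Ch \<in> cmat m n" "Dh \<in> cmat m m"
proof -
  have BR: "B * R0 \<in> cmat n m" "B * R0 * C \<in> cmat n n" "R0 * C \<in> cmat m n"
    using abcd_carrier R0_props(1) by auto
  have ID: "1\<^sub>m m - D \<in> cmat m m" using abcd_carrier by (metis minus_carrier_mat)
  show "Ah \<in> cmat n n" unfolding cayley_A_def using BR by (metis minus_carrier_mat)
  show "Bh \<in> cmat n m" "Ch \<in> cmat m n" unfolding cayley_B_def cayley_C_def using BR by auto
  show "Dh \<in> cmat m m" unfolding cayley_D_def using R0_props(1) ID by auto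
qed

lemma hat_vec:
  assumes x: "x \<in> cvec n" and u: "u \<in> cvec m"
  shows "Ah *\<^sub>v x = A *\<^sub>v x - B *\<^sub>v (R0 *\<^sub>v (C *\<^sub>v x))"
    "Bh *\<^sub>v u = (- root2) \<cdot>\<^sub>v (B *\<^sub>v (R0 *\<^sub>v u))"
    "Ch *\<^sub>v x = root2 \<cdot>\<^sub>v (R0 *\<^sub>v (C *\<^sub>v x))"
    "Dh *\<^sub>v u = 2 \<cdot>\<^sub>v (R0 *\<^sub>v u) - u"
proof -
  have BR: "B * R0 \<in> cmat n m" "B * R0 * C \<in> cmat n n" "R0 * C \<in> cmat m n"
    using abcd_carrier R0_props(1) by auto
  have ID: "1\<^sub>m m - D \<in> cmat m m" using abcd_carrier by (metis minus_carrier_mat)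
  have c: "C *\<^sub>v x \<in> cvec m" "D *\<^sub>v u \<in> cvec m" "R0 *\<^sub>v u \<in> cvec m" "R0 *\<^sub>v (D *\<^sub>v u) \<in> cvec m"
    using abcd_carrier R0_props(1) x u by auto
  show "Ah *\<^sub>v x = A *\<^sub>v x - B *\<^sub>v (R0 *\<^sub>v (C *\<^sub>v x))"
    unfolding cayley_A_def minus_mult_distrib_mat_vec[OF abcd_carrier(1) BR(2) x]
    using assoc_mult_mat_vec[OF BR(1) abcd_carrier(3) x] assoc_mult_mat_vec[OF abcd_carrier(2) R0_props(1) c(1)] by simp
  have sm: "(a \<cdot>\<^sub>m X) *\<^sub>v v = a \<cdot>\<^sub>v (X *\<^sub>v v)" if "X \<in> cmat p q" "v \<in> cvec q" for a :: complex and X p q v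
    using that by (intro eq_vecI) auto
  show "Bh *\<^sub>v u = (- root2) \<cdot>\<^sub>v (B *\<^sub>v (R0 *\<^sub>v u))"
    unfolding cayley_B_def sm[OF BR(1) u] using assoc_mult_mat_vec[OF abcd_carrier(2) R0_props(1) u] by simp
  show "Ch *\<^sub>v x = root2 \<cdot>\<^sub>v (R0 *\<^sub>v (C *\<^sub>v x))"
    unfolding cayley_C_def sm[OF BR(3) x] using assoc_mult_mat_vec[OF R0_props(1) abcd_carrier(3) x] by simp
  have "u = R0 *\<^sub>v u + R0 *\<^sub>v (D *\<^sub>v u)"
    using R0_props(2)[OF u] mult_add_distrib_mat_vec[OF R0_props(1) u c(2)] by simp
  hence e: "(R0 *\<^sub>v u) $ i + (R0 *\<^sub>v (D *\<^sub>v u)) $ i = u $ i" if "i < m" for i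
    using that c by (metis carrier_vecD index_add_vec(1))
  have "Dh *\<^sub>v u = R0 *\<^sub>v (u - D *\<^sub>v u)"
    unfolding cayley_D_def using assoc_mult_mat_vec[OF R0_props(1) ID u] minus_mult_distrib_mat_vec[OF one_carrier_mat abcd_carrier(4) u] u by simp
  also have "\<dots> = R0 *\<^sub>v u - R0 *\<^sub>v (D *\<^sub>v u)" by (rule mult_minus_distrib_mat_vec[OF R0_props(1) u c(2)])
  also have "\<dots> = 2 \<cdot>\<^sub>v (R0 *\<^sub>v u) - u"
  proof (intro eq_vecI)
    fix i assume "i < dim_vec (2 \<cdot>\<^sub>v (R0 *\<^sub>v u) - u)"
    hence i: "i < m" using u by simp
    have "(R0 *\<^sub>v u - R0 *\<^sub>v (D *\<^sub>v u)) $ i = (R0 *\<^sub>v u) $ i - (R0 *\<^sub>v (D *\<^sub>v u)) $ i" using i c by (metis carrier_vecD index_minus_vec(1))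
    also have "\<dots> = 2 * (R0 *\<^sub>v u) $ i - u $ i" using e[OF i] by (simp add: algebra_simps)
    also have "\<dots> = (2 \<cdot>\<^sub>v (R0 *\<^sub>v u) - u) $ i" using i c u by (metis carrier_vecD index_minus_vec(1) index_smult_vec(1))
    finally show "(R0 *\<^sub>v u - R0 *\<^sub>v (D *\<^sub>v u)) $ i = (2 \<cdot>\<^sub>v (R0 *\<^sub>v u) - u) $ i" .
  qed (use c u R0_props(1) in auto)
  finally show "Dh *\<^sub>v u = 2 \<cdot>\<^sub>v (R0 *\<^sub>v u) - u" .
qed

text \<open>The Cayley transform exchanges port variables for wave variables: if the original system maps the
input \<open>f\<close> to the output \<open>h\<close>, the transformed one maps \<open>- (f + h) / \<surd>2\<close> to \<open>- (f - h) / \<surd>2\<close> along the same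
state trajectory.\<close>

lemma hat_signals:
  assumes x: "x \<in> cvec n" and f: "f \<in> cvec m"
  defines "h \<equiv> C *\<^sub>v x + D *\<^sub>v f"
  defines "u \<equiv> (- 1 / root2) \<cdot>\<^sub>v (f + h)"
  shows "u \<in> cvec m" "Ah *\<^sub>v x + Bh *\<^sub>v u = A *\<^sub>v x + B *\<^sub>v f" "Ch *\<^sub>v x + Dh *\<^sub>v u = (- 1 / root2) \<cdot>\<^sub>v (f - h)"
proof -
  have c: "C *\<^sub>v x \<in> cvec m" "D *\<^sub>v f \<in> cvec m" using abcd_carrier x f by auto
  define g where "g = R0 *\<^sub>v (C *\<^sub>v x)"
  have g: "g \<in> cvec m" unfolding g_def using R0_carrier_vec[OF c(1)] .
  have h: "h \<in> cvec m" unfolding h_def using c by auto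
  have w: "f + h \<in> cvec m" using f h by auto
  show u: "u \<in> cvec m" unfolding u_def using w by auto
  have "f + (a + b) = (f + b) + a" if "a \<in> cvec m" "b \<in> cvec m" for a b
    using that f by (intro eq_vecI) auto
  from this[OF c] have "f + h = (f + D *\<^sub>v f) + C *\<^sub>v x" unfolding h_def .
  hence "R0 *\<^sub>v (f + h) = f + g"
    using mult_add_distrib_mat_vec[OF R0_props(1), of "f + D *\<^sub>v f" "C *\<^sub>v x"] R0_props(2)[OF f] f c unfolding g_def by simp
  hence Ru: "R0 *\<^sub>v u = (- 1 / root2) \<cdot>\<^sub>v (f + g)" unfolding u_def mult_mat_vec[OF R0_props(1) w] by simp
  have fg: "f + g \<in> cvec m" using f g by auto
  have BRu: "B *\<^sub>v (R0 *\<^sub>v u) = (- 1 / root2) \<cdot>\<^sub>v (B *\<^sub>v f + B *\<^sub>v g)"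
    unfolding Ru mult_mat_vec[OF abcd_carrier(2) fg] mult_add_distrib_mat_vec[OF abcd_carrier(2) f g] ..
  have Bc: "A *\<^sub>v x \<in> cvec n" "B *\<^sub>v f \<in> cvec n" "B *\<^sub>v g \<in> cvec n" using abcd_carrier x f g by auto
  have vec1: "(a - b) + (- root2) \<cdot>\<^sub>v ((- 1 / root2) \<cdot>\<^sub>v (d + b)) = a + d"
    if "a \<in> cvec n" "b \<in> cvec n" "d \<in> cvec n" for a b d
    using that by (intro eq_vecI) auto
  show "Ah *\<^sub>v x + Bh *\<^sub>v u = A *\<^sub>v x + B *\<^sub>v f"
    unfolding hat_vec[OF x u] BRu g_def[symmetric] by (rule vec1[OF Bc(1,3,2)])
  show "Ch *\<^sub>v x + Dh *\<^sub>v u = (- 1 / root2) \<cdot>\<^sub>v (f - h)"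
    unfolding hat_vec[OF x u] Ru g_def[symmetric]
  proof (intro eq_vecI)
    fix i assume "i < dim_vec ((- 1 / root2) \<cdot>\<^sub>v (f - h))"
    hence i: "i < m" using h by simp
    have "root2 * g $ i + (2 * ((- 1 / root2) * (f $ i + g $ i)) - (- 1 / root2) * (f $ i + h $ i)) = (- 1 / root2) * (f $ i - h $ i)"
      using root2 by (simp add: field_simps)
    thus "(root2 \<cdot>\<^sub>v g + (2 \<cdot>\<^sub>v ((- 1 / root2) \<cdot>\<^sub>v (f + g)) - u)) $ i = ((- 1 / root2) \<cdot>\<^sub>v (f - h)) $ i"
      using i f g h unfolding u_def by simp
  qed (use f g h u in auto)
qed

text \<open>In matrix terms \<open>(1 + G0 s) * (1 + F s) = 2\<close>, the relation of which the Cayley transform is the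
solution in either direction.\<close>

lemma cayley_transfer:
  assumes s: "s \<notin> spectrum A" "s \<notin> spectrum Ah" and f: "f \<in> cvec m"
  shows "G0 s *\<^sub>v (f + F s *\<^sub>v f) = f - F s *\<^sub>v f"
proof -
  define x where "x = resolvent_mat n A s *\<^sub>v (B *\<^sub>v f)"
  have Bf: "B *\<^sub>v f \<in> cvec n" using abcd_carrier f by auto
  note rx = resolvent_vec[OF abcd_carrier(1) s(1) Bf, folded x_def]
  have Ff: "F s *\<^sub>v f = C *\<^sub>v x + D *\<^sub>v f"
    unfolding realization_carrier(5)[OF min s(1)] x_def by (rule transfer_mult_vec[OF abcd_carrier s(1) f])
  define u where "u = (- 1 / root2) \<cdot>\<^sub>v (f + F s *\<^sub>v f)"
  note hs = hat_signals[OF rx(1) f, folded Ff, folded u_def]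
  have h: "F s *\<^sub>v f \<in> cvec m" unfolding Ff using abcd_carrier rx f by auto
  have Bu: "Bh *\<^sub>v u \<in> cvec n" using hat_carrier hs(1) by auto
  have xu: "x = resolvent_mat n Ah s *\<^sub>v (Bh *\<^sub>v u)"
    by (rule resolvent_unique[OF hat_carrier(1) s(2) Bu rx(1)]) (simp add: rx(2) hs(2))
  have Gu: "G0 s *\<^sub>v u = (- 1 / root2) \<cdot>\<^sub>v (f - F s *\<^sub>v f)"
    unfolding transfer_mult_vec[OF hat_carrier s(2) hs(1)] xu[symmetric] by (rule hs(3))
  have G: "G0 s \<in> cmat m m" using resolvent(1)[OF hat_carrier(1) s(2)] hat_carrier by auto
  have "f + F s *\<^sub>v f = (- root2) \<cdot>\<^sub>v u" unfolding u_def using f h by (intro eq_vecI) auto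
  hence "G0 s *\<^sub>v (f + F s *\<^sub>v f) = (- root2) \<cdot>\<^sub>v (G0 s *\<^sub>v u)" using mult_mat_vec[OF G hs(1)] by simp
  also have "\<dots> = f - F s *\<^sub>v f" unfolding Gu using f h by (intro eq_vecI) auto
  finally show ?thesis .
qed

lemma G0_carrier: "s \<notin> spectrum Ah \<Longrightarrow> G0 s \<in> cmat m m"
  using resolvent(1)[OF hat_carrier(1)] hat_carrier by auto

lemma F_carrier: "F s \<in> cmat m m"
  using rat unfolding rational_matrix_def by auto

lemma cayley_eq_imp:
  assumes s: "s \<notin> spectrum A" "s \<notin> spectrum Ah" and X: "X \<in> cmat m m" "- 1 \<notin> spectrum X"
    and FX: "F s = cayley m X"
  shows "X = G0 s"
proof (rule mat_eq_vecI[OF X(1) G0_carrier[OF s(2)]])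
  fix e :: "complex vec" assume e: "e \<in> cvec m"
  note I = one_plus_inv[OF X]
  have Xe: "X *\<^sub>v e \<in> cvec m" using X e by auto
  have IX: "1\<^sub>m m - X \<in> cmat m m" using X by (metis minus_carrier_mat)
  define f where "f = e + X *\<^sub>v e"
  have f: "f \<in> cvec m" unfolding f_def using e Xe by auto
  have "F s *\<^sub>v f = (1\<^sub>m m - X) *\<^sub>v e"
    unfolding FX cayley_def assoc_mult_mat_vec[OF IX I(1) f] using I(2)[OF e] f_def by simp
  also have "\<dots> = e - X *\<^sub>v e" using minus_mult_distrib_mat_vec[OF one_carrier_mat X(1) e] e by simp
  finally have h: "F s *\<^sub>v f = e - X *\<^sub>v e" .
  have "f + F s *\<^sub>v f = 2 \<cdot>\<^sub>v e" "f - F s *\<^sub>v f = 2 \<cdot>\<^sub>v (X *\<^sub>v e)"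
    unfolding h unfolding f_def by (rule vec_sum_diff[OF e Xe])+
  with cayley_transfer[OF s f] have "G0 s *\<^sub>v (2 \<cdot>\<^sub>v e) = 2 \<cdot>\<^sub>v (X *\<^sub>v e)" by simp
  hence eq: "2 \<cdot>\<^sub>v (G0 s *\<^sub>v e) = 2 \<cdot>\<^sub>v (X *\<^sub>v e)" using mult_mat_vec[OF G0_carrier[OF s(2)] e] by simp
  have Ge: "G0 s *\<^sub>v e \<in> cvec m" using G0_carrier[OF s(2)] e by (metis mult_mat_vec_carrier)
  have cancel: "v = w" if "2 \<cdot>\<^sub>v v = 2 \<cdot>\<^sub>v w" "v \<in> cvec m" "w \<in> cvec m" for v w :: "complex vec"
  proof (intro eq_vecI)
    fix i assume "i < dim_vec w"
    hence i: "i < m" using that by simp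
    have "(2 \<cdot>\<^sub>v v) $ i = (2 \<cdot>\<^sub>v w) $ i" using that(1) by simp
    thus "v $ i = w $ i" using i that(2,3) by simp
  qed (use that in auto)
  from cancel[OF eq Ge Xe] show "X *\<^sub>v e = G0 s *\<^sub>v e" by simp
qed

lemma G0_cayley:
  assumes s: "s \<notin> spectrum A" "s \<notin> spectrum Ah"
  shows "- 1 \<notin> spectrum (G0 s)" "F s = cayley m (G0 s)"
proof -
  note Gc = G0_carrier[OF s(2)]
  have P: "1\<^sub>m m + F s \<in> cmat m m" using F_carrier by auto
  have Pv: "(1\<^sub>m m + F s) *\<^sub>v v = v + F s *\<^sub>v v" if "v \<in> cvec m" for v
    using add_mult_distrib_mat_vec[OF one_carrier_mat F_carrier that] that by simp
  have half: "f = 0\<^sub>v m" if f: "f \<in> cvec m" and "f - F s *\<^sub>v f = (- 1) \<cdot>\<^sub>v (f + F s *\<^sub>v f)" for f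
  proof -
    have "F s *\<^sub>v f \<in> cvec m" using F_carrier f by (metis mult_mat_vec_carrier)
    from vec_sum_diff(5)[OF f this that(2)] show ?thesis .
  qed
  have inj: "v = 0\<^sub>v m" if v: "v \<in> cvec m" "(1\<^sub>m m + F s) *\<^sub>v v = 0\<^sub>v m" for v
  proof (rule half[OF v(1)])
    have e: "v + F s *\<^sub>v v = 0\<^sub>v m" using Pv v by simp
    have "v - F s *\<^sub>v v = 0\<^sub>v m" using cayley_transfer[OF s v(1)] mult_mat_vec_zero[OF Gc] unfolding e by simp
    moreover have "(- 1) \<cdot>\<^sub>v 0\<^sub>v m = (0\<^sub>v m :: complex vec)" by (intro eq_vecI) auto
    ultimately show "v - F s *\<^sub>v v = (- 1) \<cdot>\<^sub>v (v + F s *\<^sub>v v)" unfolding e by simp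
  qed
  show sp: "- 1 \<notin> spectrum (G0 s)"
  proof
    assume "- 1 \<in> spectrum (G0 s)"
    then obtain v where v: "v \<in> cvec m" "v \<noteq> 0\<^sub>v m" "G0 s *\<^sub>v v = (- 1) \<cdot>\<^sub>v v" using spectrum_iff[OF Gc] by auto
    obtain f where f: "f \<in> cvec m" "(1\<^sub>m m + F s) *\<^sub>v f = v" using square_inj_surj[OF P inj v(1)] by auto
    have vf: "v = f + F s *\<^sub>v f" using f Pv by simp
    have "f = 0\<^sub>v m" using half[OF f(1)] cayley_transfer[OF s f(1)] v(3) unfolding vf by simp
    thus False using v(2) f(2) mult_mat_vec_zero[OF P] by simp
  qed
  note I = one_plus_inv[OF Gc sp]
  have IG: "1\<^sub>m m - G0 s \<in> cmat m m" using Gc by (metis minus_carrier_mat)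
  show "F s = cayley m (G0 s)"
  proof (rule mat_eq_vecI[OF F_carrier])
    show "cayley m (G0 s) \<in> cmat m m" unfolding cayley_def using IG I(1) by (metis mult_carrier_mat)
    fix f :: "complex vec" assume f: "f \<in> cvec m"
    define h where "h = F s *\<^sub>v f"
    have h: "h \<in> cvec m" unfolding h_def using F_carrier f by (metis mult_mat_vec_carrier)
    define w where "w = (1 / 2) \<cdot>\<^sub>v (f + h)"
    have w: "w \<in> cvec m" unfolding w_def using f h by auto
    have "G0 s *\<^sub>v w = (1 / 2) \<cdot>\<^sub>v (f - h)"
      unfolding w_def using mult_mat_vec[OF Gc, of "f + h" "1 / 2"] cayley_transfer[OF s f] f h unfolding h_def by simp
    hence Gw: "w + G0 s *\<^sub>v w = f" "w - G0 s *\<^sub>v w = h"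
      unfolding w_def using vec_sum_diff(3,4)[OF f h] by simp_all
    have "cayley m (G0 s) *\<^sub>v f = (1\<^sub>m m - G0 s) *\<^sub>v w"
      unfolding cayley_def assoc_mult_mat_vec[OF IG I(1) f] using I(2)[OF w] Gw(1) by simp
    also have "\<dots> = h" using minus_mult_distrib_mat_vec[OF one_carrier_mat Gc w] Gw(2) w by simp
    finally show "F s *\<^sub>v f = cayley m (G0 s) *\<^sub>v f" unfolding h_def by simp
  qed
qed

abbreviation "lmi H \<equiv> adj (M_mat m n A B C D) * W_mat m n \<eta> H * M_mat m n A B C D"

lemma M_mat_hat: "M_mat m n A B C D = four_block_mat Ah Bh Ch Dh @\<^sub>r four_block_mat (1\<^sub>m n) (0\<^sub>m n m) (0\<^sub>m m n) (1\<^sub>m m)"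
  unfolding M_mat_def Let_def cayley_A_def cayley_B_def cayley_C_def cayley_D_def ..

lemma M_mat_carrier: "M_mat m n A B C D \<in> cmat ((n + m) + (n + m)) (n + m)"
  unfolding M_mat_hat using hat_carrier by (intro carrier_append_rows four_block_carrier_mat) auto

lemma M_mat_vec:
  assumes x: "x \<in> cvec n" and u: "u \<in> cvec m"
  shows "M_mat m n A B C D *\<^sub>v (x @\<^sub>v u) = ((Ah *\<^sub>v x + Bh *\<^sub>v u) @\<^sub>v (Ch *\<^sub>v x + Dh *\<^sub>v u)) @\<^sub>v (x @\<^sub>v u)"
proof -
  have c: "four_block_mat Ah Bh Ch Dh \<in> cmat (n + m) (n + m)"
    "four_block_mat (1\<^sub>m n) (0\<^sub>m n m) (0\<^sub>m m n) (1\<^sub>m m :: complex mat) \<in> cmat (n + m) (n + m)"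
    using hat_carrier by (auto intro!: four_block_carrier_mat)
  have xu: "x @\<^sub>v u \<in> cvec (n + m)" using x u by auto
  have "four_block_mat (1\<^sub>m n) (0\<^sub>m n m) (0\<^sub>m m n) (1\<^sub>m m) *\<^sub>v (x @\<^sub>v u) = x @\<^sub>v u" using xu by simp
  thus ?thesis unfolding M_mat_hat mat_mult_append[OF c xu] four_block_mat_mult_vec[OF hat_carrier x u] by simp
qed

lemma lmi_carrier_hermitian:
  assumes H: "H \<in> cmat n n" "adj H = H"
  shows "lmi H \<in> cmat (n + m) (n + m)" "adj (lmi H) = lmi H"
proof -
  note M = M_mat_carrier and W = W_mat_carrier[OF H(1), of m \<eta>]
  have Ma: "adj (M_mat m n A B C D) \<in> cmat (n + m) ((n + m) + (n + m))" using M by simp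
  have MW: "adj (M_mat m n A B C D) * W_mat m n \<eta> H \<in> cmat (n + m) ((n + m) + (n + m))" using Ma W by auto
  show "lmi H \<in> cmat (n + m) (n + m)" using MW M by auto
  show "adj (lmi H) = lmi H"
    unfolding mat_adjoint_mult[OF MW M] mat_adjoint_mult[OF Ma W] W_mat_hermitian[OF H] mat_adjoint_adjoint
    by (rule assoc_mult_mat[OF Ma W M, symmetric])
qed

text \<open>The matrix inequality is the statement that \<open>qform H\<close> is a storage function for the supply rate
\<open>sq_norm u - eta_ratio \<eta> * sq_norm y\<close>.\<close>

lemma lmi_form:
  assumes H: "H \<in> cmat n n" "adj H = H" and x: "x \<in> cvec n" and u: "u \<in> cvec m"
  shows "Re ((lmi H *\<^sub>v (x @\<^sub>v u)) \<bullet>c (x @\<^sub>v u)) =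
    sq_norm u - eta_ratio \<eta> * sq_norm (Ch *\<^sub>v x + Dh *\<^sub>v u) - 2 * Re ((H *\<^sub>v x) \<bullet>c (Ah *\<^sub>v x + Bh *\<^sub>v u))"
proof -
  note M = M_mat_carrier and W = W_mat_carrier[OF H(1), of m \<eta>]
  have Ma: "adj (M_mat m n A B C D) \<in> cmat (n + m) ((n + m) + (n + m))" using M by simp
  have MW: "adj (M_mat m n A B C D) * W_mat m n \<eta> H \<in> cmat (n + m) ((n + m) + (n + m))" using Ma W by auto
  have xu: "x @\<^sub>v u \<in> cvec (n + m)" using x u by auto
  define z where "z = M_mat m n A B C D *\<^sub>v (x @\<^sub>v u)"
  have z: "z \<in> cvec ((n + m) + (n + m))" unfolding z_def using M xu by (metis mult_mat_vec_carrier)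
  have Wz: "W_mat m n \<eta> H *\<^sub>v z \<in> cvec ((n + m) + (n + m))" using W z by (metis mult_mat_vec_carrier)
  have "lmi H *\<^sub>v (x @\<^sub>v u) = adj (M_mat m n A B C D) *\<^sub>v (W_mat m n \<eta> H *\<^sub>v z)"
    unfolding assoc_mult_mat_vec[OF MW M xu] z_def[symmetric] by (rule assoc_mult_mat_vec[OF Ma W z])
  hence "(lmi H *\<^sub>v (x @\<^sub>v u)) \<bullet>c (x @\<^sub>v u) = (W_mat m n \<eta> H *\<^sub>v z) \<bullet>c z"
    using cscalar_adjoint2[OF M Wz xu] unfolding z_def[symmetric] by simp
  moreover have "Ah *\<^sub>v x + Bh *\<^sub>v u \<in> cvec n" "Ch *\<^sub>v x + Dh *\<^sub>v u \<in> cvec m" using hat_carrier x u by auto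
  ultimately show ?thesis
    unfolding z_def M_mat_vec[OF x u] using W_mat_form[OF H _ _ x u] eta_ratio_facts(2)[OF eta] by simp
qed

lemma split_vec:
  fixes z :: "complex vec"
  assumes "z \<in> cvec (n + m)"
  shows "\<exists>x \<in> cvec n. \<exists>u \<in> cvec m. z = x @\<^sub>v u"
  using vec_first_last_append[OF assms] by (metis vec_first_carrier vec_last_carrier)

section \<open>The two implications\<close>

text \<open>At the state \<open>x\<close> with \<open>s \<cdot>\<^sub>v x = Ah *\<^sub>v x + Bh *\<^sub>v u\<close> the stored term is \<open>2 * Re s * qform H x \<ge> 0\<close>, which
makes \<open>G0 s\<close> contractive. The same computation at an eigenvector with \<open>u = 0\<close> keeps the spectrum of \<open>Ah\<close>
out of the right half plane. The function in \<open>HB\<close> is \<open>G0\<close> with its entries written as reduced fractions, so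
that it also has the correct values at eigenvalues of \<open>Ah\<close> which are not poles.\<close>

lemma lmi_imp_HP:
  assumes H: "pos_def n H" and L: "pos_semidef (n + m) (lmi H)"
  shows "F \<in> HP m \<eta>"
proof -
  have Hc: "H \<in> cmat n n" "adj H = H" and Hp: "\<And>v. v \<in> cvec n \<Longrightarrow> v \<noteq> 0\<^sub>v n \<Longrightarrow> 0 < qform H v"
    using H unfolding pos_def_def by auto
  have Hn: "0 \<le> qform H v" if "v \<in> cvec n" for v
    using Hp[OF that] mult_mat_vec_zero[OF Hc(1)] by (cases "v = 0\<^sub>v n") (auto intro: less_imp_le)
  have Hr: "(H *\<^sub>v v) \<bullet>c v = of_real (qform H v)" if "v \<in> cvec n" for v
    using hermitian_cscalar_cnj[OF Hc that that] by (metis Reals_cnj_iff of_real_Re)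
  note hc = hat_carrier
  note k = eta_ratio_facts(1)[OF eta]
  have diss: "2 * Re ((H *\<^sub>v x) \<bullet>c (Ah *\<^sub>v x + Bh *\<^sub>v u)) \<le> sq_norm u - eta_ratio \<eta> * sq_norm (Ch *\<^sub>v x + Dh *\<^sub>v u)"
    if x: "x \<in> cvec n" and u: "u \<in> cvec m" for x u
  proof -
    have "x @\<^sub>v u \<in> cvec (n + m)" using x u by auto
    from pos_semidefD(3)[OF L this] show ?thesis unfolding lmi_form[OF Hc x u] by simp
  qed
  have stable: "s \<notin> spectrum Ah" if s: "0 < Re s" for s
  proof
    assume "s \<in> spectrum Ah"
    then obtain v where v: "v \<in> cvec n" "v \<noteq> 0\<^sub>v n" "Ah *\<^sub>v v = s \<cdot>\<^sub>v v" using spectrum_iff[OF hc(1)] by auto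
    have Hv: "H *\<^sub>v v \<in> cvec n" using Hc v by auto
    have e: "Ah *\<^sub>v v + Bh *\<^sub>v 0\<^sub>v m = s \<cdot>\<^sub>v v" "Ch *\<^sub>v v + Dh *\<^sub>v 0\<^sub>v m = Ch *\<^sub>v v"
      using mult_mat_vec_zero[OF hc(2)] mult_mat_vec_zero[OF hc(4)] v hc by auto
    have "2 * Re (cnj s * ((H *\<^sub>v v) \<bullet>c v)) \<le> 0"
      using diss[OF v(1) zero_carrier_vec] cscalar_smult_right[OF v(1) Hv] k
        cscalar_self_Re(2)[of "Ch *\<^sub>v v" m] hc v(1) unfolding e
      by (smt (verit) cscalar_zero(1) mult_mat_vec_carrier mult_nonneg_nonneg zero_carrier_vec zero_complex.sel(1))
    hence "Re s * qform H v \<le> 0" by (subst (asm) Hr[OF v(1)]) simp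
    moreover have "0 < Re s * qform H v" using s Hp[OF v(1,2)] by simp
    ultimately show False by simp
  qed
  have contr: "eta_ratio \<eta> * sq_norm (G0 s *\<^sub>v u) \<le> sq_norm u" if s: "0 < Re s" and u: "u \<in> cvec m" for s u
  proof -
    have Bu: "Bh *\<^sub>v u \<in> cvec n" using hc u by auto
    define x where "x = resolvent_mat n Ah s *\<^sub>v (Bh *\<^sub>v u)"
    note rx = resolvent_vec[OF hc(1) stable[OF s] Bu, folded x_def]
    have Gu: "G0 s *\<^sub>v u = Ch *\<^sub>v x + Dh *\<^sub>v u" unfolding x_def by (rule transfer_mult_vec[OF hc stable[OF s] u])
    have Hx: "H *\<^sub>v x \<in> cvec n" using Hc rx by auto
    have "0 \<le> 2 * (Re s * qform H x)" using s Hn[OF rx(1)] by simp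
    also have "\<dots> = 2 * Re (cnj s * ((H *\<^sub>v x) \<bullet>c x))" by (subst (2) Hr[OF rx(1)]) simp
    also have "\<dots> = 2 * Re ((H *\<^sub>v x) \<bullet>c (Ah *\<^sub>v x + Bh *\<^sub>v u))"
      unfolding rx(2)[symmetric] cscalar_smult_right[OF rx(1) Hx] ..
    also have "\<dots> \<le> sq_norm u - eta_ratio \<eta> * sq_norm (G0 s *\<^sub>v u)" unfolding Gu by (rule diss[OF rx(1) u])
    finally show ?thesis by simp
  qed
  have "\<exists>p q. i < m \<longrightarrow> j < m \<longrightarrow> q \<noteq> 0 \<and> coprime p q \<and> (\<forall>s. s \<notin> spectrum Ah \<longrightarrow> poly q s \<noteq> 0 \<and> G0 s $$ (i, j) = poly p s / poly q s)" for i j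
  proof (cases "i < m \<and> j < m")
    case True
    obtain p0 where p0: "\<And>s. s \<notin> spectrum Ah \<Longrightarrow> poly (char_poly Ah) s * G0 s $$ (i, j) = poly p0 s"
      using realization_entry_rational[OF hc] True by blast
    have chi: "char_poly Ah \<noteq> 0" using degree_monic_char_poly[OF hc(1)] by auto
    obtain p q where pq: "q \<noteq> 0" "coprime p q"
      "\<And>s. poly (char_poly Ah) s \<noteq> 0 \<Longrightarrow> poly q s \<noteq> 0 \<and> poly p0 s / poly (char_poly Ah) s = poly p s / poly q s"
      using polynomial_fraction_coprime[OF chi, of p0] by auto
    have "poly q s \<noteq> 0 \<and> G0 s $$ (i, j) = poly p s / poly q s" if s: "s \<notin> spectrum Ah" for s
    proof -
      have nz: "poly (char_poly Ah) s \<noteq> 0" using s spectrum_root_char_poly[OF hc(1)] by auto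
      have "G0 s $$ (i, j) = poly p0 s / poly (char_poly Ah) s" using p0[OF s] nz by (simp add: field_simps)
      thus ?thesis using pq(3)[OF nz] by simp
    qed
    thus ?thesis using pq by blast
  qed auto
  then obtain p q where pq: "\<And>i j. i < m \<Longrightarrow> j < m \<Longrightarrow> q i j \<noteq> 0 \<and> coprime (p i j) (q i j) \<and>
     (\<forall>s. s \<notin> spectrum Ah \<longrightarrow> poly (q i j) s \<noteq> 0 \<and> G0 s $$ (i, j) = poly (p i j) s / poly (q i j) s)" by metis
  define G where "G s = mat m m (\<lambda>(i, j). poly (p i j) s / poly (q i j) s)" for s
  have GG: "G s = G0 s" if s: "s \<notin> spectrum Ah" for s
  proof (intro eq_matI)
    fix i j assume "i < dim_row (G0 s)" "j < dim_col (G0 s)"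
    hence ij: "i < m" "j < m" using G0_carrier[OF s] by auto
    thus "G s $$ (i, j) = G0 s $$ (i, j)" using pq[OF ij] s unfolding G_def by simp
  qed (use G0_carrier[OF s] in \<open>auto simp: G_def\<close>)
  have "G \<in> HB m \<eta>" unfolding HB_def
  proof (intro CollectI conjI ballI)
    show "rational_matrix m G" unfolding rational_matrix_def
    proof (intro conjI allI impI)
      fix s show "G s \<in> cmat m m" unfolding G_def by simp
      fix i j assume ij: "i < m" "j < m"
      show "rational_function (\<lambda>s. G s $$ (i, j))" unfolding rational_function_def G_def
        using pq[OF ij] ij by (intro exI[of _ "p i j"] exI[of _ "q i j"]) simp
    qed
    show "mat_analytic_on m G right_half_plane" unfolding mat_analytic_on_def
    proof (intro allI impI)
      fix i j assume ij: "i < m" "j < m"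
      have an: "poly r analytic_on S" for r :: "complex poly" and S
      proof -
        have "poly r holomorphic_on UNIV"
          unfolding holomorphic_on_def field_differentiable_def using poly_DERIV by blast
        hence "poly r analytic_on UNIV" by (simp add: analytic_on_open)
        thus ?thesis by (rule analytic_on_subset) simp
      qed
      have "(\<lambda>s. poly (p i j) s / poly (q i j) s) analytic_on right_half_plane"
        by (intro analytic_on_divide an) (use pq[OF ij] stable in auto)
      thus "(\<lambda>s. G s $$ (i, j)) analytic_on right_half_plane" unfolding G_def using ij by simp
    qed
    fix s assume "s \<in> right_half_plane"
    hence s: "0 < Re s" by simp
    show "pos_semidef m (1\<^sub>m m - complex_of_real (eta_ratio \<eta>) \<cdot>\<^sub>m (adj (G s) * G s))"
      unfolding GG[OF stable[OF s]] one_minus_gram_pos_semidef[OF G0_carrier[OF stable[OF s]]] using contr[OF s] by auto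
  qed
  moreover have "\<forall>\<^sub>F s in cofinite. - 1 \<notin> spectrum (G s) \<and> F s = cayley m (G s)"
  proof -
    have "{s. \<not> (- 1 \<notin> spectrum (G s) \<and> F s = cayley m (G s))} \<subseteq> spectrum A \<union> spectrum Ah"
    proof
      fix s assume s: "s \<in> {s. \<not> (- 1 \<notin> spectrum (G s) \<and> F s = cayley m (G s))}"
      show "s \<in> spectrum A \<union> spectrum Ah"
      proof (rule ccontr)
        assume "s \<notin> spectrum A \<union> spectrum Ah"
        hence s': "s \<notin> spectrum A" "s \<notin> spectrum Ah" by auto
        show False using s G0_cayley[OF s'] GG[OF s'(2)] by auto
      qed
    qed
    thus ?thesis unfolding eventually_cofinite
      using finite_subset card_finite_spectrum(1)[OF abcd_carrier(1)] card_finite_spectrum(1)[OF hc(1)] by blast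
  qed
  ultimately show ?thesis unfolding HP_def using rat by auto
qed

text \<open>Passing from \<open>A\<close> to \<open>Ah\<close> is an output feedback, which does not affect vectors that \<open>C\<close> annihilates.\<close>

lemma hat_observable:
  assumes w: "w \<in> cvec n" and Aw: "Ah *\<^sub>v w = l \<cdot>\<^sub>v w" and Cw: "Ch *\<^sub>v w = 0\<^sub>v m"
  shows "w = 0\<^sub>v n"
proof -
  have Cw': "C *\<^sub>v w \<in> cvec m" using abcd_carrier w by auto
  define g where "g = R0 *\<^sub>v (C *\<^sub>v w)"
  have g: "g \<in> cvec m" unfolding g_def by (rule R0_carrier_vec[OF Cw'])
  have z: "root2 \<cdot>\<^sub>v g = 0\<^sub>v m" using Cw unfolding hat_vec(3)[OF w zero_carrier_vec] g_def .
  have g0: "g = 0\<^sub>v m" by (rule smult_vec_eq_zero[OF g _ z]) simp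
  have "C *\<^sub>v w = g + D *\<^sub>v g" using R0_props(3)[OF Cw'] unfolding g_def by simp
  hence C0: "C *\<^sub>v w = 0\<^sub>v m" unfolding g0 using mult_mat_vec_zero[OF abcd_carrier(4)] by simp
  have Aw0: "A *\<^sub>v w \<in> cvec n" using abcd_carrier w by auto
  have "Ah *\<^sub>v w = A *\<^sub>v w" unfolding hat_vec(1)[OF w zero_carrier_vec] g_def[symmetric] g0 mult_mat_vec_zero[OF abcd_carrier(2)] using Aw0 by simp
  hence "A *\<^sub>v w = l \<cdot>\<^sub>v w" using Aw by simp
  from minimal_realization_observable[OF min w this C0] show ?thesis .
qed

text \<open>The columns of \<open>B\<close> and \<open>Bh\<close> span the same space, and \<open>A\<close> and \<open>Ah\<close> differ by a matrix with range in it.\<close>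

lemma hat_controllable:
  assumes w: "w \<in> cvec n" and Aw: "adj Ah *\<^sub>v w = l \<cdot>\<^sub>v w" and Bw: "adj Bh *\<^sub>v w = 0\<^sub>v m"
  shows "w = 0\<^sub>v n"
proof -
  note hc = hat_carrier
  have wB: "w \<bullet>c (B *\<^sub>v u) = 0" if u: "u \<in> cvec m" for u
  proof -
    define u' where "u' = (- 1 / root2) \<cdot>\<^sub>v (u + D *\<^sub>v u)"
    have Du: "u + D *\<^sub>v u \<in> cvec m" using abcd_carrier u by auto
    have u': "u' \<in> cvec m" unfolding u'_def using Du by auto
    have Bu: "B *\<^sub>v u \<in> cvec n" using abcd_carrier u by auto
    have "R0 *\<^sub>v u' = (- 1 / root2) \<cdot>\<^sub>v u" unfolding u'_def mult_mat_vec[OF R0_props(1) Du] R0_props(2)[OF u] ..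
    hence "Bh *\<^sub>v u' = (- root2) \<cdot>\<^sub>v ((- 1 / root2) \<cdot>\<^sub>v (B *\<^sub>v u))"
      using hat_vec(2)[OF zero_carrier_vec u'] mult_mat_vec[OF abcd_carrier(2) u] by simp
    also have "\<dots> = B *\<^sub>v u" using Bu by (intro eq_vecI) auto
    finally have "w \<bullet>c (B *\<^sub>v u) = w \<bullet>c (Bh *\<^sub>v u')" by simp
    also have "\<dots> = 0" using cscalar_adjoint2[OF hc(2) w u'] Bw u' by simp
    finally show ?thesis .
  qed
  have Bac: "adj B *\<^sub>v w \<in> cvec m" using abcd_carrier w by (metis mat_adjoint_carrier mult_mat_vec_carrier)
  have Aac: "adj A *\<^sub>v w \<in> cvec n" "adj Ah *\<^sub>v w \<in> cvec n" using abcd_carrier hc w by (metis mat_adjoint_carrier mult_mat_vec_carrier)+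
  have B0: "adj B *\<^sub>v w = 0\<^sub>v m"
    by (rule vec_eq_cscalar[OF Bac zero_carrier_vec]) (use cscalar_adjoint2[OF abcd_carrier(2) w] wB in auto)
  have "adj A *\<^sub>v w = adj Ah *\<^sub>v w"
  proof (rule vec_eq_cscalar[OF Aac])
    fix v :: "complex vec" assume v: "v \<in> cvec n"
    have Cv: "R0 *\<^sub>v (C *\<^sub>v v) \<in> cvec m" using R0_carrier_vec abcd_carrier v by auto
    have Av: "A *\<^sub>v v \<in> cvec n" "B *\<^sub>v (R0 *\<^sub>v (C *\<^sub>v v)) \<in> cvec n" using abcd_carrier v Cv by auto
    have "w \<bullet>c (Ah *\<^sub>v v) = w \<bullet>c (A *\<^sub>v v)"
      unfolding hat_vec(1)[OF v zero_carrier_vec] cscalar_minus_right[OF Av w] wB[OF Cv] by simp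
    thus "(adj A *\<^sub>v w) \<bullet>c v = (adj Ah *\<^sub>v w) \<bullet>c v"
      using cscalar_adjoint2[OF abcd_carrier(1) w v] cscalar_adjoint2[OF hc(1) w v] by simp
  qed
  hence "adj A *\<^sub>v w = l \<cdot>\<^sub>v w" using Aw by simp
  from minimal_realization_controllable[OF min w this B0] show ?thesis .
qed

text \<open>The exceptional set collects the points where \<open>F\<close> is not the pointwise Cayley transform of the function
in \<open>HB\<close> and the points where one of the two realizations has no value.\<close>

lemma HP_contractive:
  assumes HP: "F \<in> HP m \<eta>"
  shows "\<exists>E. finite E \<and> spectrum Ah \<subseteq> E \<and> (\<forall>s u. 0 < Re s \<longrightarrow> s \<notin> E \<longrightarrow> u \<in> cvec m \<longrightarrow>
    eta_ratio \<eta> * sq_norm (G0 s *\<^sub>v u) \<le> sq_norm u)"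
proof -
  note hc = hat_carrier
  obtain G where G: "G \<in> HB m \<eta>" and ev: "\<forall>\<^sub>F s in cofinite. - 1 \<notin> spectrum (G s) \<and> F s = cayley m (G s)"
    using HP unfolding HP_def by auto
  have Gc: "G s \<in> cmat m m" for s using G unfolding HB_def rational_matrix_def by auto
  define E where "E = {s. \<not> (- 1 \<notin> spectrum (G s) \<and> F s = cayley m (G s))} \<union> spectrum A \<union> spectrum Ah"
  have E: "finite E" unfolding E_def using ev card_finite_spectrum(1)[OF abcd_carrier(1)] card_finite_spectrum(1)[OF hc(1)]
    unfolding eventually_cofinite by simp
  have contr: "eta_ratio \<eta> * sq_norm (G0 s *\<^sub>v u) \<le> sq_norm u" if s: "0 < Re s" "s \<notin> E" and u: "u \<in> cvec m" for s u
  proof -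
    have "G s = G0 s" by (rule cayley_eq_imp[OF _ _ Gc]) (use s E_def in auto)
    moreover have "pos_semidef m (1\<^sub>m m - complex_of_real (eta_ratio \<eta>) \<cdot>\<^sub>m (adj (G s) * G s))"
      using G s(1) unfolding HB_def by auto
    hence "eta_ratio \<eta> * sq_norm (G s *\<^sub>v u) \<le> sq_norm u"
      using one_minus_gram_pos_semidef[OF Gc[of s]] u by blast
    ultimately show ?thesis by simp
  qed
  show ?thesis
    by (rule exI[of _ E]) (use E contr in \<open>auto simp: E_def\<close>)
qed

text \<open>The hypothesis is affine in \<open>u\<close>, which forces \<open>H * Bh = 0\<close>. So the kernel of \<open>H\<close> contains the range of \<open>Bh\<close>
and is invariant under \<open>Ah\<close>; by controllability it is everything.\<close>

lemma hat_dissipative_zero: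
  assumes H: "H \<in> cmat n n" "adj H = H"
    and neg: "\<And>x u. x \<in> cvec n \<Longrightarrow> u \<in> cvec m \<Longrightarrow> Re ((H *\<^sub>v x) \<bullet>c (Ah *\<^sub>v x + Bh *\<^sub>v u)) \<le> 0"
  shows "H = 0\<^sub>m n n"
proof -
  note hc = hat_carrier
  have negA: "Re ((H *\<^sub>v x) \<bullet>c (Ah *\<^sub>v x)) \<le> 0" if x: "x \<in> cvec n" for x
  proof -
    have "Ah *\<^sub>v x \<in> cvec n" using hc x by auto
    thus ?thesis using neg[OF x zero_carrier_vec] mult_mat_vec_zero[OF hc(2)] by simp
  qed
  have HB: "H *\<^sub>v (Bh *\<^sub>v u) = 0\<^sub>v n" if u: "u \<in> cvec m" for u
  proof (rule ccontr)
    assume ne: "H *\<^sub>v (Bh *\<^sub>v u) \<noteq> 0\<^sub>v n"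
    have Bu: "Bh *\<^sub>v u \<in> cvec n" using hc u by auto
    define x where "x = H *\<^sub>v (Bh *\<^sub>v u)"
    have x: "x \<in> cvec n" unfolding x_def using H Bu by auto
    have c: "H *\<^sub>v x \<in> cvec n" "Ah *\<^sub>v x \<in> cvec n" using H hc x by auto
    have px: "0 < sq_norm x" using cscalar_self_pos[OF x] ne unfolding x_def by simp
    define a where "a = Re ((H *\<^sub>v x) \<bullet>c (Ah *\<^sub>v x))"
    \<comment> \<open>Chosen so that the form takes the positive value 1 at the input \<open>t \<cdot>\<^sub>v u\<close>.\<close>
    define t where "t = (1 - a) / sq_norm x"
    have tu: "complex_of_real t \<cdot>\<^sub>v u \<in> cvec m" using u by auto
    have tB: "complex_of_real t \<cdot>\<^sub>v (Bh *\<^sub>v u) \<in> cvec n" using Bu by auto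
    have "Re ((H *\<^sub>v x) \<bullet>c (Ah *\<^sub>v x + Bh *\<^sub>v (complex_of_real t \<cdot>\<^sub>v u))) = a + t * Re ((H *\<^sub>v x) \<bullet>c (Bh *\<^sub>v u))"
      unfolding mult_mat_vec[OF hc(2) u] cscalar_add_right[OF c(2) tB c(1)] cscalar_smult_right[OF Bu c(1)] a_def by simp
    also have "(H *\<^sub>v x) \<bullet>c (Bh *\<^sub>v u) = x \<bullet>c x" using hermitian_cscalar[OF H x Bu] unfolding x_def by simp
    also have "a + t * sq_norm x = 1" unfolding t_def using px by simp
    finally show False using neg[OF x tu] by simp
  qed
  define V where "V = {v \<in> cvec n. H *\<^sub>v v = 0\<^sub>v n}"
  have "vec_subspace n V" unfolding vec_subspace_def V_def
    using mult_mat_vec_zero[OF H(1)] mult_add_distrib_mat_vec[OF H(1)] mult_mat_vec[OF H(1)] by auto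
  hence V: "V = cvec n"
  proof (rule hautus_full[OF _ hc(1,2)])
    show "Ah *\<^sub>v v \<in> V" if "v \<in> V" for v
      using that dissipative_kernel_invariant[OF hc(1) H negA, of v] hc unfolding V_def by auto
    show "Bh *\<^sub>v u \<in> V" if "u \<in> cvec m" for u using HB[OF that] hc that unfolding V_def by auto
  qed (rule hat_controllable)
  show ?thesis
  proof (rule mat_eq_vecI[OF H(1) zero_carrier_mat])
    fix v :: "complex vec" assume v: "v \<in> cvec n"
    have "0\<^sub>m n n *\<^sub>v v = 0\<^sub>v n" using v by (intro eq_vecI) auto
    thus "H *\<^sub>v v = 0\<^sub>m n n *\<^sub>v v" using V v unfolding V_def by auto
  qed
qed

text \<open>Stability makes the storage semidefinite. On its kernel, which is invariant under \<open>Ah\<close>, no energy is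
dissipated, so \<open>Ch\<close> vanishes there and observability makes the kernel trivial.\<close>

lemma hat_storage_pos_def:
  assumes H: "H \<in> cmat n n" "adj H = H"
    and diss: "\<And>x u. x \<in> cvec n \<Longrightarrow> u \<in> cvec m \<Longrightarrow>
      2 * Re ((H *\<^sub>v x) \<bullet>c (Ah *\<^sub>v x + Bh *\<^sub>v u)) \<le> sq_norm u - eta_ratio \<eta> * sq_norm (Ch *\<^sub>v x + Dh *\<^sub>v u)"
    and stable: "\<And>l. l \<in> spectrum Ah \<Longrightarrow> Re l < 0"
  shows "pos_def n H"
proof -
  note hc = hat_carrier
  note k = eta_ratio_facts(1)[OF eta]
  have dissA: "2 * Re ((H *\<^sub>v x) \<bullet>c (Ah *\<^sub>v x)) \<le> - eta_ratio \<eta> * sq_norm (Ch *\<^sub>v x)" if x: "x \<in> cvec n" for x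
  proof -
    have "Ah *\<^sub>v x \<in> cvec n" "Ch *\<^sub>v x \<in> cvec m" using hc x by auto
    thus ?thesis using diss[OF x zero_carrier_vec] mult_mat_vec_zero[OF hc(2)] mult_mat_vec_zero[OF hc(4)] by simp
  qed
  have negA: "Re ((H *\<^sub>v x) \<bullet>c (Ah *\<^sub>v x)) \<le> 0" if x: "x \<in> cvec n" for x
  proof -
    have "Ch *\<^sub>v x \<in> cvec m" using hc x by auto
    hence "0 \<le> eta_ratio \<eta> * sq_norm (Ch *\<^sub>v x)" using k cscalar_self_Re(2) by simp
    thus ?thesis using dissA[OF x] by simp
  qed
  have Hn: "0 \<le> qform H x" if "x \<in> cvec n" for x
    by (rule stable_lyapunov_nonneg[OF hc(1) H negA stable that])
  have Hpsd: "pos_semidef n H" unfolding pos_semidef_def using H Hn by auto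
  show "pos_def n H" unfolding pos_def_def
  proof (intro conjI ballI impI H)
    fix v :: "complex vec" assume v: "v \<in> cvec n" "v \<noteq> 0\<^sub>v n"
    show "0 < qform H v"
    proof (rule ccontr)
      assume "\<not> 0 < qform H v"
      hence "qform H v = 0" using Hn[OF v(1)] by simp
      hence Hv: "H *\<^sub>v v = 0\<^sub>v n" by (rule pos_semidef_zero_form[OF Hpsd v(1)])
      define U where "U = {v \<in> cvec n. H *\<^sub>v v = 0\<^sub>v n}"
      have U: "vec_subspace n U" unfolding vec_subspace_def U_def
        using mult_mat_vec_zero[OF H(1)] mult_add_distrib_mat_vec[OF H(1)] mult_mat_vec[OF H(1)] by auto
      have ne: "U \<noteq> {0\<^sub>v n}" using v Hv unfolding U_def by auto
      have inv: "\<exists>z' \<in> U. Ah *\<^sub>v z = 1\<^sub>m n *\<^sub>v z'" if "z \<in> U" for z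
        using that dissipative_kernel_invariant[OF hc(1) H negA, of z] hc unfolding U_def
        by (intro bexI[of _ "Ah *\<^sub>v z"]) auto
      obtain z l where z: "z \<in> U" "z \<noteq> 0\<^sub>v n" "Ah *\<^sub>v z = l \<cdot>\<^sub>v (1\<^sub>m n *\<^sub>v z)"
        using pencil_eigenvector[OF U ne hc(1) one_carrier_mat inv] by auto
      have zc: "z \<in> cvec n" "H *\<^sub>v z = 0\<^sub>v n" using z unfolding U_def by auto
      have Cz: "Ch *\<^sub>v z \<in> cvec m" "Ah *\<^sub>v z \<in> cvec n" using hc zc by auto
      have "eta_ratio \<eta> * sq_norm (Ch *\<^sub>v z) \<le> 0" using dissA[OF zc(1)] Cz(2) unfolding zc(2) by simp
      hence "sq_norm (Ch *\<^sub>v z) = 0" using k cscalar_self_Re(2)[OF Cz(1)] by (simp add: mult_le_0_iff)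
      hence "Ch *\<^sub>v z = 0\<^sub>v m" using cscalar_self_eq_0[OF Cz(1)] by simp
      with hat_observable[OF zc(1), of l] z zc show False by simp
    qed
  qed
qed

context
  fixes E :: "complex set"
  assumes E: "finite E" "spectrum Ah \<subseteq> E"
    and bound: "\<forall>s u. 0 < Re s \<longrightarrow> s \<notin> E \<longrightarrow> u \<in> cvec m \<longrightarrow> eta_ratio \<eta> * sq_norm (G0 s *\<^sub>v u) \<le> sq_norm u"
begin

lemma hat_contractive: "0 < Re s \<Longrightarrow> s \<notin> E \<Longrightarrow> u \<in> cvec m \<Longrightarrow> eta_ratio \<eta> * sq_norm (G0 s *\<^sub>v u) \<le> sq_norm u"
  using bound by blast

text \<open>An eigenvalue of \<open>Ah\<close> in the closed right half plane would be a pole of \<open>G0\<close>, approached from a region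
in which \<open>G0\<close> is bounded.\<close>

lemma hat_stable:
  assumes l: "l \<in> spectrum Ah"
  shows "Re l < 0"
proof (rule ccontr)
  note hc = hat_carrier
  note k = eta_ratio_facts(1)[OF eta]
  assume "\<not> Re l < 0"
  hence Rl: "0 \<le> Re l" by simp
  have pos: "\<forall>\<^sub>F \<epsilon> in at_right (0::real). 0 < \<epsilon>" by (simp add: eventually_at_right_less)
  have "l \<notin> spectrum Ah"
  proof (rule hautus_eigenvalue_is_pole[OF hc(1-3) hat_controllable hat_observable])
    fix u y :: "complex vec" assume u: "u \<in> cvec m" and y: "y \<in> cvec m"
    define b where "b = sqrt (sq_norm u / eta_ratio \<eta>)"
    have Du: "Dh *\<^sub>v u \<in> cvec m" using hc u by auto
    have "\<forall>\<^sub>F \<epsilon> in at_right 0. cmod ((Ch *\<^sub>v (resolvent_mat n Ah (l + complex_of_real \<epsilon>) *\<^sub>v (Bh *\<^sub>v u))) \<bullet>c y)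
        \<le> (\<Sum>i<m. b * cmod (y $ i)) + cmod ((Dh *\<^sub>v u) \<bullet>c y)"
      using eventually_avoid_finite[OF E(1), of l] pos
    proof eventually_elim
      case (elim \<epsilon>)
      define s where "s = l + complex_of_real \<epsilon>"
      have s: "0 < Re s" "s \<notin> E" "s \<notin> spectrum Ah" using elim Rl E(2) unfolding s_def by auto
      define a where "a = Ch *\<^sub>v (resolvent_mat n Ah s *\<^sub>v (Bh *\<^sub>v u))"
      have Bu: "Bh *\<^sub>v u \<in> cvec n" using hc u by auto
      have a: "a \<in> cvec m" unfolding a_def using resolvent_vec(1)[OF hc(1) s(3) Bu] hc by auto
      have Gu: "G0 s *\<^sub>v u = a + Dh *\<^sub>v u" unfolding a_def by (rule transfer_mult_vec[OF hc s(3) u])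
      have Guc: "G0 s *\<^sub>v u \<in> cvec m" unfolding Gu using a Du by auto
      have bi: "cmod ((G0 s *\<^sub>v u) $ i) \<le> b" if i: "i < m" for i
      proof -
        have "(cmod ((G0 s *\<^sub>v u) $ i))\<^sup>2 \<le> sq_norm (G0 s *\<^sub>v u)"
          unfolding sq_norm_sum[OF Guc] using i by (intro member_le_sum) auto
        also have "\<dots> \<le> sq_norm u / eta_ratio \<eta>" using hat_contractive[OF s(1,2) u] k by (simp add: field_simps)
        finally show ?thesis unfolding b_def by (rule real_le_rsqrt)
      qed
      have "a \<bullet>c y = (G0 s *\<^sub>v u) \<bullet>c y - (Dh *\<^sub>v u) \<bullet>c y" unfolding Gu cscalar_add_left[OF a Du y] by simp
      hence "cmod (a \<bullet>c y) \<le> cmod ((G0 s *\<^sub>v u) \<bullet>c y) + cmod ((Dh *\<^sub>v u) \<bullet>c y)" by (simp add: norm_triangle_ineq4)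
      also have "cmod ((G0 s *\<^sub>v u) \<bullet>c y) \<le> (\<Sum>i<m. b * cmod (y $ i))"
        unfolding cscalar_sum[OF y] using bi
        by (intro order_trans[OF norm_sum] sum_mono) (auto simp: norm_mult intro!: mult_right_mono simp del: index_mult_mat_vec)
      finally show ?case unfolding a_def s_def by simp
    qed
    thus "bounded_right (\<lambda>\<epsilon>. (Ch *\<^sub>v (resolvent_mat n Ah (l + complex_of_real \<epsilon>) *\<^sub>v (Bh *\<^sub>v u))) \<bullet>c y)"
      unfolding bounded_right_def by blast
  qed
  thus False using l by simp
qed

lemma contractive_at_infinity:
  assumes u: "u \<in> cvec m"
  shows "eta_ratio \<eta> * sq_norm (Dh *\<^sub>v u) \<le> sq_norm u"
proof -
  note hc = hat_carrier
  have Bu: "Bh *\<^sub>v u \<in> cvec n" using hc u by auto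
  have yc: "Dh *\<^sub>v u \<in> cvec m" using hc u by auto
  show ?thesis
  proof (rule sq_norm_limit_le[OF _ _ _ yc])
    show "(at_top :: real filter) \<noteq> bot" by simp
    \<comment> \<open>Beyond all moduli of exceptional points, a positive real number is not exceptional.\<close>
    have "\<forall>\<^sub>F t in at_top. Max (insert 0 (cmod ` E)) < t" by (rule eventually_gt_at_top)
    hence evE: "\<forall>\<^sub>F t in at_top. 0 < t \<and> complex_of_real t \<notin> E"
    proof eventually_elim
      case (elim t)
      have fin: "finite (insert 0 (cmod ` E))" using E(1) by simp
      have t: "0 < t" "\<And>e. e \<in> E \<Longrightarrow> cmod e < t" using elim fin by auto
      show ?case using t(1) t(2)[of "complex_of_real t"] by auto
    qed
    thus "\<forall>\<^sub>F t in at_top. G0 (complex_of_real t) *\<^sub>v u \<in> cvec m \<and> eta_ratio \<eta> * sq_norm (G0 (complex_of_real t) *\<^sub>v u) \<le> sq_norm u"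
    proof eventually_elim
      case (elim t)
      hence "complex_of_real t \<notin> spectrum Ah" using E(2) by auto
      from G0_carrier[OF this] show ?case using hat_contractive[of "complex_of_real t" u] elim u by (auto intro: mult_mat_vec_carrier)
    qed
    fix i assume i: "i < m"
    define X where "X t = resolvent_mat n Ah (complex_of_real t) *\<^sub>v (Bh *\<^sub>v u)" for t
    have "((\<lambda>t. (\<Sum>j<n. Ch $$ (i, j) * X t $ j) + (Dh *\<^sub>v u) $ i) \<longlongrightarrow> (\<Sum>j<n. Ch $$ (i, j) * 0) + (Dh *\<^sub>v u) $ i) at_top"
      unfolding X_def by (intro tendsto_add tendsto_sum tendsto_mult tendsto_const resolvent_at_top(2)[OF hc(1) Bu]) auto
    moreover have "\<forall>\<^sub>F t in at_top. (\<Sum>j<n. Ch $$ (i, j) * X t $ j) + (Dh *\<^sub>v u) $ i = (G0 (complex_of_real t) *\<^sub>v u) $ i"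
      using evE
    proof eventually_elim
      case (elim t)
      hence s: "complex_of_real t \<notin> spectrum Ah" using E(2) by auto
      have Xt: "X t \<in> cvec n" unfolding X_def by (rule resolvent_vec(1)[OF hc(1) s Bu])
      show ?case unfolding transfer_mult_vec[OF hc s u] X_def[symmetric]
        using mult_mat_vec_index_sum[OF hc(3) Xt i] i hc by (simp del: index_mult_mat_vec)
    qed
    ultimately have "((\<lambda>t. (G0 (complex_of_real t) *\<^sub>v u) $ i) \<longlongrightarrow> (\<Sum>j<n. Ch $$ (i, j) * 0) + (Dh *\<^sub>v u) $ i) at_top"
      by (rule Lim_transform_eventually)
    thus "((\<lambda>t. (G0 (complex_of_real t) *\<^sub>v u) $ i) \<longlongrightarrow> (Dh *\<^sub>v u) $ i) at_top"
      by simp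
  qed
qed

lemma contractive_on_axis:
  assumes x: "x \<in> cvec n" and u: "u \<in> cvec m"
    and e: "(\<i> * complex_of_real \<omega>) \<cdot>\<^sub>v x = Ah *\<^sub>v x + Bh *\<^sub>v u"
  shows "eta_ratio \<eta> * sq_norm (Ch *\<^sub>v x + Dh *\<^sub>v u) \<le> sq_norm u"
proof -
  note hc = hat_carrier
  have Bu: "Bh *\<^sub>v u \<in> cvec n" using hc u by auto
  have yc: "Ch *\<^sub>v x + Dh *\<^sub>v u \<in> cvec m" using hc x u by auto
  define l where "l = \<i> * complex_of_real \<omega>"
  have l: "l \<notin> spectrum Ah" using hat_stable[of l] unfolding l_def by auto
  have xr: "x = resolvent_mat n Ah l *\<^sub>v (Bh *\<^sub>v u)"
    by (rule resolvent_unique[OF hc(1) l Bu x]) (use e l_def in simp)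
  have y: "Ch *\<^sub>v x + Dh *\<^sub>v u = G0 l *\<^sub>v u" unfolding transfer_mult_vec[OF hc l u] xr[symmetric] ..
  show ?thesis
  proof (rule sq_norm_limit_le[OF _ _ _ yc])
    show "at_right (0::real) \<noteq> bot" by simp
    have pos: "\<forall>\<^sub>F \<epsilon> in at_right (0::real). 0 < \<epsilon>" by (simp add: eventually_at_right_less)
    show "\<forall>\<^sub>F \<epsilon> in at_right 0. G0 (l + complex_of_real \<epsilon>) *\<^sub>v u \<in> cvec m \<and> eta_ratio \<eta> * sq_norm (G0 (l + complex_of_real \<epsilon>) *\<^sub>v u) \<le> sq_norm u"
      using pos eventually_avoid_finite[OF E(1), of l]
    proof eventually_elim
      case (elim \<epsilon>)
      hence "l + complex_of_real \<epsilon> \<notin> spectrum Ah" using E(2) by auto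
      from G0_carrier[OF this] show ?case using hat_contractive[of "l + complex_of_real \<epsilon>" u] elim u
        by (auto intro: mult_mat_vec_carrier simp: l_def)
    qed
    show "((\<lambda>\<epsilon>. (G0 (l + complex_of_real \<epsilon>) *\<^sub>v u) $ i) \<longlongrightarrow> (Ch *\<^sub>v x + Dh *\<^sub>v u) $ i) (at_right 0)" if "i < m" for i
      unfolding y by (rule transfer_tendsto[OF hc l u that])
  qed
qed

text \<open>The frequency condition of the Kalman--Yakubovich--Popov lemma splits into the behaviour at infinity,
where the state is \<open>0\<close>, and on the imaginary axis, where the velocity is an imaginary multiple of the state.\<close>

lemma storage_exists:
  "\<exists>H. H \<in> cmat n n \<and> adj H = H \<and> (\<forall>x \<in> cvec n. \<forall>u \<in> cvec m.
    2 * Re ((H *\<^sub>v x) \<bullet>c (Ah *\<^sub>v x + Bh *\<^sub>v u)) \<le> sq_norm u - eta_ratio \<eta> * sq_norm (Ch *\<^sub>v x + Dh *\<^sub>v u))"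
proof -
  note hc = hat_carrier
  obtain N where N: "N \<in> cmat n (n + m)" and Nv: "\<And>x u. x \<in> cvec n \<Longrightarrow> u \<in> cvec m \<Longrightarrow> N *\<^sub>v (x @\<^sub>v u) = Ah *\<^sub>v x + Bh *\<^sub>v u"
    using row_block_exists[OF hc(1,2)] by auto
  from row_block_exists[OF one_carrier_mat[of n] zero_carrier_mat[of n m]]
  obtain J :: "complex mat" where J: "J \<in> cmat n (n + m)"
    and Jb: "\<forall>x \<in> cvec n. \<forall>u \<in> cvec m. J *\<^sub>v (x @\<^sub>v u) = 1\<^sub>m n *\<^sub>v x + 0\<^sub>m n m *\<^sub>v u"
    by (rule bexE)
  have Jv: "J *\<^sub>v (x @\<^sub>v u) = x" if "x \<in> cvec n" "u \<in> cvec m" for x u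
  proof -
    have "0\<^sub>m n m *\<^sub>v u = 0\<^sub>v n" using that(2) by (intro eq_vecI) auto
    moreover have "J *\<^sub>v (x @\<^sub>v u) = 1\<^sub>m n *\<^sub>v x + 0\<^sub>m n m *\<^sub>v u" using Jb that by simp
    ultimately show ?thesis using that(1) by simp
  qed
  define Q0 where "Q0 = lmi (0\<^sub>m n n)"
  have H0: "0\<^sub>m n n \<in> cmat n n" "adj (0\<^sub>m n n :: complex mat) = 0\<^sub>m n n" by (auto simp: mat_adjoint_zero)
  have Q0: "Q0 \<in> cmat (n + m) (n + m)" "adj Q0 = Q0" unfolding Q0_def using lmi_carrier_hermitian[OF H0] by auto
  have Q0f: "qform Q0 (x @\<^sub>v u) = sq_norm u - eta_ratio \<eta> * sq_norm (Ch *\<^sub>v x + Dh *\<^sub>v u)"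
    if x: "x \<in> cvec n" and u: "u \<in> cvec m" for x u
  proof -
    have z: "0\<^sub>m n n *\<^sub>v x = 0\<^sub>v n" using x by (intro eq_vecI) auto
    have "Ah *\<^sub>v x + Bh *\<^sub>v u \<in> cvec n" using hc x u by auto
    thus ?thesis unfolding Q0_def lmi_form[OF H0 x u] z by simp
  qed
  have ctrl: "H = 0\<^sub>m n n" if H: "H \<in> cmat n n" "adj H = H"
    and neg: "\<And>z. z \<in> cvec (n + m) \<Longrightarrow> Re ((H *\<^sub>v (J *\<^sub>v z)) \<bullet>c (N *\<^sub>v z)) \<le> 0" for H
  proof (rule hat_dissipative_zero[OF H])
    show "Re ((H *\<^sub>v x) \<bullet>c (Ah *\<^sub>v x + Bh *\<^sub>v u)) \<le> 0" if "x \<in> cvec n" "u \<in> cvec m" for x u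
      using neg[of "x @\<^sub>v u"] that by (simp add: Nv Jv)
  qed
  have freq: "0 \<le> qform Q0 z" if z: "z \<in> cvec (n + m)"
    and alt: "J *\<^sub>v z = 0\<^sub>v n \<or> N *\<^sub>v z = (\<i> * complex_of_real \<omega>) \<cdot>\<^sub>v (J *\<^sub>v z)" for z \<omega>
  proof -
    obtain x u where x: "x \<in> cvec n" and u: "u \<in> cvec m" and zxu: "z = x @\<^sub>v u" using split_vec[OF z] by auto
    have Du: "Dh *\<^sub>v u \<in> cvec m" using hc u by auto
    have "eta_ratio \<eta> * sq_norm (Ch *\<^sub>v x + Dh *\<^sub>v u) \<le> sq_norm u"
      using alt
    proof
      assume "J *\<^sub>v z = 0\<^sub>v n"
      hence "x = 0\<^sub>v n" using Jv[OF x u] zxu by simp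
      thus ?thesis using contractive_at_infinity[OF u] mult_mat_vec_zero[OF hc(3)] Du by simp
    next
      assume "N *\<^sub>v z = (\<i> * complex_of_real \<omega>) \<cdot>\<^sub>v (J *\<^sub>v z)"
      hence "(\<i> * complex_of_real \<omega>) \<cdot>\<^sub>v x = Ah *\<^sub>v x + Bh *\<^sub>v u" using Jv[OF x u] Nv[OF x u] zxu by simp
      thus ?thesis by (rule contractive_on_axis[OF x u])
    qed
    thus ?thesis unfolding zxu Q0f[OF x u] by simp
  qed
  have "\<exists>H. H \<in> cmat n n \<and> adj H = H \<and>
    (\<forall>z \<in> cvec (n + m). 2 * Re ((H *\<^sub>v (J *\<^sub>v z)) \<bullet>c (N *\<^sub>v z)) \<le> qform Q0 z)"
    by (rule kyp_lemma[OF N J Q0]) (fact ctrl, fact freq)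
  then obtain H where H: "H \<in> cmat n n" "adj H = H"
    and Hz: "\<forall>z \<in> cvec (n + m). 2 * Re ((H *\<^sub>v (J *\<^sub>v z)) \<bullet>c (N *\<^sub>v z)) \<le> qform Q0 z"
    by (elim exE conjE)
  have "2 * Re ((H *\<^sub>v x) \<bullet>c (Ah *\<^sub>v x + Bh *\<^sub>v u)) \<le> sq_norm u - eta_ratio \<eta> * sq_norm (Ch *\<^sub>v x + Dh *\<^sub>v u)"
    if x: "x \<in> cvec n" and u: "u \<in> cvec m" for x u
    using bspec[OF Hz, of "x @\<^sub>v u"] x u Nv[OF x u] Jv[OF x u] Q0f[OF x u] by simp
  thus ?thesis using H by blast
qed

end

lemma HP_imp_lmi:
  assumes HP: "F \<in> HP m \<eta>"
  shows "\<exists>H. pos_def n H \<and> pos_semidef (n + m) (lmi H)"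
proof -
  obtain E where E: "finite E" "spectrum Ah \<subseteq> E"
    and bound: "\<forall>s u. 0 < Re s \<longrightarrow> s \<notin> E \<longrightarrow> u \<in> cvec m \<longrightarrow> eta_ratio \<eta> * sq_norm (G0 s *\<^sub>v u) \<le> sq_norm u"
    using HP_contractive[OF HP] by (elim exE conjE)
  obtain H where H: "H \<in> cmat n n" "adj H = H"
    and d: "\<forall>x \<in> cvec n. \<forall>u \<in> cvec m. 2 * Re ((H *\<^sub>v x) \<bullet>c (Ah *\<^sub>v x + Bh *\<^sub>v u)) \<le> sq_norm u - eta_ratio \<eta> * sq_norm (Ch *\<^sub>v x + Dh *\<^sub>v u)"
    using storage_exists[OF E bound] by (elim exE conjE)
  have diss: "2 * Re ((H *\<^sub>v x) \<bullet>c (Ah *\<^sub>v x + Bh *\<^sub>v u)) \<le> sq_norm u - eta_ratio \<eta> * sq_norm (Ch *\<^sub>v x + Dh *\<^sub>v u)"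
    if "x \<in> cvec n" "u \<in> cvec m" for x u using d that by simp
  have L: "pos_semidef (n + m) (lmi H)" unfolding pos_semidef_def
  proof (intro conjI ballI lmi_carrier_hermitian[OF H])
    fix z :: "complex vec" assume "z \<in> cvec (n + m)"
    then obtain x u where x: "x \<in> cvec n" and u: "u \<in> cvec m" and zxu: "z = x @\<^sub>v u" using split_vec by blast
    show "0 \<le> qform (lmi H) z" unfolding zxu lmi_form[OF H x u] using diss[OF x u] by simp
  qed
  have "pos_def n H" by (rule hat_storage_pos_def[OF H diss hat_stable[OF E bound]])
  thus ?thesis using L by blast
qed

end

theorem theorem6p3:
  fixes F :: "complex \<Rightarrow> complex mat"
    and A B C D :: "complex mat"
    and m n :: nat
    and \<eta> :: ereal
  assumes "rational_matrix m F"
    and "no_pole_at_infinity m F"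
    and "minimal_realization m n F A B C D"
    and "- 1 \<notin> spectrum D"
    and "1 < \<eta>"
  shows "F \<in> HP m \<eta> \<longleftrightarrow>
    (\<exists>H. pos_def n H \<and>
      pos_semidef (n + m) (mat_adjoint (M_mat m n A B C D) * W_mat m n \<eta> H * M_mat m n A B C D))"
  using lmi_imp_HP[OF assms(1,3,4,5)] HP_imp_lmi[OF assms(1,3,4,5)] by blast

end
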